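(* (Decidability of type checking.) All typing judgments of CoLF are algorithmically decidable: given the inputs, it is decidable whether $\Sigma\ \mathsf{sig}$, $\vdash_\Sigma\Xi\ \mathsf{sig}$, $\vdash_{\Xi;\Sigma}\Gamma\ \mathsf{ctx}$, $\Gamma\vdash_{\Xi;\Sigma}K\Leftarrow\mathsf{kind}$, $\Gamma\vdash_{\Xi;\Sigma}A\Leftarrow\mathsf{type}/\mathsf{cotype}$, $\Gamma\vdash_{\Xi;\Sigma}M\Leftarrow A$, $\Gamma\vdash_\Sigma A_1=A_2$ and $\Gamma\vdash_\Sigma P_1=P_2$ hold, and the synthesis judgments $\Gamma\vdash_{\Xi;\Sigma}P\Rightarrow K$, $\Gamma\vdash_{\Xi;\Sigma}S\rhd K\Rightarrow K'$, $\Gamma\vdash_{\Xi;\Sigma}R\Rightarrow P$, $\Gamma\vdash_{\Xi;\Sigma}S\rhd A\Rightarrow P$ can be decided (computing the output or failing).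
   Context: CoLF syntax: signatures $\Sigma$ with declarations $a:K$, $c:A$, $r:A=M$ (recursion constants; bodies may refer to recursion constants declared later, all other references are to earlier declarations); contexts $\Gamma::=\cdot\mid\Gamma,x{:}A\mid\Gamma,x\,\hat{:}\,A$; kinds $K::=\mathsf{type}\mid\mathsf{cotype}\mid\Pi x{:}A.K\mid\Pi x\,\hat{:}\,A.K$; types $A::=P\mid\Pi x{:}A_2.A_1\mid\Pi x\,\hat{:}\,A_2.A_1$, $P::=a\cdot S$; terms $M::=R\mid\lambda x.M$, $R::=H\cdot S$, $H::=x\mid c\mid r$; spines $S::=()\mid M;S\mid[y];S$. Hereditary substitution $[N/x]^\tau$ on simple types $\tau::=*\mid\tau_1\to\tau_2$ (erasure $(\Pi x{:}A_2.A_1)^o=A_2^o\to A_1^o$, $(\Pi x\,\hat{:}\,A_2.A_1)^o=*\to A_1^o$, $P^o=*$) and renaming $\{y/x\}$ are as usual for canonical LF, with $([y];S)\rhd^{*\to\tau}(\lambda x.M)=S\rhd^\tau\{y/x\}M$ and substitution for a prepattern argument undefined. Rules. $\Sigma\ \mathsf{sig}$ iff $\vdash_\Sigma\Sigma\ \mathsf{sig}$. $\vdash_\Sigma\Xi\ \mathsf{sig}$: empty is fine; $\Xi,a{:}K$ if $\Xi$ ok and $\vdash_{\Xi;\Sigma}K\Leftarrow\mathsf{kind}$; $\Xi,c{:}A$ if $\Xi$ ok and $A\Leftarrow\mathsf{type}/\mathsf{cotype}$; $\Xi,r{:}A=M$ if $\Xi$ ok, $\vdash_{\Xi;\Sigma}A\Leftarrow\mathsf{type}/\mathsf{cotype}$,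 $A$ consists only of prepattern $\Pi$'s over an atomic type, $M$ is contractive (its head is not a recursion constant), $r$ is guarded in $M$ (every path from the root of $M$, unfolding other recursion constants of $\Sigma$, to an occurrence of $r$ passes through a coinductive constructor whose priority is highest among the constructors on that path; priorities: later-declared type families have higher priority, constructors inherit the priority of their target family, a constructor is coinductive if its target family's kind ends in $\mathsf{cotype}$), and — deferred until all declarations of $\Sigma$ have been checked — $\vdash_{\Xi;\Sigma}M\Leftarrow A$. Contexts: each added $x{:}A$ or $x\,\hat{:}\,A$ needs $A\Leftarrow\mathsf{type}/\mathsf{cotype}$. Kinds: $\mathsf{type},\mathsf{cotype}\Leftarrow\mathsf{kind}$; $\Pi x{:}A.K$ / $\Pi x\,\hat{:}\,A.K$ if $A\Leftarrow\mathsf{type}/\mathsf{cotype}$ and $K\Leftarrow\mathsf{kind}$ in the extended context. Types: $\Pi$'s similarly; $P\Leftarrow\mathsf{type}/\mathsf{cotype}$ if $P\Rightarrow\mathsf{type}$ or $\mathsf{cotype}$; $a\cdot S\Rightarrow K'$ if $a{:}K\in\Xi$ and $S\rhd K\Rightarrow K'$; kind spines: $()\rhd K\Rightarrow K$, $M;S\rhd\Pi x{:}A_2.K$ if $M\Leftarrow A_2$ and $S\rhd[M/x]^{A_2^o}K$, $[y];S\rhd\Pi x\,\hat{:}\,A_2.K$ if $y\,\hat{:}\,A_2'\in\Gamma$, $A_2'=A_2$ and $S\rhd\{y/x\}K$. Terms: $\lambda x.M\Leftarrow\Pi x{:}A_2.A_1$ / $\Pi x\,\hat{:}\,A_2.A_1$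 if $M\Leftarrow A_1$ in $\Gamma,x{:}A_2$ / $\Gamma,x\,\hat{:}\,A_2$; $R\Leftarrow P$ if $R\Rightarrow P'$ and $\Gamma\vdash_\Sigma P'=P$; $x\cdot S\Rightarrow P$ if $x{:}A$ or $x\,\hat{:}\,A$ in $\Gamma$ and $S\rhd A\Rightarrow P$; $c\cdot S\Rightarrow P$ if $c{:}A\in\Xi$ and $S\rhd A\Rightarrow P$; $r\cdot S\Rightarrow P$ if $r{:}A=M\in\Xi$ (or $\in\Sigma$ while checking deferred bodies) and $S\rhd A\Rightarrow P$; type spines analogous to kind spines, ending with $()\rhd P\Rightarrow P$. Type equality: structural on $\Pi$'s, and $a\cdot S=a\cdot S'$ iff $\cdot;|\Gamma|\vdash_\Sigma S=S'$ in the CoLF term equality algorithm, which decides equality of the infinite Böhm-tree unfoldings of rational terms (unfolding $r\cdot S$ with $S$ a prepattern spine to $S\rhd^{A^o}M$, memoising encountered equations and closing a goal when it is a variable renaming of a memoised equation). *)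

theory Defs
  imports Main "HOL-Library.Nat_Bijection" "HOL-Library.Monad_Syntax"
begin

section \<open>Computability\<close>

text \<open>Kleene's \<open>\<mu>\<close>-recursive functions.  A primitive recursion takes its recursion argument
  first, and its step function receives the predecessor, the previous value and the parameters;
  minimisation is over the first argument.\<close>

datatype recf =
    RZero
  | RSucc
  | RProj nat
  | RComp recf "recf list"
  | RPrim recf recf
  | RMu recf

inductive rec_eval :: "recf \<Rightarrow> nat list \<Rightarrow> nat \<Rightarrow> bool" where
  "rec_eval RZero xs 0"
| "rec_eval RSucc [x] (Suc x)"
| "i < length xs \<Longrightarrow> rec_eval (RProj i) xs (xs ! i)"
| "\<lbrakk>list_all2 (\<lambda>g y. rec_eval g xs y) gs ys; rec_eval f ys z\<rbrakk> \<Longrightarrow> rec_eval (RComp f gs) xs z"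
| "rec_eval f xs y \<Longrightarrow> rec_eval (RPrim f g) (0 # xs) y"
| "\<lbrakk>rec_eval (RPrim f g) (n # xs) y; rec_eval g (n # y # xs) z\<rbrakk>
    \<Longrightarrow> rec_eval (RPrim f g) (Suc n # xs) z"
| "\<lbrakk>rec_eval f (n # xs) 0; \<forall>m<n. \<exists>y. rec_eval f (m # xs) (Suc y)\<rbrakk> \<Longrightarrow> rec_eval (RMu f) xs n"

inductive_cases rec_eval_RZeroE: "rec_eval RZero xs y"
inductive_cases rec_eval_RSuccE: "rec_eval RSucc xs y"
inductive_cases rec_eval_RProjE: "rec_eval (RProj i) xs y"
inductive_cases rec_eval_RCompE: "rec_eval (RComp f gs) xs y"
inductive_cases rec_eval_RPrim0E: "rec_eval (RPrim f g) (0 # xs) y"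
inductive_cases rec_eval_RPrimSucE: "rec_eval (RPrim f g) (Suc n # xs) y"
inductive_cases rec_eval_RMuE: "rec_eval (RMu f) xs y"

lemma rec_eval_deterministic: "rec_eval f xs y \<Longrightarrow> rec_eval f xs z \<Longrightarrow> y = z"
proof (induction arbitrary: z rule: rec_eval.induct)
  case (1 xs)
  then show ?case by (rule rec_eval_RZeroE) simp
next
  case (2 x)
  then show ?case by (rule rec_eval_RSuccE) simp
next
  case (3 i xs)
  from "3.prems" show ?case by (rule rec_eval_RProjE) simp
next
  case (4 xs gs ys f w)
  from "4.prems" obtain ys' where ys': "list_all2 (\<lambda>g y. rec_eval g xs y) gs ys'" "rec_eval f ys' z"
    by (rule rec_eval_RCompE)
  have "ys = ys'"
  proof (rule nth_equalityI)
    show "length ys = length ys'"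
      using list_all2_lengthD[OF "4.IH"(1)] list_all2_lengthD[OF ys'(1)] by simp
    fix i
    assume "i < length ys"
    then have i: "i < length gs" using list_all2_lengthD[OF "4.IH"(1)] by simp
    show "ys ! i = ys' ! i"
      using list_all2_nthD[OF "4.IH"(1) i] list_all2_nthD[OF ys'(1) i] by blast
  qed
  with ys'(2) have "rec_eval f ys z" by simp
  then show ?case by (rule "4.IH"(2))
next
  case (5 f xs y g)
  from "5.prems" have "rec_eval f xs z" by (rule rec_eval_RPrim0E)
  then show ?case by (rule "5.IH")
next
  case (6 f g n xs y w)
  from "6.prems" obtain y' where y': "rec_eval (RPrim f g) (n # xs) y'" "rec_eval g (n # y' # xs) z"
    by (rule rec_eval_RPrimSucE)
  have "y = y'" using y'(1) by (rule "6.IH"(1))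
  with y'(2) have "rec_eval g (n # y # xs) z" by simp
  then show ?case by (rule "6.IH"(2))
next
  case (7 f n xs)
  from "7.prems" have z: "rec_eval f (z # xs) 0" "\<forall>m<z. \<exists>y. rec_eval f (m # xs) (Suc y)"
    by (blast elim: rec_eval_RMuE)+
  have "\<not> n < z"
  proof
    assume "n < z"
    with z(2) obtain y where "rec_eval f (n # xs) (Suc y)" by blast
    then have "0 = Suc y" by (rule "7.IH"(1))
    then show False by simp
  qed
  moreover have "\<not> z < n"
  proof
    assume "z < n"
    with "7.IH"(2) obtain y where "\<forall>w. rec_eval f (z # xs) w \<longrightarrow> Suc y = w" by blast
    with z(1) have "Suc y = 0" by blast
    then show False by simp
  qed
  ultimately show ?case by simp
qed

class godel =
  fixes gcode :: "'a \<Rightarrow> nat"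
  assumes gcode_inject: "gcode x = gcode y \<Longrightarrow> x = y"

lemma gcode_eq_iff [simp]: "gcode x = gcode y \<longleftrightarrow> x = (y :: 'a::godel)"
  using gcode_inject by blast

definition computable :: "('a::godel \<Rightarrow> 'b::godel) \<Rightarrow> bool" where
  "computable g \<longleftrightarrow> (\<exists>f. \<forall>x. rec_eval f [gcode x] (gcode (g x)))"

definition decidable :: "('a::godel \<Rightarrow> bool) \<Rightarrow> bool" where
  "decidable P \<longleftrightarrow> (\<exists>f. \<forall>x. rec_eval f [gcode x] (if P x then 1 else 0))"

instantiation nat :: godel
begin
definition gcode_nat :: "nat \<Rightarrow> nat" where "gcode_nat n = n"
instance by standard (simp add: gcode_nat_def)
end

instantiation bool :: godel
begin
definition gcode_bool :: "bool \<Rightarrow> nat" where "gcode_bool b = (if b then 1 else 0)"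
instance by standard (simp add: gcode_bool_def split: if_splits)
end

instantiation prod :: (godel, godel) godel
begin
definition gcode_prod :: "'a \<times> 'b \<Rightarrow> nat" where
  "gcode_prod p = prod_encode (gcode (fst p), gcode (snd p))"
instance by standard (simp add: gcode_prod_def prod_eq_iff)
end

instantiation option :: (godel) godel
begin
definition gcode_option :: "'a option \<Rightarrow> nat" where
  "gcode_option z = (case z of None \<Rightarrow> 0 | Some x \<Rightarrow> Suc (gcode x))"
instance by standard (auto simp: gcode_option_def split: option.splits)
end

instantiation list :: (godel) godel
begin
definition gcode_list :: "'a list \<Rightarrow> nat" where
  "gcode_list xs = list_encode (map gcode xs)"
instance by standard (simp add: gcode_list_def list_encode_eq inj_map_eq_map inj_def)
end

text \<open>For a judgment \<open>J\<close> with input \<open>x\<close> and output \<open>y\<close>: a total algorithm that returns the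
  output if there is one and reports failure (\<open>None\<close>) otherwise; in particular the output is
  determined by the input.\<close>

definition decidable_synth :: "('a::godel \<Rightarrow> 'b::godel \<Rightarrow> bool) \<Rightarrow> bool" where
  "decidable_synth J \<longleftrightarrow> (\<exists>g. computable g \<and> (\<forall>x y. J x y \<longleftrightarrow> g x = Some y))"


section \<open>Syntax\<close>

text \<open>Variables are de Bruijn indices.  Type families, constructors and recursion constants are
  named by natural numbers, in three separate name spaces.  In signatures and contexts the most
  recent declaration is the head of the list, so that \<open>d # \<Xi>\<close> is the signature \<open>\<Xi>, d\<close>.\<close>

datatype head = Var nat | Con nat | Rec nat

datatype tm = Neu neu | Lam tm
  and neu = App head spine
  and spine = SNil | SArg tm spine | SPre nat spine

datatype aty = Fam nat spine

datatype ty = Atom aty | Pi ty ty | PrePi ty ty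

datatype kind = Type | Cotype | KPi ty kind | KPrePi ty kind

datatype decl = FamDecl nat kind | ConDecl nat ty | RecDecl nat ty tm

type_synonym sig = "decl list"

datatype binding = Ord ty | Pre ty

type_synonym ctx = "binding list"

datatype stp = Base | Arr stp stp

primrec erase :: "ty \<Rightarrow> stp" where
  "erase (Atom P) = Base"
| "erase (Pi A2 A1) = Arr (erase A2) (erase A1)"
| "erase (PrePi A2 A1) = Arr Base (erase A1)"

primrec fam_kind :: "sig \<Rightarrow> nat \<Rightarrow> kind option" where
  "fam_kind [] a = None"
| "fam_kind (d # \<Xi>) a =
    (case d of FamDecl b K \<Rightarrow> if b = a then Some K else fam_kind \<Xi> a | _ \<Rightarrow> fam_kind \<Xi> a)"

primrec con_type :: "sig \<Rightarrow> nat \<Rightarrow> ty option" where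
  "con_type [] c = None"
| "con_type (d # \<Xi>) c =
    (case d of ConDecl b A \<Rightarrow> if b = c then Some A else con_type \<Xi> c | _ \<Rightarrow> con_type \<Xi> c)"

primrec rec_def :: "sig \<Rightarrow> nat \<Rightarrow> (ty \<times> tm) option" where
  "rec_def [] r = None"
| "rec_def (d # \<Xi>) r =
    (case d of RecDecl b A M \<Rightarrow> if b = r then Some (A, M) else rec_def \<Xi> r | _ \<Rightarrow> rec_def \<Xi> r)"


section \<open>Goedel numbers of the syntax\<close>

primrec code_head :: "head \<Rightarrow> nat" where
  "code_head (Var x) = prod_encode (0, x)"
| "code_head (Con c) = prod_encode (1, c)"
| "code_head (Rec r) = prod_encode (2, r)"

primrec code_tm :: "tm \<Rightarrow> nat" and code_neu :: "neu \<Rightarrow> nat" and code_spine :: "spine \<Rightarrow> nat" where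
  "code_tm (Neu R) = prod_encode (0, code_neu R)"
| "code_tm (Lam M) = prod_encode (1, code_tm M)"
| "code_neu (App H S) = prod_encode (code_head H, code_spine S)"
| "code_spine SNil = prod_encode (0, 0)"
| "code_spine (SArg M S) = prod_encode (1, prod_encode (code_tm M, code_spine S))"
| "code_spine (SPre y S) = prod_encode (2, prod_encode (y, code_spine S))"

primrec code_aty :: "aty \<Rightarrow> nat" where
  "code_aty (Fam a S) = prod_encode (a, code_spine S)"

primrec code_ty :: "ty \<Rightarrow> nat" where
  "code_ty (Atom P) = prod_encode (0, code_aty P)"
| "code_ty (Pi A2 A1) = prod_encode (1, prod_encode (code_ty A2, code_ty A1))"
| "code_ty (PrePi A2 A1) = prod_encode (2, prod_encode (code_ty A2, code_ty A1))"

primrec code_kind :: "kind \<Rightarrow> nat" where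
  "code_kind Type = prod_encode (0, 0)"
| "code_kind Cotype = prod_encode (1, 0)"
| "code_kind (KPi A K) = prod_encode (2, prod_encode (code_ty A, code_kind K))"
| "code_kind (KPrePi A K) = prod_encode (3, prod_encode (code_ty A, code_kind K))"

primrec code_decl :: "decl \<Rightarrow> nat" where
  "code_decl (FamDecl a K) = prod_encode (0, prod_encode (a, code_kind K))"
| "code_decl (ConDecl c A) = prod_encode (1, prod_encode (c, code_ty A))"
| "code_decl (RecDecl r A M) = prod_encode (2, prod_encode (r, prod_encode (code_ty A, code_tm M)))"

primrec code_binding :: "binding \<Rightarrow> nat" where
  "code_binding (Ord A) = prod_encode (0, code_ty A)"
| "code_binding (Pre A) = prod_encode (1, code_ty A)"

lemma code_head_inject: "code_head H = code_head H' \<Longrightarrow> H = H'"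
  by (cases H; cases H') auto

lemma
  shows code_tm_inject: "code_tm M = code_tm M' \<Longrightarrow> M = M'"
    and code_neu_inject: "code_neu R = code_neu R' \<Longrightarrow> R = R'"
    and code_spine_inject: "code_spine S = code_spine S' \<Longrightarrow> S = S'"
proof (induction M and R and S arbitrary: M' and R' and S')
  case (Neu R) then show ?case by (cases M') auto
next
  case (Lam M) then show ?case by (cases M') auto
next
  case (App H S) then show ?case by (cases R') (auto dest: code_head_inject)
next
  case SNil then show ?case by (cases S') auto
next
  case (SArg M S) then show ?case by (cases S') auto
next
  case (SPre y S) then show ?case by (cases S') auto
qed

lemma code_aty_inject: "code_aty P = code_aty P' \<Longrightarrow> P = P'"
  by (cases P; cases P') (auto dest: code_spine_inject)

lemma code_ty_inject: "code_ty A = code_ty A' \<Longrightarrow> A = A'"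
proof (induction A arbitrary: A')
  case (Atom P) then show ?case by (cases A') (auto dest: code_aty_inject)
next
  case (Pi A2 A1) then show ?case by (cases A') auto
next
  case (PrePi A2 A1) then show ?case by (cases A') auto
qed

lemma code_kind_inject: "code_kind K = code_kind K' \<Longrightarrow> K = K'"
proof (induction K arbitrary: K')
  case Type then show ?case by (cases K') auto
next
  case Cotype then show ?case by (cases K') auto
next
  case (KPi A K) then show ?case by (cases K') (auto dest: code_ty_inject)
next
  case (KPrePi A K) then show ?case by (cases K') (auto dest: code_ty_inject)
qed

lemma code_decl_inject: "code_decl d = code_decl d' \<Longrightarrow> d = d'"
  by (cases d; cases d') (auto dest: code_kind_inject code_ty_inject code_tm_inject)

lemma code_binding_inject: "code_binding b = code_binding b' \<Longrightarrow> b = b'"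
  by (cases b; cases b') (auto dest: code_ty_inject)

instantiation tm :: godel
begin
definition "gcode_tm = code_tm"
instance by standard (simp add: gcode_tm_def code_tm_inject)
end

instantiation neu :: godel
begin
definition "gcode_neu = code_neu"
instance by standard (simp add: gcode_neu_def code_neu_inject)
end

instantiation spine :: godel
begin
definition "gcode_spine = code_spine"
instance by standard (simp add: gcode_spine_def code_spine_inject)
end

instantiation aty :: godel
begin
definition "gcode_aty = code_aty"
instance by standard (simp add: gcode_aty_def code_aty_inject)
end

instantiation ty :: godel
begin
definition "gcode_ty = code_ty"
instance by standard (simp add: gcode_ty_def code_ty_inject)
end

instantiation kind :: godel
begin
definition "gcode_kind = code_kind"
instance by standard (simp add: gcode_kind_def code_kind_inject)
end

instantiation decl :: godel
begin
definition "gcode_decl = code_decl"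
instance by standard (simp add: gcode_decl_def code_decl_inject)
end

instantiation binding :: godel
begin
definition "gcode_binding = code_binding"
instance by standard (simp add: gcode_binding_def code_binding_inject)
end


section \<open>Renaming and hereditary substitution\<close>

definition up :: "(nat \<Rightarrow> nat) \<Rightarrow> nat \<Rightarrow> nat" where
  "up \<rho> = case_nat 0 (\<lambda>i. Suc (\<rho> i))"

primrec ren_head :: "(nat \<Rightarrow> nat) \<Rightarrow> head \<Rightarrow> head" where
  "ren_head \<rho> (Var x) = Var (\<rho> x)"
| "ren_head \<rho> (Con c) = Con c"
| "ren_head \<rho> (Rec r) = Rec r"

primrec ren_tm :: "tm \<Rightarrow> (nat \<Rightarrow> nat) \<Rightarrow> tm"
  and ren_neu :: "neu \<Rightarrow> (nat \<Rightarrow> nat) \<Rightarrow> neu"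
  and ren_spine :: "spine \<Rightarrow> (nat \<Rightarrow> nat) \<Rightarrow> spine" where
  "ren_tm (Neu R) \<rho> = Neu (ren_neu R \<rho>)"
| "ren_tm (Lam M) \<rho> = Lam (ren_tm M (up \<rho>))"
| "ren_neu (App H S) \<rho> = App (ren_head \<rho> H) (ren_spine S \<rho>)"
| "ren_spine SNil \<rho> = SNil"
| "ren_spine (SArg M S) \<rho> = SArg (ren_tm M \<rho>) (ren_spine S \<rho>)"
| "ren_spine (SPre y S) \<rho> = SPre (\<rho> y) (ren_spine S \<rho>)"

primrec ren_aty :: "aty \<Rightarrow> (nat \<Rightarrow> nat) \<Rightarrow> aty" where
  "ren_aty (Fam a S) \<rho> = Fam a (ren_spine S \<rho>)"

primrec ren_ty :: "ty \<Rightarrow> (nat \<Rightarrow> nat) \<Rightarrow> ty" where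
  "ren_ty (Atom P) \<rho> = Atom (ren_aty P \<rho>)"
| "ren_ty (Pi A2 A1) \<rho> = Pi (ren_ty A2 \<rho>) (ren_ty A1 (up \<rho>))"
| "ren_ty (PrePi A2 A1) \<rho> = PrePi (ren_ty A2 \<rho>) (ren_ty A1 (up \<rho>))"

primrec ren_kind :: "kind \<Rightarrow> (nat \<Rightarrow> nat) \<Rightarrow> kind" where
  "ren_kind Type \<rho> = Type"
| "ren_kind Cotype \<rho> = Cotype"
| "ren_kind (KPi A K) \<rho> = KPi (ren_ty A \<rho>) (ren_kind K (up \<rho>))"
| "ren_kind (KPrePi A K) \<rho> = KPrePi (ren_ty A \<rho>) (ren_kind K (up \<rho>))"

text \<open>The renaming \<open>{y/x}\<close> for the outermost bound variable \<open>x\<close> (index 0) of a binder body.\<close>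

definition inst :: "nat \<Rightarrow> nat \<Rightarrow> nat" where
  "inst y = case_nat y (\<lambda>i. i)"

text \<open>\<open>hsub_tm \<tau> x N M\<close> is \<open>[N/x]\<^sup>\<tau> M\<close>, where the index \<open>x\<close> is removed from the context and
  \<open>N\<close> lives in the context without \<open>x\<close>; \<open>happ \<tau> S M\<close> is \<open>S \<rhd>\<^sup>\<tau> M\<close>.
  Both are partial functions.\<close>

definition drop_var :: "nat \<Rightarrow> nat \<Rightarrow> nat" where
  "drop_var x y = (if x < y then y - 1 else y)"

function (sequential)
      hsub_tm :: "stp \<Rightarrow> nat \<Rightarrow> tm \<Rightarrow> tm \<Rightarrow> tm option"
  and hsub_neu :: "stp \<Rightarrow> nat \<Rightarrow> tm \<Rightarrow> neu \<Rightarrow> neu option"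
  and hsub_spine :: "stp \<Rightarrow> nat \<Rightarrow> tm \<Rightarrow> spine \<Rightarrow> spine option"
  and happ :: "stp \<Rightarrow> spine \<Rightarrow> tm \<Rightarrow> neu option" where
  "hsub_tm \<tau> x N (Neu R) = do { R' \<leftarrow> hsub_neu \<tau> x N R; Some (Neu R') }"
| "hsub_tm \<tau> x N (Lam M) = do { M' \<leftarrow> hsub_tm \<tau> (Suc x) (ren_tm N Suc) M; Some (Lam M') }"
| "hsub_neu \<tau> x N (App H S) = do {
     S' \<leftarrow> hsub_spine \<tau> x N S;
     (if H = Var x then happ \<tau> S' N else Some (App (ren_head (drop_var x) H) S')) }"
| "hsub_spine \<tau> x N SNil = Some SNil"
| "hsub_spine \<tau> x N (SArg M S) = do {
     M' \<leftarrow> hsub_tm \<tau> x N M; S' \<leftarrow> hsub_spine \<tau> x N S; Some (SArg M' S') }"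
| "hsub_spine \<tau> x N (SPre y S) =
     (if y = x then None else do { S' \<leftarrow> hsub_spine \<tau> x N S; Some (SPre (drop_var x y) S') })"
| "happ Base SNil (Neu R) = Some R"
| "happ (Arr \<tau>2 \<tau>1) (SArg N S) (Lam M) = do { M' \<leftarrow> hsub_tm \<tau>2 0 N M; happ \<tau>1 S M' }"
| "happ (Arr Base \<tau>1) (SPre y S) (Lam M) = happ \<tau>1 S (ren_tm M (inst y))"
| "happ _ _ _ = None"
  by pat_completeness auto
termination
  by (relation "inv_image (less_than <*lex*> less_than <*lex*> less_than)
    (case_sum
      (case_sum (\<lambda>(\<tau>, x, N, M). (size \<tau>, Suc 0, size M)) (\<lambda>(\<tau>, x, N, R). (size \<tau>, Suc 0, size R)))
      (case_sum (\<lambda>(\<tau>, x, N, S). (size \<tau>, Suc 0, size S)) (\<lambda>(\<tau>, S, M). (size \<tau>, 0, 0))))") auto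

primrec hsub_aty :: "stp \<Rightarrow> nat \<Rightarrow> tm \<Rightarrow> aty \<Rightarrow> aty option" where
  "hsub_aty \<tau> x N (Fam a S) = do { S' \<leftarrow> hsub_spine \<tau> x N S; Some (Fam a S') }"

fun hsub_ty :: "stp \<Rightarrow> nat \<Rightarrow> tm \<Rightarrow> ty \<Rightarrow> ty option" where
  "hsub_ty \<tau> x N (Atom P) = do { P' \<leftarrow> hsub_aty \<tau> x N P; Some (Atom P') }"
| "hsub_ty \<tau> x N (Pi A2 A1) = do {
     A2' \<leftarrow> hsub_ty \<tau> x N A2; A1' \<leftarrow> hsub_ty \<tau> (Suc x) (ren_tm N Suc) A1; Some (Pi A2' A1') }"
| "hsub_ty \<tau> x N (PrePi A2 A1) = do {
     A2' \<leftarrow> hsub_ty \<tau> x N A2; A1' \<leftarrow> hsub_ty \<tau> (Suc x) (ren_tm N Suc) A1; Some (PrePi A2' A1') }"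

fun hsub_kind :: "stp \<Rightarrow> nat \<Rightarrow> tm \<Rightarrow> kind \<Rightarrow> kind option" where
  "hsub_kind \<tau> x N Type = Some Type"
| "hsub_kind \<tau> x N Cotype = Some Cotype"
| "hsub_kind \<tau> x N (KPi A K) = do {
     A' \<leftarrow> hsub_ty \<tau> x N A; K' \<leftarrow> hsub_kind \<tau> (Suc x) (ren_tm N Suc) K; Some (KPi A' K') }"
| "hsub_kind \<tau> x N (KPrePi A K) = do {
     A' \<leftarrow> hsub_ty \<tau> x N A; K' \<leftarrow> hsub_kind \<tau> (Suc x) (ren_tm N Suc) K; Some (KPrePi A' K') }"


section \<open>Equality\<close>

primrec prepattern_spine :: "spine \<Rightarrow> bool" where
  "prepattern_spine SNil = True"
| "prepattern_spine (SArg M S) = False"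
| "prepattern_spine (SPre y S) = prepattern_spine S"

primrec rec_headed :: "neu \<Rightarrow> bool" where
  "rec_headed (App H S) = (\<exists>r. H = Rec r)"

text \<open>An equation \<open>\<Theta> \<turnstile> R = R'\<close>.  The variable context \<open>\<Theta>\<close> is given by its length.\<close>

type_synonym eqn = "nat \<times> neu \<times> neu"

definition is_renaming_of :: "eqn \<Rightarrow> eqn \<Rightarrow> bool" where
  "is_renaming_of = (\<lambda>(n, R, R') (k, Q, Q').
     \<exists>\<rho>. inj_on \<rho> {..<k} \<and> \<rho> ` {..<k} \<subseteq> {..<n} \<and> R = ren_neu Q \<rho> \<and> R' = ren_neu Q' \<rho>)"

text \<open>The rules of the algorithm \<open>\<Delta>; \<Theta> \<turnstile>\<^sub>\<Sigma> M = M'\<close>, where \<open>\<Delta>\<close> lists the memoised equations.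
  An equation is memoised when one of its sides is unfolded; if both sides are headed by a
  recursion constant, the left one is unfolded first.\<close>

inductive tm_eq :: "sig \<Rightarrow> eqn list \<Rightarrow> nat \<Rightarrow> tm \<Rightarrow> tm \<Rightarrow> bool"
  and neu_eq :: "sig \<Rightarrow> eqn list \<Rightarrow> nat \<Rightarrow> neu \<Rightarrow> neu \<Rightarrow> bool"
  and spine_eq :: "sig \<Rightarrow> eqn list \<Rightarrow> nat \<Rightarrow> spine \<Rightarrow> spine \<Rightarrow> bool"
  for \<Sigma> :: sig where
  eq_lam: "tm_eq \<Sigma> \<Delta> (Suc n) M M' \<Longrightarrow> tm_eq \<Sigma> \<Delta> n (Lam M) (Lam M')"
| eq_neu: "neu_eq \<Sigma> \<Delta> n R R' \<Longrightarrow> tm_eq \<Sigma> \<Delta> n (Neu R) (Neu R')"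
| eq_var: "\<lbrakk>x < n; spine_eq \<Sigma> \<Delta> n S S'\<rbrakk> \<Longrightarrow> neu_eq \<Sigma> \<Delta> n (App (Var x) S) (App (Var x) S')"
| eq_con: "spine_eq \<Sigma> \<Delta> n S S' \<Longrightarrow> neu_eq \<Sigma> \<Delta> n (App (Con c) S) (App (Con c) S')"
| eq_memo: "\<lbrakk>e \<in> set \<Delta>; is_renaming_of (n, R, R') e\<rbrakk> \<Longrightarrow> neu_eq \<Sigma> \<Delta> n R R'"
| eq_unfold_left:
    "\<lbrakk>rec_def \<Sigma> r = Some (A, M); prepattern_spine S; happ (erase A) S M = Some R;
      neu_eq \<Sigma> ((n, App (Rec r) S, R') # \<Delta>) n R R'\<rbrakk>
     \<Longrightarrow> neu_eq \<Sigma> \<Delta> n (App (Rec r) S) R'"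
| eq_unfold_right:
    "\<lbrakk>\<not> rec_headed R; rec_def \<Sigma> r = Some (A, M); prepattern_spine S; happ (erase A) S M = Some R';
      neu_eq \<Sigma> ((n, R, App (Rec r) S) # \<Delta>) n R R'\<rbrakk>
     \<Longrightarrow> neu_eq \<Sigma> \<Delta> n R (App (Rec r) S)"
| eq_nil: "spine_eq \<Sigma> \<Delta> n SNil SNil"
| eq_arg: "\<lbrakk>tm_eq \<Sigma> \<Delta> n M M'; spine_eq \<Sigma> \<Delta> n S S'\<rbrakk> \<Longrightarrow> spine_eq \<Sigma> \<Delta> n (SArg M S) (SArg M' S')"
| eq_pre: "\<lbrakk>y < n; spine_eq \<Sigma> \<Delta> n S S'\<rbrakk> \<Longrightarrow> spine_eq \<Sigma> \<Delta> n (SPre y S) (SPre y S')"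

inductive aty_eq :: "sig \<Rightarrow> ctx \<Rightarrow> aty \<Rightarrow> aty \<Rightarrow> bool" for \<Sigma> :: sig where
  "spine_eq \<Sigma> [] (length \<Gamma>) S S' \<Longrightarrow> aty_eq \<Sigma> \<Gamma> (Fam a S) (Fam a S')"

inductive ty_eq :: "sig \<Rightarrow> ctx \<Rightarrow> ty \<Rightarrow> ty \<Rightarrow> bool" for \<Sigma> :: sig where
  "aty_eq \<Sigma> \<Gamma> P P' \<Longrightarrow> ty_eq \<Sigma> \<Gamma> (Atom P) (Atom P')"
| "\<lbrakk>ty_eq \<Sigma> \<Gamma> A2 A2'; ty_eq \<Sigma> (Ord A2 # \<Gamma>) A1 A1'\<rbrakk> \<Longrightarrow> ty_eq \<Sigma> \<Gamma> (Pi A2 A1) (Pi A2' A1')"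
| "\<lbrakk>ty_eq \<Sigma> \<Gamma> A2 A2'; ty_eq \<Sigma> (Pre A2 # \<Gamma>) A1 A1'\<rbrakk> \<Longrightarrow> ty_eq \<Sigma> \<Gamma> (PrePi A2 A1) (PrePi A2' A1')"


section \<open>Typing\<close>

primrec binding_ty :: "binding \<Rightarrow> ty" where
  "binding_ty (Ord A) = A"
| "binding_ty (Pre A) = A"

text \<open>The type of variable \<open>x\<close>, weakened to the whole context.\<close>

definition var_ty :: "ctx \<Rightarrow> nat \<Rightarrow> ty" where
  "var_ty \<Gamma> x = ren_ty (binding_ty (\<Gamma> ! x)) (\<lambda>i. i + Suc x)"

text \<open>The flag \<open>\<delta>\<close> marks the deferred checks of bodies of recursion constants: recursion constants
  are then looked up in the full signature \<open>\<Sigma>\<close> instead of \<open>\<Xi>\<close>.\<close>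

definition rec_scope :: "sig \<Rightarrow> sig \<Rightarrow> bool \<Rightarrow> sig" where
  "rec_scope \<Xi> \<Sigma> \<delta> = (if \<delta> then \<Sigma> else \<Xi>)"

inductive check_tm :: "sig \<Rightarrow> sig \<Rightarrow> bool \<Rightarrow> ctx \<Rightarrow> tm \<Rightarrow> ty \<Rightarrow> bool"
  and synth_neu :: "sig \<Rightarrow> sig \<Rightarrow> bool \<Rightarrow> ctx \<Rightarrow> neu \<Rightarrow> aty \<Rightarrow> bool"
  and ty_spine :: "sig \<Rightarrow> sig \<Rightarrow> bool \<Rightarrow> ctx \<Rightarrow> spine \<Rightarrow> ty \<Rightarrow> aty \<Rightarrow> bool"
  for \<Xi> \<Sigma> :: sig and \<delta> :: bool where
  "check_tm \<Xi> \<Sigma> \<delta> (Ord A2 # \<Gamma>) M A1 \<Longrightarrow> check_tm \<Xi> \<Sigma> \<delta> \<Gamma> (Lam M) (Pi A2 A1)"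
| "check_tm \<Xi> \<Sigma> \<delta> (Pre A2 # \<Gamma>) M A1 \<Longrightarrow> check_tm \<Xi> \<Sigma> \<delta> \<Gamma> (Lam M) (PrePi A2 A1)"
| "\<lbrakk>synth_neu \<Xi> \<Sigma> \<delta> \<Gamma> R P'; aty_eq \<Sigma> \<Gamma> P' P\<rbrakk> \<Longrightarrow> check_tm \<Xi> \<Sigma> \<delta> \<Gamma> (Neu R) (Atom P)"
| "\<lbrakk>x < length \<Gamma>; ty_spine \<Xi> \<Sigma> \<delta> \<Gamma> S (var_ty \<Gamma> x) P\<rbrakk> \<Longrightarrow> synth_neu \<Xi> \<Sigma> \<delta> \<Gamma> (App (Var x) S) P"
| "\<lbrakk>con_type \<Xi> c = Some A; ty_spine \<Xi> \<Sigma> \<delta> \<Gamma> S A P\<rbrakk> \<Longrightarrow> synth_neu \<Xi> \<Sigma> \<delta> \<Gamma> (App (Con c) S) P"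
| "\<lbrakk>rec_def (rec_scope \<Xi> \<Sigma> \<delta>) r = Some (A, M); ty_spine \<Xi> \<Sigma> \<delta> \<Gamma> S A P\<rbrakk>
    \<Longrightarrow> synth_neu \<Xi> \<Sigma> \<delta> \<Gamma> (App (Rec r) S) P"
| "ty_spine \<Xi> \<Sigma> \<delta> \<Gamma> SNil (Atom P) P"
| "\<lbrakk>check_tm \<Xi> \<Sigma> \<delta> \<Gamma> M A2; hsub_ty (erase A2) 0 M A1 = Some A1'; ty_spine \<Xi> \<Sigma> \<delta> \<Gamma> S A1' P\<rbrakk>
    \<Longrightarrow> ty_spine \<Xi> \<Sigma> \<delta> \<Gamma> (SArg M S) (Pi A2 A1) P"
| "\<lbrakk>y < length \<Gamma>; \<Gamma> ! y = Pre B; ty_eq \<Sigma> \<Gamma> (var_ty \<Gamma> y) A2;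
     ty_spine \<Xi> \<Sigma> \<delta> \<Gamma> S (ren_ty A1 (inst y)) P\<rbrakk>
    \<Longrightarrow> ty_spine \<Xi> \<Sigma> \<delta> \<Gamma> (SPre y S) (PrePi A2 A1) P"

inductive kind_spine :: "sig \<Rightarrow> sig \<Rightarrow> bool \<Rightarrow> ctx \<Rightarrow> spine \<Rightarrow> kind \<Rightarrow> kind \<Rightarrow> bool"
  for \<Xi> \<Sigma> :: sig and \<delta> :: bool where
  "kind_spine \<Xi> \<Sigma> \<delta> \<Gamma> SNil K K"
| "\<lbrakk>check_tm \<Xi> \<Sigma> \<delta> \<Gamma> M A2; hsub_kind (erase A2) 0 M K = Some K1; kind_spine \<Xi> \<Sigma> \<delta> \<Gamma> S K1 K'\<rbrakk>
    \<Longrightarrow> kind_spine \<Xi> \<Sigma> \<delta> \<Gamma> (SArg M S) (KPi A2 K) K'"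
| "\<lbrakk>y < length \<Gamma>; \<Gamma> ! y = Pre B; ty_eq \<Sigma> \<Gamma> (var_ty \<Gamma> y) A2;
     kind_spine \<Xi> \<Sigma> \<delta> \<Gamma> S (ren_kind K (inst y)) K'\<rbrakk>
    \<Longrightarrow> kind_spine \<Xi> \<Sigma> \<delta> \<Gamma> (SPre y S) (KPrePi A2 K) K'"

inductive synth_aty :: "sig \<Rightarrow> sig \<Rightarrow> bool \<Rightarrow> ctx \<Rightarrow> aty \<Rightarrow> kind \<Rightarrow> bool"
  for \<Xi> \<Sigma> :: sig and \<delta> :: bool where
  "\<lbrakk>fam_kind \<Xi> a = Some K; kind_spine \<Xi> \<Sigma> \<delta> \<Gamma> S K K'\<rbrakk> \<Longrightarrow> synth_aty \<Xi> \<Sigma> \<delta> \<Gamma> (Fam a S) K'"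

inductive check_ty :: "sig \<Rightarrow> sig \<Rightarrow> bool \<Rightarrow> ctx \<Rightarrow> ty \<Rightarrow> bool"
  for \<Xi> \<Sigma> :: sig and \<delta> :: bool where
  "\<lbrakk>synth_aty \<Xi> \<Sigma> \<delta> \<Gamma> P K; K = Type \<or> K = Cotype\<rbrakk> \<Longrightarrow> check_ty \<Xi> \<Sigma> \<delta> \<Gamma> (Atom P)"
| "\<lbrakk>check_ty \<Xi> \<Sigma> \<delta> \<Gamma> A2; check_ty \<Xi> \<Sigma> \<delta> (Ord A2 # \<Gamma>) A1\<rbrakk> \<Longrightarrow> check_ty \<Xi> \<Sigma> \<delta> \<Gamma> (Pi A2 A1)"
| "\<lbrakk>check_ty \<Xi> \<Sigma> \<delta> \<Gamma> A2; check_ty \<Xi> \<Sigma> \<delta> (Pre A2 # \<Gamma>) A1\<rbrakk> \<Longrightarrow> check_ty \<Xi> \<Sigma> \<delta> \<Gamma> (PrePi A2 A1)"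

inductive check_kind :: "sig \<Rightarrow> sig \<Rightarrow> bool \<Rightarrow> ctx \<Rightarrow> kind \<Rightarrow> bool"
  for \<Xi> \<Sigma> :: sig and \<delta> :: bool where
  "check_kind \<Xi> \<Sigma> \<delta> \<Gamma> Type"
| "check_kind \<Xi> \<Sigma> \<delta> \<Gamma> Cotype"
| "\<lbrakk>check_ty \<Xi> \<Sigma> \<delta> \<Gamma> A; check_kind \<Xi> \<Sigma> \<delta> (Ord A # \<Gamma>) K\<rbrakk> \<Longrightarrow> check_kind \<Xi> \<Sigma> \<delta> \<Gamma> (KPi A K)"
| "\<lbrakk>check_ty \<Xi> \<Sigma> \<delta> \<Gamma> A; check_kind \<Xi> \<Sigma> \<delta> (Pre A # \<Gamma>) K\<rbrakk> \<Longrightarrow> check_kind \<Xi> \<Sigma> \<delta> \<Gamma> (KPrePi A K)"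

inductive ctx_ok :: "sig \<Rightarrow> sig \<Rightarrow> bool \<Rightarrow> ctx \<Rightarrow> bool"
  for \<Xi> \<Sigma> :: sig and \<delta> :: bool where
  "ctx_ok \<Xi> \<Sigma> \<delta> []"
| "\<lbrakk>ctx_ok \<Xi> \<Sigma> \<delta> \<Gamma>; check_ty \<Xi> \<Sigma> \<delta> \<Gamma> A\<rbrakk> \<Longrightarrow> ctx_ok \<Xi> \<Sigma> \<delta> (Ord A # \<Gamma>)"
| "\<lbrakk>ctx_ok \<Xi> \<Sigma> \<delta> \<Gamma>; check_ty \<Xi> \<Sigma> \<delta> \<Gamma> A\<rbrakk> \<Longrightarrow> ctx_ok \<Xi> \<Sigma> \<delta> (Pre A # \<Gamma>)"


section \<open>Validity of recursive definitions\<close>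

primrec prepattern_ty :: "ty \<Rightarrow> bool" where
  "prepattern_ty (Atom P) = True"
| "prepattern_ty (Pi A2 A1) = False"
| "prepattern_ty (PrePi A2 A1) = prepattern_ty A1"

primrec contractive :: "tm \<Rightarrow> bool" where
  "contractive (Neu R) = (\<not> rec_headed R)"
| "contractive (Lam M) = contractive M"

primrec target :: "ty \<Rightarrow> nat" where
  "target (Atom P) = (case P of Fam a S \<Rightarrow> a)"
| "target (Pi A2 A1) = target A1"
| "target (PrePi A2 A1) = target A1"

primrec cotype_kind :: "kind \<Rightarrow> bool" where
  "cotype_kind Type = False"
| "cotype_kind Cotype = True"
| "cotype_kind (KPi A K) = cotype_kind K"
| "cotype_kind (KPrePi A K) = cotype_kind K"

primrec fam_prio :: "sig \<Rightarrow> nat \<Rightarrow> nat option" where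
  "fam_prio [] a = None"
| "fam_prio (d # \<Sigma>) a =
    (case d of FamDecl b K \<Rightarrow> if b = a then Some (length \<Sigma>) else fam_prio \<Sigma> a | _ \<Rightarrow> fam_prio \<Sigma> a)"

definition con_prio :: "sig \<Rightarrow> nat \<Rightarrow> nat option" where
  "con_prio \<Sigma> c = do { A \<leftarrow> con_type \<Sigma> c; fam_prio \<Sigma> (target A) }"

definition coinductive_con :: "sig \<Rightarrow> nat \<Rightarrow> bool" where
  "coinductive_con \<Sigma> c \<longleftrightarrow>
     (\<exists>A K. con_type \<Sigma> c = Some A \<and> fam_kind \<Sigma> (target A) = Some K \<and> cotype_kind K)"

text \<open>\<open>path_tm \<Sigma> r M cs\<close>: some path from the root of \<open>M\<close> to an occurrence of \<open>r\<close>, unfolding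
  recursion constants other than \<open>r\<close>, passes through exactly the constructors \<open>cs\<close>.\<close>

inductive path_tm :: "sig \<Rightarrow> nat \<Rightarrow> tm \<Rightarrow> nat list \<Rightarrow> bool"
  and path_neu :: "sig \<Rightarrow> nat \<Rightarrow> neu \<Rightarrow> nat list \<Rightarrow> bool"
  and path_spine :: "sig \<Rightarrow> nat \<Rightarrow> spine \<Rightarrow> nat list \<Rightarrow> bool"
  for \<Sigma> :: sig and r :: nat where
  "path_tm \<Sigma> r M cs \<Longrightarrow> path_tm \<Sigma> r (Lam M) cs"
| "path_neu \<Sigma> r R cs \<Longrightarrow> path_tm \<Sigma> r (Neu R) cs"
| "path_neu \<Sigma> r (App (Rec r) S) []"
| "\<lbrakk>r' \<noteq> r; rec_def \<Sigma> r' = Some (A, M); path_tm \<Sigma> r M cs\<rbrakk> \<Longrightarrow> path_neu \<Sigma> r (App (Rec r') S) cs"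
| "path_spine \<Sigma> r S cs \<Longrightarrow> path_neu \<Sigma> r (App (Con c) S) (c # cs)"
| "path_spine \<Sigma> r S cs \<Longrightarrow> path_neu \<Sigma> r (App (Var x) S) cs"
| "path_spine \<Sigma> r S cs \<Longrightarrow> path_neu \<Sigma> r (App (Rec r') S) cs"
| "path_tm \<Sigma> r M cs \<Longrightarrow> path_spine \<Sigma> r (SArg M S) cs"
| "path_spine \<Sigma> r S cs \<Longrightarrow> path_spine \<Sigma> r (SArg M S) cs"
| "path_spine \<Sigma> r S cs \<Longrightarrow> path_spine \<Sigma> r (SPre y S) cs"

definition guarded :: "sig \<Rightarrow> nat \<Rightarrow> tm \<Rightarrow> bool" where
  "guarded \<Sigma> r M \<longleftrightarrow>
     (\<forall>cs. path_tm \<Sigma> r M cs \<longrightarrow>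
        (\<exists>c\<in>set cs. coinductive_con \<Sigma> c \<and>
           (\<exists>p. con_prio \<Sigma> c = Some p \<and>
              (\<forall>c'\<in>set cs. \<exists>p'. con_prio \<Sigma> c' = Some p' \<and> p' \<le> p))))"


section \<open>Signatures\<close>

text \<open>\<open>sig_ok \<Sigma> \<Xi>\<close> is \<open>\<turnstile>\<^sub>\<Sigma> \<Xi> sig\<close>.  The first premise of each extension rule makes explicit the
  convention that declared names are distinct.\<close>

inductive sig_ok :: "sig \<Rightarrow> sig \<Rightarrow> bool" for \<Sigma> :: sig where
  "sig_ok \<Sigma> []"
| "\<lbrakk>fam_kind \<Xi> a = None; sig_ok \<Sigma> \<Xi>; check_kind \<Xi> \<Sigma> False [] K\<rbrakk> \<Longrightarrow> sig_ok \<Sigma> (FamDecl a K # \<Xi>)"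
| "\<lbrakk>con_type \<Xi> c = None; sig_ok \<Sigma> \<Xi>; check_ty \<Xi> \<Sigma> False [] A\<rbrakk> \<Longrightarrow> sig_ok \<Sigma> (ConDecl c A # \<Xi>)"
| "\<lbrakk>rec_def \<Xi> r = None; sig_ok \<Sigma> \<Xi>; check_ty \<Xi> \<Sigma> False [] A; prepattern_ty A; contractive M;
     guarded \<Sigma> r M; check_tm \<Xi> \<Sigma> True [] M A\<rbrakk> \<Longrightarrow> sig_ok \<Sigma> (RecDecl r A M # \<Xi>)"

definition sig_valid :: "sig \<Rightarrow> bool" where
  "sig_valid \<Sigma> \<longleftrightarrow> sig_ok \<Sigma> \<Sigma>"

end

theory Submission
  imports Defs
begin

text \<open>
  Call a function effective if its graph, read through Goedel numbers, is recursively enumerable; a total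
  effective function is computable by unbounded search.  Recursively enumerable relations are closed under
  reflexive-transitive closure, hence under finite derivations, so the least fixed point of a finitary
  operator with recursively enumerable graph is effective.  A recursive algorithm on syntax is therefore
  computable as soon as every solution of its recursion equation is total and has the intended values.

  Totality is a structural induction except in two places.  For equality, unfolding a recursion constant at
  a prepattern spine only renames its body, so all neutral terms met are renamings of finitely many
  skeletons; an equation is determined up to renaming by its skeletons, the coincidences among its free
  variable occurrences, and which of them are in scope, so that only finitely many equations can be
  memoised before one of them is a renaming of an earlier one.  For guardedness, only the set of
  constructors on a path matters, and the search space of subterms paired with such sets is finite.
\<close>


section \<open>Recursive functions on natural numbers\<close>

text \<open>Programs of \<open>recf\<close> act on numbers and know only primitive recursion and
  search, whereas the algorithms recurse mutually and nestedly over syntax. Working with graphs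
  avoids writing such programs: composition becomes an existential over an intermediate value, and
  all recursion is reduced to one search, along a reflexive-transitive closure. Lists, membership,
  finite tables and the codes of the datatypes come from this search too, since they are needed
  before a recursion theorem is available.

  The judgments are decided on all raw inputs: signatures need not be valid, variables may lie
  outside the context, substitution may fail. So no termination argument can appeal to typing or
  guardedness; equality terminates over an arbitrary \<Sigma> thanks to the memo list, and failure
  is a value of its own, kept apart from nontermination. Functions have no Goedel numbers, so
  renamings are passed as numerical parameters, and the existential over a renaming in
  \<open>is_renaming_of\<close> becomes a finite comparison of occurrence lists.\<close>

definition rc :: "nat \<Rightarrow> (nat list \<Rightarrow> nat) \<Rightarrow> bool" where
  "rc k f \<longleftrightarrow> (\<exists>r. \<forall>xs. length xs = k \<longrightarrow> rec_eval r xs (f xs))"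

abbreviation nc :: "(nat \<Rightarrow> nat) \<Rightarrow> bool" where
  "nc f \<equiv> rc 1 (\<lambda>xs. f (xs ! 0))"

lemma rc_proj: "i < k \<Longrightarrow> rc k (\<lambda>xs. xs ! i)"
  unfolding rc_def by (rule exI[of _ "RProj i"]) (auto intro: rec_eval.intros)

lemma rc_zero: "rc k (\<lambda>xs. 0)"
  unfolding rc_def by (rule exI[of _ RZero]) (auto intro: rec_eval.intros)

lemma length_1_conv: "length xs = 1 \<longleftrightarrow> (\<exists>x. xs = [x])"
  by (cases xs) auto

lemma length_2_conv: "length xs = 2 \<longleftrightarrow> (\<exists>x y. xs = [x, y])"
  by (cases xs; cases "tl xs") auto

text \<open>Composition is phrased for expressions \<open>F (a xs)\<close> instead of argument
  lists, so that closure proofs can follow the syntax of the function.\<close>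

lemma rc_app1:
  assumes "rc 1 (\<lambda>ys. F (ys ! 0))" and "rc k a"
  shows "rc k (\<lambda>xs. F (a xs))"
proof -
  from assms obtain f r where f: "\<And>ys. length ys = 1 \<Longrightarrow> rec_eval f ys (F (ys ! 0))"
    and r: "\<And>xs. length xs = k \<Longrightarrow> rec_eval r xs (a xs)" unfolding rc_def by blast
  have "rec_eval (RComp f [r]) xs (F (a xs))" if "length xs = k" for xs
    by (rule rec_eval.intros(4)[of _ _ "[a xs]"]) (use f[of "[a xs]"] r[OF that] in simp_all)
  then show ?thesis unfolding rc_def by blast
qed

lemma rc_app2:
  assumes "rc 2 (\<lambda>ys. F (ys ! 0) (ys ! 1))" and "rc k a" and "rc k b"
  shows "rc k (\<lambda>xs. F (a xs) (b xs))"
proof -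
  from assms obtain f r s where f: "\<And>ys. length ys = 2 \<Longrightarrow> rec_eval f ys (F (ys ! 0) (ys ! 1))"
    and r: "\<And>xs. length xs = k \<Longrightarrow> rec_eval r xs (a xs)"
    and s: "\<And>xs. length xs = k \<Longrightarrow> rec_eval s xs (b xs)" unfolding rc_def by blast
  have "rec_eval (RComp f [r, s]) xs (F (a xs) (b xs))" if "length xs = k" for xs
    by (rule rec_eval.intros(4)[of _ _ "[a xs, b xs]"])
      (use f[of "[a xs, b xs]"] r[OF that] s[OF that] in simp_all)
  then show ?thesis unfolding rc_def by blast
qed

lemma rc_Suc: "rc k a \<Longrightarrow> rc k (\<lambda>xs. Suc (a xs))"
proof (rule rc_app1[where F = Suc])
  show "rc 1 (\<lambda>ys. Suc (ys ! 0))"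
    unfolding rc_def
    by (rule exI[of _ RSucc]) (auto simp: length_1_conv[unfolded One_nat_def] intro: rec_eval.intros)
qed

text \<open>There is one parameter \<open>x\<close>; further parameters are packed into it by
  \<open>prod_encode\<close>, as in \<open>rc_if0\<close>.\<close>

lemma rc_prim:
  assumes g: "rc 1 (\<lambda>ys. g (ys ! 0))"
    and s: "rc 3 (\<lambda>ys. s (ys ! 0) (ys ! 1) (ys ! 2))"
    and f0: "\<And>x. f 0 x = g x" and fS: "\<And>n x. f (Suc n) x = s n (f n x) x"
  shows "rc 2 (\<lambda>ys. f (ys ! 0) (ys ! 1))"
proof -
  from g s obtain rg rs where rg: "\<And>ys. length ys = 1 \<Longrightarrow> rec_eval rg ys (g (ys ! 0))"
    and rs: "\<And>ys. length ys = 3 \<Longrightarrow> rec_eval rs ys (s (ys ! 0) (ys ! 1) (ys ! 2))"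
    unfolding rc_def by blast
  have "rec_eval (RPrim rg rs) [n, x] (f n x)" for n x
  proof (induction n)
    case 0
    show ?case using rg[of "[x]"] by (auto simp: f0 intro: rec_eval.intros)
  next
    case (Suc n)
    from rec_eval.intros(6)[OF Suc, of "s n (f n x) x"] rs[of "[n, f n x, x]"]
    show ?case by (simp add: fS)
  qed
  then show ?thesis unfolding rc_def length_2_conv by (intro exI[of _ "RPrim rg rs"]) auto
qed

lemma rc_mu:
  assumes f: "rc 2 (\<lambda>ys. f (ys ! 0) (ys ! 1))" and ex: "\<And>x. \<exists>m. f m x = 0"
  shows "nc (\<lambda>x. LEAST m. f m x = 0)"
proof -
  from f obtain r where r: "\<And>ys. length ys = 2 \<Longrightarrow> rec_eval r ys (f (ys ! 0) (ys ! 1))"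
    unfolding rc_def by blast
  have r': "rec_eval r [m, x] (f m x)" for m x using r[of "[m, x]"] by simp
  have "rec_eval (RMu r) [x] (LEAST m. f m x = 0)" for x
  proof (rule rec_eval.intros(7))
    show "rec_eval r [LEAST m. f m x = 0, x] 0"
      using r'[of "LEAST m. f m x = 0" x] LeastI_ex[OF ex[of x]] by simp
    show "\<forall>m<LEAST m. f m x = 0. \<exists>y. rec_eval r [m, x] (Suc y)"
    proof (intro allI impI)
      fix m assume "m < (LEAST m. f m x = 0)"
      then have "f m x \<noteq> 0" by (rule not_less_Least)
      then show "\<exists>y. rec_eval r [m, x] (Suc y)" using r'[of m x] by (cases "f m x") auto
    qed
  qed
  then show ?thesis unfolding rc_def length_1_conv by (intro exI[of _ "RMu r"]) auto
qed

lemma rc_const: "rc k (\<lambda>xs. c)"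
  by (induction c) (auto intro: rc_zero rc_Suc)

lemma rc_add: "rc k a \<Longrightarrow> rc k b \<Longrightarrow> rc k (\<lambda>xs. a xs + b xs)"
proof (rule rc_app2[where F = "(+)"])
  show "rc 2 (\<lambda>ys. ys ! 0 + ys ! 1)"
    by (rule rc_prim[of "\<lambda>x. x" "\<lambda>n y x. Suc y"]) (simp_all add: rc_proj rc_Suc)
qed

lemma rc_pred: "rc k a \<Longrightarrow> rc k (\<lambda>xs. a xs - 1)"
proof (rule rc_app1[where F = "\<lambda>x. x - 1"])
  have "rc 2 (\<lambda>ys. (\<lambda>n x. n - 1) (ys ! 0) (ys ! 1))"
    by (rule rc_prim[of "\<lambda>x. 0" "\<lambda>n y x. n"]) (simp_all add: rc_proj rc_zero)
  then show "rc 1 (\<lambda>ys. ys ! 0 - 1)"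
    by (rule rc_app2[where b = "\<lambda>ys. ys ! 0"]) (simp_all add: rc_proj)
qed

lemma rc_diff: "rc k a \<Longrightarrow> rc k b \<Longrightarrow> rc k (\<lambda>xs. a xs - b xs)"
proof -
  have "rc 2 (\<lambda>ys. (\<lambda>n x. x - n) (ys ! 0) (ys ! 1))"
    by (rule rc_prim[of "\<lambda>x. x" "\<lambda>n y x. y - 1"]) (simp_all add: rc_proj rc_pred[unfolded One_nat_def])
  then show "rc k a \<Longrightarrow> rc k b \<Longrightarrow> rc k (\<lambda>xs. a xs - b xs)"
    by (rule rc_app2)
qed

lemma rc_triangle: "rc k a \<Longrightarrow> rc k (\<lambda>xs. triangle (a xs))"
proof (rule rc_app1[where F = triangle])
  have "rc 2 (\<lambda>ys. (\<lambda>n x. triangle n) (ys ! 0) (ys ! 1))"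
    by (rule rc_prim[of "\<lambda>x. 0" "\<lambda>n y x. y + Suc n"]) (simp_all add: rc_proj rc_zero rc_add rc_Suc)
  then show "rc 1 (\<lambda>ys. triangle (ys ! 0))"
    by (rule rc_app2[where b = "\<lambda>ys. ys ! 0"]) (simp_all add: rc_proj)
qed

lemma rc_pair: "rc k a \<Longrightarrow> rc k b \<Longrightarrow> rc k (\<lambda>xs. prod_encode (a xs, b xs))"
  unfolding prod_encode_def by (simp add: rc_add rc_triangle)

section \<open>The inverse of the Cantor pairing function\<close>

definition pi1 :: "nat \<Rightarrow> nat" where "pi1 n = fst (prod_decode n)"
definition pi2 :: "nat \<Rightarrow> nat" where "pi2 n = snd (prod_decode n)"

lemma pi1_pair [simp]: "pi1 (prod_encode (a, b)) = a" by (simp add: pi1_def)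
lemma pi2_pair [simp]: "pi2 (prod_encode (a, b)) = b" by (simp add: pi2_def)
lemma pair_pi [simp]: "prod_encode (pi1 n, pi2 n) = n" by (simp add: pi1_def pi2_def)

lemma triangle_mono: "m \<le> n \<Longrightarrow> triangle m \<le> triangle n"
  unfolding triangle_def by (intro div_le_mono mult_le_mono) simp_all

text \<open>Since \<open>prod_encode (a, b)\<close> is \<open>triangle (a + b) + a\<close>, the
  numbers on antidiagonal \<open>s\<close> run from \<open>triangle s\<close> up to but excluding
  \<open>triangle (Suc s)\<close>. The truncated subtraction is zero exactly when
  \<open>x < triangle (Suc s)\<close>, so the least such \<open>s\<close> is the antidiagonal of
  \<open>x\<close>, found by a search that always ends.\<close>

definition diagonal :: "nat \<Rightarrow> nat" where
  "diagonal x = (LEAST s. Suc x - triangle (Suc s) = 0)"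

lemma diagonal_pair: "diagonal (prod_encode (a, b)) = a + b"
  unfolding diagonal_def
proof (rule Least_equality)
  show "Suc (prod_encode (a, b)) - triangle (Suc (a + b)) = 0"
    by (simp add: prod_encode_def)
  fix s assume s: "Suc (prod_encode (a, b)) - triangle (Suc s) = 0"
  show "a + b \<le> s"
  proof (rule ccontr)
    assume "\<not> a + b \<le> s"
    then have "triangle (Suc s) \<le> triangle (a + b)" by (intro triangle_mono) simp
    with s show False by (simp add: prod_encode_def)
  qed
qed

lemma rc_diagonal: "rc k a \<Longrightarrow> rc k (\<lambda>xs. diagonal (a xs))"
proof (rule rc_app1[where F = diagonal])
  have "nc (\<lambda>x. LEAST s. Suc x - triangle (Suc s) = 0)"
  proof (rule rc_mu)
    show "rc 2 (\<lambda>ys. Suc (ys ! 1) - triangle (Suc (ys ! 0)))"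
      by (intro rc_diff rc_triangle rc_Suc rc_proj) simp_all
    fix x
    have "Suc x \<le> triangle (Suc x)" by (induction x) simp_all
    then show "\<exists>m. Suc x - triangle (Suc m) = 0" by (metis diff_is_0_eq)
  qed
  then show "rc 1 (\<lambda>ys. diagonal (ys ! 0))" by (simp add: diagonal_def)
qed

lemma pi1_eq: "pi1 x = x - triangle (diagonal x)"
proof -
  obtain a b where "x = prod_encode (a, b)" by (metis pair_pi)
  then show ?thesis by (simp add: diagonal_pair) (simp add: prod_encode_def)
qed

lemma pi2_eq: "pi2 x = diagonal x - pi1 x"
proof -
  obtain a b where "x = prod_encode (a, b)" by (metis pair_pi)
  then show ?thesis by (simp add: diagonal_pair)
qed

lemma rc_pi1: "rc k a \<Longrightarrow> rc k (\<lambda>xs. pi1 (a xs))"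
  unfolding pi1_eq by (intro rc_diff rc_triangle rc_diagonal)

lemma rc_pi2: "rc k a \<Longrightarrow> rc k (\<lambda>xs. pi2 (a xs))"
  unfolding pi2_eq by (intro rc_diff rc_diagonal rc_pi1)

text \<open>The condition is the recursion argument: zero selects the base value, and a successor
  discards the previous value. Both branches are computed beforehand and passed as a pair, which is
  harmless as all functions here are total.\<close>

lemma rc_if0: "rc k c \<Longrightarrow> rc k a \<Longrightarrow> rc k b \<Longrightarrow> rc k (\<lambda>xs. if c xs = 0 then a xs else b xs)"
proof -
  assume c: "rc k c" and a: "rc k a" and b: "rc k b"
  have "rc 2 (\<lambda>ys. (\<lambda>n x. if n = 0 then pi1 x else pi2 x) (ys ! 0) (ys ! 1))"
    by (rule rc_prim[of pi1 "\<lambda>n y x. pi2 x"]) (simp_all add: rc_proj rc_pi1 rc_pi2)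
  from rc_app2[OF this c rc_pair[OF a b]] show ?thesis by (simp cong: if_cong)
qed

lemma rc_funpow:
  assumes s: "nc s" and "rc k a" "rc k b"
  shows "rc k (\<lambda>xs. (s ^^ a xs) (b xs))"
proof -
  have "rc 2 (\<lambda>ys. (\<lambda>n x. (s ^^ n) x) (ys ! 0) (ys ! 1))"
    by (rule rc_prim[of "\<lambda>x. x" "\<lambda>n y x. s y"]) (simp_all add: rc_proj rc_app1[OF s])
  then show ?thesis using assms(2,3) by (rule rc_app2)
qed

lemmas rc_intros = rc_zero rc_Suc rc_const rc_add rc_diff rc_pair rc_pi1 rc_pi2 rc_if0

section \<open>Recursively enumerable sets\<close>

text \<open>The Sigma_1 normal form with a total test: no partial function is mentioned, and closure
  properties become manipulations of the witness \<open>w\<close>.\<close>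

definition re :: "nat set \<Rightarrow> bool" where
  "re A \<longleftrightarrow> (\<exists>T. nc T \<and> (\<forall>n. n \<in> A \<longleftrightarrow> (\<exists>w. T (prod_encode (w, n)) = 0)))"

lemma reI:
  assumes "nc T" "\<And>n. n \<in> A \<longleftrightarrow> (\<exists>w. T (prod_encode (w, n)) = 0)"
  shows "re A"
  using assms unfolding re_def by blast

lemma ex_pair_nat: "(\<exists>w. P w) \<longleftrightarrow> (\<exists>a b. P (prod_encode (a, b)))"
  by (metis pair_pi)

lemma re_vimage:
  assumes "re A" "nc f" shows "re {n. f n \<in> A}"
proof -
  from assms(1) obtain T where T: "nc T" "\<And>n. n \<in> A \<longleftrightarrow> (\<exists>w. T (prod_encode (w, n)) = 0)"
    unfolding re_def by blast
  show ?thesis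
    by (rule reI[where T = "\<lambda>z. T (prod_encode (pi1 z, f (pi2 z)))"])
      (simp_all add: T(2), intro rc_app1[OF T(1)] rc_intros rc_app1[OF assms(2)] rc_proj, simp_all)
qed

lemma re_Int:
  assumes "re A" "re B" shows "re (A \<inter> B)"
proof -
  from assms obtain T U where T: "nc T" "\<And>n. n \<in> A \<longleftrightarrow> (\<exists>w. T (prod_encode (w, n)) = 0)"
    and U: "nc U" "\<And>n. n \<in> B \<longleftrightarrow> (\<exists>w. U (prod_encode (w, n)) = 0)"
    unfolding re_def by blast
  show ?thesis
    by (rule reI[where T = "\<lambda>z. T (prod_encode (pi1 (pi1 z), pi2 z)) + U (prod_encode (pi2 (pi1 z), pi2 z))"])
      (intro rc_app1[OF T(1)] rc_app1[OF U(1)] rc_intros rc_proj, simp_all add: T(2) U(2),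
       subst (3) ex_pair_nat, simp)
qed

lemma re_Un:
  assumes "re A" "re B" shows "re (A \<union> B)"
proof -
  from assms obtain T U where T: "nc T" "\<And>n. n \<in> A \<longleftrightarrow> (\<exists>w. T (prod_encode (w, n)) = 0)"
    and U: "nc U" "\<And>n. n \<in> B \<longleftrightarrow> (\<exists>w. U (prod_encode (w, n)) = 0)"
    unfolding re_def by blast
  show ?thesis
  proof (rule reI[where T = "\<lambda>z. if T z = 0 then 0 else U z"])
    show "nc (\<lambda>z. if T z = 0 then 0 else U z)"
      by (intro rc_app1[OF T(1)] rc_app1[OF U(1)] rc_intros rc_proj) simp_all
    fix n
    have "((if T z = 0 then 0 else U z) = 0) \<longleftrightarrow> T z = 0 \<or> U z = 0" for z by simp
    then show "n \<in> A \<union> B \<longleftrightarrow> (\<exists>w. (if T (prod_encode (w, n)) = 0 then 0 else U (prod_encode (w, n))) = 0)"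
      by (simp only: Un_iff T(2) U(2) ex_disj_distrib)
  qed
qed

text \<open>The projected component moves into the witness, whose two halves are the old witness and
  the value of \<open>m\<close>.\<close>

lemma re_proj:
  assumes "re A" shows "re {n. \<exists>m. prod_encode (n, m) \<in> A}"
proof -
  from assms obtain T where T: "nc T" "\<And>n. n \<in> A \<longleftrightarrow> (\<exists>w. T (prod_encode (w, n)) = 0)"
    unfolding re_def by blast
  show ?thesis
  proof (rule reI[where T = "\<lambda>z. T (prod_encode (pi1 (pi1 z), prod_encode (pi2 z, pi2 (pi1 z))))"])
    show "nc (\<lambda>z. T (prod_encode (pi1 (pi1 z), prod_encode (pi2 z, pi2 (pi1 z)))))"
      by (intro rc_app1[OF T(1)] rc_intros rc_proj) simp_all
    fix n
    show "n \<in> {n. \<exists>m. prod_encode (n, m) \<in> A} \<longleftrightarrow>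
      (\<exists>w. T (prod_encode (pi1 (pi1 (prod_encode (w, n))),
        prod_encode (pi2 (prod_encode (w, n)), pi2 (pi1 (prod_encode (w, n)))))) = 0)"
      by (subst ex_pair_nat) (auto simp: T(2))
  qed
qed

lemma re_eq: "nc f \<Longrightarrow> nc g \<Longrightarrow> re {n. f n = g n}"
proof (rule reI[where T = "\<lambda>z. (f (pi2 z) - g (pi2 z)) + (g (pi2 z) - f (pi2 z))"])
  assume f: "nc f" and g: "nc g"
  show "nc (\<lambda>z. (f (pi2 z) - g (pi2 z)) + (g (pi2 z) - f (pi2 z)))"
    by (intro rc_app1[OF f] rc_app1[OF g] rc_intros rc_proj) simp_all
qed auto

lemma re_less: "nc f \<Longrightarrow> nc g \<Longrightarrow> re {n. f n < g n}"
proof (rule reI[where T = "\<lambda>z. Suc (f (pi2 z)) - g (pi2 z)"])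
  assume f: "nc f" and g: "nc g"
  show "nc (\<lambda>z. Suc (f (pi2 z)) - g (pi2 z))"
    by (intro rc_app1[OF f] rc_app1[OF g] rc_intros rc_proj) simp_all
qed auto

lemma nc_id: "nc (\<lambda>x. x)" by (rule rc_proj) simp

lemma re_UNIV: "re UNIV" using re_eq[OF nc_id nc_id] by simp

text \<open>A path is certified by a number that lists its moves, each consisting of the next point
  and a witness for the edge to it. Replaying the list iterates a total function \<open>st\<close>,
  so checking a certificate is total as well.\<close>

lemma re_rtrancl:
  assumes "re A"
  shows "re {n. (pi1 n, pi2 n) \<in> {(x, y). prod_encode (x, y) \<in> A}\<^sup>*}" (is "re {n. _ \<in> ?R\<^sup>*}")
proof -
  from assms obtain T where T: "nc T" "\<And>n. n \<in> A \<longleftrightarrow> (\<exists>w. T (prod_encode (w, n)) = 0)"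
    unfolding re_def by blast
  \<comment> \<open>A state pairs the remaining moves with the current point. Moves form a list
    coded by 0 when empty and by \<open>Suc\<close> of the pair of head and tail otherwise; the head
    is a pair of an edge witness and a target. A move whose witness is rejected leaves the point
    unchanged.\<close>
  define st where "st q = (if pi1 q = 0 then q else prod_encode (pi2 (pi1 q - 1),
    if T (prod_encode (pi1 (pi1 (pi1 q - 1)), prod_encode (pi2 q, pi2 (pi1 (pi1 q - 1))))) = 0
    then pi2 (pi1 (pi1 q - 1)) else pi2 q))" for q
  have st: "nc st" unfolding st_def by (intro rc_app1[OF T(1)] rc_intros rc_proj) simp_all
  \<comment> \<open>Rejected moves are ignored, so a run from any state whatever stays inside the
    closure and certificates need not be well formed.\<close>
  have sound: "(pi2 q, pi2 ((st ^^ k) q)) \<in> ?R\<^sup>*" for k q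
  proof (induction k)
    case (Suc k)
    have "(pi2 q', pi2 (st q')) \<in> ?R\<^sup>*" for q'
      by (auto simp: st_def T(2) intro!: r_into_rtrancl)
    from rtrancl_trans[OF Suc this] show ?case by (simp only: funpow.simps comp_apply)
  qed simp
  have complete: "\<exists>k l. pi2 ((st ^^ k) (prod_encode (l, x))) = y" if "(x, y) \<in> ?R\<^sup>*" for x y
    using that
  proof (induction rule: converse_rtrancl_induct)
    case base
    show ?case by (rule exI[of _ 0]) simp
  next
    case (step x z)
    from step(1) obtain w where w: "T (prod_encode (w, prod_encode (x, z))) = 0" by (auto simp: T(2))
    from step(3) obtain k l where kl: "pi2 ((st ^^ k) (prod_encode (l, z))) = y" by blast
    have "st (prod_encode (Suc (prod_encode (prod_encode (w, z), l)), x)) = prod_encode (l, z)"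
      by (simp add: st_def w)
    with kl have "pi2 ((st ^^ Suc k) (prod_encode (Suc (prod_encode (prod_encode (w, z), l)), x))) = y"
      by (simp add: funpow_swap1)
    then show ?case by blast
  qed
  \<comment> \<open>The witness pairs the number of steps with the list of moves, so the length of
    the list need not be computed.\<close>
  have "(pi1 n, pi2 n) \<in> ?R\<^sup>* \<longleftrightarrow>
      (\<exists>w. pi2 ((st ^^ pi1 w) (prod_encode (pi2 w, pi1 n))) = pi2 n)" for n
  proof
    assume "(pi1 n, pi2 n) \<in> ?R\<^sup>*"
    from complete[OF this] obtain k l where "pi2 ((st ^^ k) (prod_encode (l, pi1 n))) = pi2 n" by blast
    then show "\<exists>w. pi2 ((st ^^ pi1 w) (prod_encode (pi2 w, pi1 n))) = pi2 n"
      by (intro exI[of _ "prod_encode (k, l)"]) simp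
  next
    assume "\<exists>w. pi2 ((st ^^ pi1 w) (prod_encode (pi2 w, pi1 n))) = pi2 n"
    then show "(pi1 n, pi2 n) \<in> ?R\<^sup>*"
      using sound[of "prod_encode (_, pi1 n)"] by (metis pi2_pair)
  qed
  then have eq: "{n. (pi1 n, pi2 n) \<in> ?R\<^sup>*} =
    {n. \<exists>m. prod_encode (n, m) \<in>
      {z. pi2 ((st ^^ pi1 (pi2 z)) (prod_encode (pi2 (pi2 z), pi1 (pi1 z)))) = pi2 (pi1 z)}}" by auto
  show ?thesis
    unfolding eq by (intro re_proj re_eq rc_funpow[OF st] rc_intros rc_proj) simp_all
qed

text \<open>The search may diverge when no \<open>y\<close> exists, so it falls outside
  \<open>rc\<close> and is run by \<open>RMu\<close> directly. It looks for a pair \<open>m\<close>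
  of a witness and a value and returns the value; when \<open>A\<close> is functional, this is the
  value at \<open>x\<close>.\<close>

lemma re_search:
  assumes "re A"
  shows "\<exists>r. \<forall>x. (\<exists>y. prod_encode (x, y) \<in> A) \<longrightarrow> (\<exists>y. rec_eval r [x] y \<and> prod_encode (x, y) \<in> A)"
proof -
  from assms obtain T where T: "nc T" "\<And>n. n \<in> A \<longleftrightarrow> (\<exists>w. T (prod_encode (w, n)) = 0)"
    unfolding re_def by blast
  have "rc 2 (\<lambda>ys. T (prod_encode (pi1 (ys ! 0), prod_encode (ys ! 1, pi2 (ys ! 0)))))"
    by (intro rc_app1[OF T(1)] rc_intros rc_proj) simp_all
  then obtain r where "\<forall>ys. length ys = 2 \<longrightarrow>
      rec_eval r ys (T (prod_encode (pi1 (ys ! 0), prod_encode (ys ! 1, pi2 (ys ! 0)))))"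
    unfolding rc_def by blast
  from this[rule_format, of "[_, _]"]
  have r: "rec_eval r [m, x] (T (prod_encode (pi1 m, prod_encode (x, pi2 m))))" for m x by simp
  from rc_pi2[OF nc_id] obtain s where "\<forall>ys. length ys = 1 \<longrightarrow> rec_eval s ys (pi2 (ys ! 0))"
    unfolding rc_def by auto
  from this[rule_format, of "[_]"] have s: "rec_eval s [m] (pi2 m)" for m by simp
  have "\<exists>y. rec_eval (RComp s [RMu r]) [x] y \<and> prod_encode (x, y) \<in> A"
    if "\<exists>y. prod_encode (x, y) \<in> A" for x
  proof -
    let ?P = "\<lambda>m. T (prod_encode (pi1 m, prod_encode (x, pi2 m))) = 0"
    define m where "m = (LEAST m. ?P m)"
    from that obtain y w where "T (prod_encode (w, prod_encode (x, y))) = 0" by (auto simp: T(2))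
    then have "?P (prod_encode (w, y))" by simp
    then have m: "?P m" unfolding m_def by (rule LeastI)
    have "rec_eval (RMu r) [x] m"
    proof (rule rec_eval.intros(7))
      show "rec_eval r [m, x] 0" using r[of m x] m by simp
      show "\<forall>m'<m. \<exists>y. rec_eval r [m', x] (Suc y)"
      proof (intro allI impI)
        fix m' assume "m' < m"
        then have "\<not> ?P m'" unfolding m_def by (rule not_less_Least)
        then show "\<exists>y. rec_eval r [m', x] (Suc y)"
          using r[of m' x] by (cases "T (prod_encode (pi1 m', prod_encode (x, pi2 m')))") auto
      qed
    qed
    then have "rec_eval (RComp s [RMu r]) [x] (pi2 m)"
      by (intro rec_eval.intros(4)[of _ _ "[m]"]) (simp_all add: s)
    moreover have "prod_encode (x, pi2 m) \<in> A" using m by (auto simp: T(2))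
    ultimately show ?thesis by blast
  qed
  then show ?thesis by blast
qed

section \<open>Semidecidable predicates and computable functions on coded types\<close>

text \<open>An existential over a type has to be turned into one over numbers, and a number found by
  search has to be the code of something. Both require that the codes themselves can be
  enumerated.\<close>

class godel_re = godel +
  assumes re_range: "re (range gcode)"

text \<open>Membership is prescribed on codes only; \<open>A\<close> may also contain numbers that
  code nothing.\<close>

definition semidec :: "('a::godel \<Rightarrow> bool) \<Rightarrow> bool" where
  "semidec P \<longleftrightarrow> (\<exists>A. re A \<and> (\<forall>x. P x \<longleftrightarrow> gcode x \<in> A))"

text \<open>The basis of the effective functions: projections, pairing and constructors are given
  directly by recursive functions on codes.\<close>

definition tracked :: "('a::godel \<Rightarrow> 'b::godel) \<Rightarrow> bool" where
  "tracked f \<longleftrightarrow> (\<exists>F. nc F \<and> (\<forall>x. gcode (f x) = F (gcode x)))"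

definition effective :: "('a::godel \<Rightarrow> 'b::godel) \<Rightarrow> bool" where
  "effective f \<longleftrightarrow> semidec (\<lambda>p. f (fst p) = snd p)"

text \<open>The rules follow the syntax of a function or predicate. Once an operation is registered,
  effectiveness of whatever is defined from it is proved by resolution along the right-hand
  side.\<close>

named_theorems eff_intros

lemma gcode_pair: "gcode (x, y) = prod_encode (gcode x, gcode y)"
  by (simp add: gcode_prod_def)

lemma semidec_tracked:
  assumes "semidec P" "tracked f" shows "semidec (\<lambda>x. P (f x))"
proof -
  from assms obtain A F where "re A" "\<And>x. P x \<longleftrightarrow> gcode x \<in> A" "nc F" "\<And>x. gcode (f x) = F (gcode x)"
    unfolding semidec_def tracked_def by blast
  then show ?thesis unfolding semidec_def
    by (intro exI[of _ "{n. F n \<in> A}"]) (simp add: re_vimage)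
qed

lemma semidec_conj [eff_intros]: "semidec P \<Longrightarrow> semidec Q \<Longrightarrow> semidec (\<lambda>x. P x \<and> Q x)"
  unfolding semidec_def using re_Int by (metis Int_iff)

lemma semidec_disj [eff_intros]: "semidec P \<Longrightarrow> semidec Q \<Longrightarrow> semidec (\<lambda>x. P x \<or> Q x)"
  unfolding semidec_def using re_Un by (metis Un_iff)

text \<open>The projection must range over codes of type \<open>'b\<close> only, hence the
  intersection with \<open>range gcode\<close>; this is where \<open>godel_re\<close>
  enters.\<close>

lemma semidec_ex [eff_intros]:
  fixes Q :: "'a::godel \<Rightarrow> 'b::godel_re \<Rightarrow> bool"
  assumes "semidec (\<lambda>p. Q (fst p) (snd p))"
  shows "semidec (\<lambda>x. \<exists>y. Q x y)"
proof -
  from assms obtain A where A: "re A" "\<And>p. Q (fst p) (snd p) \<longleftrightarrow> gcode p \<in> A"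
    unfolding semidec_def by blast
  let ?B = "A \<inter> {z. pi2 z \<in> range (gcode :: 'b \<Rightarrow> nat)}"
  have "re {n. \<exists>m. prod_encode (n, m) \<in> ?B}"
    by (intro re_proj re_Int A(1) re_vimage re_range rc_pi2 rc_proj) simp
  moreover have "(\<exists>y. Q x y) \<longleftrightarrow> gcode x \<in> {n. \<exists>m. prod_encode (n, m) \<in> ?B}" for x
    using A(2)[of "(x, _)"] by (auto simp: gcode_pair)
  ultimately show ?thesis unfolding semidec_def by blast
qed

lemma semidec_eq_tracked: "tracked f \<Longrightarrow> tracked g \<Longrightarrow> semidec (\<lambda>x. f x = g x)"
proof -
  assume "tracked f" "tracked g"
  then obtain F G where F: "nc F" "\<And>x. gcode (f x) = F (gcode x)" and G: "nc G" "\<And>x. gcode (g x) = G (gcode x)"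
    unfolding tracked_def by blast
  have "f x = g x \<longleftrightarrow> gcode x \<in> {n. F n = G n}" for x
    using gcode_eq_iff[of "f x" "g x"] by (simp add: F(2) G(2))
  with re_eq[OF F(1) G(1)] show ?thesis unfolding semidec_def by blast
qed

lemma tracked_id: "tracked (\<lambda>x. x)"
  unfolding tracked_def by (rule exI[of _ "\<lambda>x. x"]) (simp add: rc_proj)

lemma tracked_fst: "tracked f \<Longrightarrow> tracked (\<lambda>x. fst (f x))"
proof -
  assume "tracked f"
  then obtain F where F: "nc F" "\<And>x. gcode (f x) = F (gcode x)" unfolding tracked_def by blast
  have "gcode (fst (f x)) = pi1 (F (gcode x))" for x
    unfolding F(2)[symmetric] by (simp add: gcode_prod_def)
  then show ?thesis unfolding tracked_def using rc_pi1[OF F(1)] by (intro exI[of _ "\<lambda>n. pi1 (F n)"]) blast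
qed

lemma tracked_snd: "tracked f \<Longrightarrow> tracked (\<lambda>x. snd (f x))"
proof -
  assume "tracked f"
  then obtain F where F: "nc F" "\<And>x. gcode (f x) = F (gcode x)" unfolding tracked_def by blast
  have "gcode (snd (f x)) = pi2 (F (gcode x))" for x
    unfolding F(2)[symmetric] by (simp add: gcode_prod_def)
  then show ?thesis unfolding tracked_def using rc_pi2[OF F(1)] by (intro exI[of _ "\<lambda>n. pi2 (F n)"]) blast
qed

lemma tracked_Pair: "tracked f \<Longrightarrow> tracked g \<Longrightarrow> tracked (\<lambda>x. (f x, g x))"
proof -
  assume "tracked f" "tracked g"
  then obtain F G where F: "nc F" "\<And>x. gcode (f x) = F (gcode x)" and G: "nc G" "\<And>x. gcode (g x) = G (gcode x)"
    unfolding tracked_def by blast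
  then show ?thesis unfolding tracked_def
    by (intro exI[of _ "\<lambda>n. prod_encode (F n, G n)"]) (simp add: gcode_pair rc_pair)
qed

lemma tracked_const: "tracked (\<lambda>x. c)"
  unfolding tracked_def by (intro exI[of _ "\<lambda>n. gcode c"]) (simp add: rc_const)

lemmas tracked_intros = tracked_id tracked_fst tracked_snd tracked_Pair tracked_const

lemma eff_tracked:
  fixes f :: "'a::godel \<Rightarrow> 'b::godel"
  assumes "tracked f" shows "effective f"
proof -
  from assms obtain F where F: "nc F" "\<And>x. gcode (f x) = F (gcode x)"
    unfolding tracked_def by blast
  have "tracked (\<lambda>p :: 'a \<times> 'b. f (fst p))" unfolding tracked_def
    by (rule exI[of _ "\<lambda>n. F (pi1 n)"])
      (use F in \<open>auto simp: gcode_prod_def intro!: rc_app1[OF F(1)] rc_pi1 rc_proj\<close>)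
  then show ?thesis unfolding effective_def by (intro semidec_eq_tracked tracked_intros)
qed

text \<open>The value \<open>f x\<close> is guessed and checked against the graph of
  \<open>f\<close>.\<close>

lemma semidec_subst:
  fixes f :: "'a::godel \<Rightarrow> 'b::godel_re"
  assumes "semidec P" "effective f" shows "semidec (\<lambda>x. P (f x))"
proof -
  have "semidec (\<lambda>x. \<exists>y. f x = y \<and> P y)"
    by (intro eff_intros assms(2)[unfolded effective_def] semidec_tracked[OF assms(1)] tracked_intros)
  then show ?thesis by simp
qed

lemma eff_compose:
  fixes f :: "'a::godel \<Rightarrow> 'b::godel_re"
  assumes "effective g" "effective f" shows "effective (\<lambda>x. g (f x))"
proof -
  have "semidec (\<lambda>p. \<exists>y. f (fst p) = y \<and> g y = snd p)"
    using semidec_tracked[OF assms(2)[unfolded effective_def], of "\<lambda>p. (fst (fst p), snd p)"]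
      semidec_tracked[OF assms(1)[unfolded effective_def], of "\<lambda>p. (snd p, snd (fst p))"]
    by (intro eff_intros) (simp_all add: tracked_intros)
  then show ?thesis unfolding effective_def by simp
qed

lemma eff_id [eff_intros]: "effective (\<lambda>x. x)" by (intro eff_tracked tracked_intros)
lemma eff_const [eff_intros]: "effective (\<lambda>x. c)" by (intro eff_tracked tracked_intros)

lemma eff_fst [eff_intros]:
  fixes f :: "'a::godel \<Rightarrow> 'b::godel_re \<times> 'c::godel_re"
  assumes "effective f" shows "effective (\<lambda>x. fst (f x))"
proof -
  have eq: "fst (f x) = y \<longleftrightarrow> (\<exists>z. f x = (y, z))" for x y by (cases "f x") auto
  have "semidec (\<lambda>p. \<exists>z. f (fst p) = (snd p, z))"
    using semidec_tracked[OF assms(1)[unfolded effective_def], of "\<lambda>q. (fst (fst q), (snd (fst q), snd q))"]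
    by (intro eff_intros) (simp add: tracked_intros)
  then show ?thesis unfolding effective_def eq .
qed

lemma eff_snd [eff_intros]:
  fixes f :: "'a::godel \<Rightarrow> 'b::godel_re \<times> 'c::godel_re"
  assumes "effective f" shows "effective (\<lambda>x. snd (f x))"
proof -
  have eq: "snd (f x) = y \<longleftrightarrow> (\<exists>z. f x = (z, y))" for x y by (cases "f x") auto
  have "semidec (\<lambda>p. \<exists>z. f (fst p) = (z, snd p))"
    using semidec_tracked[OF assms(1)[unfolded effective_def], of "\<lambda>q. (fst (fst q), (snd q, snd (fst q)))"]
    by (intro eff_intros) (simp add: tracked_intros)
  then show ?thesis unfolding effective_def eq .
qed

lemma eff_Pair [eff_intros]:
  assumes "effective f" "effective g" shows "effective (\<lambda>x. (f x, g x))"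
proof -
  have eq: "(f x, g x) = y \<longleftrightarrow> f x = fst y \<and> g x = snd y" for x y by (cases y) auto
  have "semidec (\<lambda>p. f (fst p) = fst (snd p) \<and> g (fst p) = snd (snd p))"
    using semidec_tracked[OF assms(1)[unfolded effective_def], of "\<lambda>q. (fst q, fst (snd q))"]
     semidec_tracked[OF assms(2)[unfolded effective_def], of "\<lambda>q. (fst q, snd (snd q))"]
    by (intro eff_intros) (simp_all add: tracked_intros)
  then show ?thesis unfolding effective_def eq .
qed

lemma semidec_const [eff_intros]: "semidec (\<lambda>x. c)"
  unfolding semidec_def using re_UNIV re_less[OF nc_id nc_id] by (cases c) auto

lemma re_iff_semidec: "re A \<longleftrightarrow> semidec (\<lambda>n. n \<in> A)"
  unfolding semidec_def gcode_nat_def by (metis Collect_mem_eq Collect_cong)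

instance nat :: godel_re
  by standard (simp add: gcode_nat_def re_UNIV)

instance bool :: godel_re
proof
  have "range (gcode :: bool \<Rightarrow> nat) = {n. n < 2}" by (auto simp: gcode_bool_def image_iff)
  then show "re (range (gcode :: bool \<Rightarrow> nat))" using re_less[OF nc_id rc_const[of 1 2]] by simp
qed

instance prod :: (godel_re, godel_re) godel_re
proof
  have "range (gcode :: 'a \<times> 'b \<Rightarrow> nat) = {n. pi1 n \<in> range (gcode :: 'a \<Rightarrow> nat)} \<inter> {n. pi2 n \<in> range (gcode :: 'b \<Rightarrow> nat)}"
  proof -
    have "n \<in> range (gcode :: 'a \<times> 'b \<Rightarrow> nat)" if "pi1 n = gcode x" "pi2 n = gcode y" for n and x :: 'a and y :: 'b
      using that gcode_pair[of x y] by (metis pair_pi rangeI)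
    then show ?thesis by (auto simp: gcode_prod_def)
  qed
  then show "re (range (gcode :: 'a \<times> 'b \<Rightarrow> nat))"
    by (auto intro!: re_Int re_vimage re_range rc_pi1 rc_pi2 rc_proj)
qed

lemma semidec_eq [eff_intros]:
  fixes f g :: "'a::godel \<Rightarrow> 'b::godel_re"
  assumes "effective f" "effective g"
  shows "semidec (\<lambda>x. f x = g x)"
  using semidec_subst[OF semidec_eq_tracked[OF tracked_fst[OF tracked_id] tracked_snd[OF tracked_id]]
      eff_Pair[OF assms]] by simp

lemma semidec_less [eff_intros]:
  assumes "effective f" "effective g"
  shows "semidec (\<lambda>x. f x < (g x :: nat))"
proof -
  have "semidec (\<lambda>p :: nat \<times> nat. fst p < snd p)"
    unfolding semidec_def
    by (rule exI[of _ "{n. pi1 n < pi2 n}"])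
      (auto simp: gcode_prod_def gcode_nat_def intro!: re_less rc_pi1 rc_pi2 rc_proj)
  from semidec_subst[OF this eff_Pair[OF assms]] show ?thesis by simp
qed

lemma eff_gcode [eff_intros]: "effective f \<Longrightarrow> effective (\<lambda>x. gcode (f x :: 'a::godel_re))"
  by (rule eff_compose[of gcode], rule eff_tracked)
    (auto simp: tracked_def gcode_nat_def intro!: exI[of _ "\<lambda>x. x"] rc_proj)

text \<open>Codes are injective and linearly ordered, so distinctness is a strict inequality between
  codes in one direction or the other.\<close>

lemma semidec_neq [eff_intros]:
  fixes f g :: "'a::godel \<Rightarrow> 'b::godel_re"
  assumes "effective f" "effective g"
  shows "semidec (\<lambda>x. f x \<noteq> g x)"
proof -
  have "semidec (\<lambda>x. gcode (f x) < gcode (g x) \<or> gcode (g x) < gcode (f x))"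
    by (intro eff_intros assms)
  then show ?thesis by (simp flip: neq_iff)
qed

text \<open>Post's theorem in graph form: the graph of a predicate consists of its positive and its
  negative instances.\<close>

lemma eff_decide:
  assumes "semidec P" "semidec (\<lambda>x. \<not> P x)" shows "effective P"
proof -
  have "semidec (\<lambda>p. (P (fst p) \<and> snd p = True) \<or> (\<not> P (fst p) \<and> snd p = False))"
    using semidec_tracked[OF assms(1) tracked_fst[OF tracked_id]]
      semidec_tracked[OF assms(2) tracked_fst[OF tracked_id]]
    by (intro eff_intros semidec_eq_tracked tracked_intros)
  moreover have "(P (fst p) \<and> snd p = True) \<or> (\<not> P (fst p) \<and> snd p = False) \<longleftrightarrow> P (fst p) = snd p" for p
    by auto
  ultimately show ?thesis unfolding effective_def by simp
qed

lemma semidec_eff: "effective P \<Longrightarrow> semidec (\<lambda>x. P x)"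
  using semidec_eq[of P "\<lambda>x. True"] eff_const[of True] by simp

lemma semidec_not_eff: "effective P \<Longrightarrow> semidec (\<lambda>x. \<not> P x)"
  using semidec_eq[of P "\<lambda>x. False"] eff_const[of False] by simp

text \<open>Any pair found by the search lies on the graph and has a code as second component. As
  the graph is functional, that component can only be the code of \<open>f x\<close>.\<close>

lemma eff_computable:
  fixes f :: "'a::godel \<Rightarrow> 'b::godel_re"
  assumes "effective f" shows "computable f"
proof -
  from assms obtain A where A: "re A" "\<And>x y. f x = y \<longleftrightarrow> prod_encode (gcode x, gcode y) \<in> A"
    unfolding effective_def semidec_def gcode_prod_def by auto
  let ?B = "A \<inter> {z. pi2 z \<in> range (gcode :: 'b \<Rightarrow> nat)}"
  have "re ?B"
    by (intro re_Int A(1) re_vimage re_range rc_pi2 rc_proj) simp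
  from re_search[OF this] obtain r where
    r: "\<And>x. \<exists>y. prod_encode (x, y) \<in> ?B \<Longrightarrow> \<exists>y. rec_eval r [x] y \<and> prod_encode (x, y) \<in> ?B" by blast
  have "rec_eval r [gcode x] (gcode (f x))" for x
  proof -
    have "prod_encode (gcode x, gcode (f x)) \<in> ?B" using A(2)[of x "f x"] by auto
    with r[of "gcode x"] obtain y where y: "rec_eval r [gcode x] y" "prod_encode (gcode x, y) \<in> ?B" by blast
    then obtain b :: 'b where b: "y = gcode b" by auto
    with y(2) A(2)[of x b] have "f x = b" by auto
    with y(1) b show ?thesis by simp
  qed
  then show ?thesis unfolding computable_def by blast
qed

lemma eff_decidable: "effective P \<Longrightarrow> decidable P"
  by (drule eff_computable) (simp add: computable_def decidable_def gcode_bool_def)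

lemma tracked_Suc_encode: "tracked (\<lambda>n. Suc n)"
  by (auto simp: tracked_def gcode_nat_def intro!: exI[of _ Suc] rc_Suc rc_proj)

lemma eff_Suc [eff_intros]: "effective f \<Longrightarrow> effective (\<lambda>x. Suc (f x))"
  by (rule eff_compose[OF eff_tracked[OF tracked_Suc_encode]])

lemma eff_app2:
  assumes "effective (\<lambda>p. C (fst p) (snd p))" "effective f" "effective g"
  shows "effective (\<lambda>x. C (f x :: 'a::godel_re) (g x :: 'b::godel_re))"
  using eff_compose[OF assms(1) eff_Pair[OF assms(2,3)]] by simp

lemma eff_ctor2:
  assumes "nc F" "\<And>x y. gcode (C x y) = F (prod_encode (gcode x, gcode y))" "effective f" "effective g"
  shows "effective (\<lambda>x. C (f x :: 'a::godel_re) (g x :: 'b::godel_re))"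
  by (rule eff_app2[OF eff_tracked assms(3,4)])
    (use assms(1,2) in \<open>auto simp: tracked_def gcode_prod_def\<close>)

lemma eff_ctor1:
  assumes "nc F" "\<And>x. gcode (C x) = F (gcode x)" "effective f"
  shows "effective (\<lambda>x. C (f x :: 'a::godel_re))"
  by (rule eff_compose[OF eff_tracked assms(3)]) (use assms(1,2) in \<open>auto simp: tracked_def\<close>)

lemma eff_add [eff_intros]: "effective f \<Longrightarrow> effective g \<Longrightarrow> effective (\<lambda>x. f x + (g x :: nat))"
  by (rule eff_ctor2[where F = "\<lambda>n. pi1 n + pi2 n"])
    (auto simp: gcode_nat_def intro!: rc_add rc_pi1 rc_pi2 rc_proj)

lemma eff_diff [eff_intros]: "effective f \<Longrightarrow> effective g \<Longrightarrow> effective (\<lambda>x. f x - (g x :: nat))"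
  by (rule eff_ctor2[where F = "\<lambda>n. pi1 n - pi2 n"])
    (auto simp: gcode_nat_def intro!: rc_diff rc_pi1 rc_pi2 rc_proj)

lemma eff_prod_encode [eff_intros]:
  "effective f \<Longrightarrow> effective g \<Longrightarrow> effective (\<lambda>x. prod_encode (f x, g x))"
  by (rule eff_ctor2[where F = "\<lambda>n. n"]) (auto simp: gcode_nat_def intro!: rc_proj)

section \<open>Codes of options, sums and lists\<close>

instance option :: (godel_re) godel_re
proof
  have "semidec (\<lambda>n. n = 0 \<or> (\<exists>x::'a. n = Suc (gcode x)))" by (intro eff_intros)
  moreover have "range (gcode :: 'a option \<Rightarrow> nat) = {n. n = 0 \<or> (\<exists>x::'a. n = Suc (gcode x))}"
    unfolding UNIV_option_conv image_insert image_image by (auto simp: gcode_option_def)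
  ultimately show "re (range (gcode :: 'a option \<Rightarrow> nat))" by (simp add: re_iff_semidec)
qed

lemma eff_Some [eff_intros]: "effective f \<Longrightarrow> effective (\<lambda>x. Some (f x :: 'a::godel_re))"
  by (rule eff_ctor1[where F = Suc]) (auto simp: gcode_option_def intro!: rc_Suc rc_proj)

instantiation sum :: (godel, godel) godel
begin
definition gcode_sum :: "'a + 'b \<Rightarrow> nat" where
  "gcode_sum z = (case z of Inl x \<Rightarrow> prod_encode (0, gcode x) | Inr y \<Rightarrow> prod_encode (1, gcode y))"
instance by standard (auto simp: gcode_sum_def split: sum.splits)
end

instance sum :: (godel_re, godel_re) godel_re
proof
  have "semidec (\<lambda>n. (\<exists>x::'a. n = prod_encode (0, gcode x)) \<or> (\<exists>x::'b. n = prod_encode (1, gcode x)))"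
    by (intro eff_intros)
  moreover have "range (gcode :: 'a + 'b \<Rightarrow> nat) =
    {n. (\<exists>x::'a. n = prod_encode (0, gcode x)) \<or> (\<exists>x::'b. n = prod_encode (1, gcode x))}"
    unfolding UNIV_sum image_Un image_image by (auto simp: gcode_sum_def)
  ultimately show "re (range (gcode :: 'a + 'b \<Rightarrow> nat))" by (simp add: re_iff_semidec)
qed

lemma eff_Inl [eff_intros]: "effective f \<Longrightarrow> effective (\<lambda>x. Inl (f x :: 'a::godel_re) :: 'a + 'b::godel_re)"
  by (rule eff_ctor1[where F = "\<lambda>n. prod_encode (0, n)"])
    (auto simp: gcode_sum_def intro!: rc_pair rc_const rc_proj)

lemma eff_Inr [eff_intros]: "effective f \<Longrightarrow> effective (\<lambda>x. Inr (f x :: 'b::godel_re) :: 'a::godel_re + 'b)"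
  by (rule eff_ctor1[where F = "\<lambda>n. prod_encode (1, n)"])
    (auto simp: gcode_sum_def intro!: rc_pair rc_const rc_proj)

lemma gcode_Nil: "gcode [] = 0" and gcode_Cons: "gcode (x # xs) = Suc (prod_encode (gcode x, gcode xs))"
  by (simp_all add: gcode_list_def)

instance list :: (godel_re) godel_re
proof
  \<comment> \<open>An element codes an edge from its first half, the code of a list, to its second
    half, the code of that list with one more element in front. The codes of lists are then the
    points reachable from 0, the code of the empty list.\<close>
  let ?A = "{n. \<exists>x::'a. pi2 n = Suc (prod_encode (gcode x, pi1 n))}"
  have pi: "effective pi1" "effective pi2"
    by (rule eff_tracked, unfold tracked_def gcode_nat_def, rule exI[of _ pi1], simp add: rc_pi1 rc_proj)
      (rule eff_tracked, unfold tracked_def gcode_nat_def, rule exI[of _ pi2], simp add: rc_pi2 rc_proj)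
  have A: "re ?A" unfolding re_iff_semidec mem_Collect_eq by (intro eff_intros pi[THEN eff_compose])
  let ?R = "{(x, y). prod_encode (x, y) \<in> ?A}"
  have 1: "(0, gcode xs) \<in> ?R\<^sup>*" for xs :: "'a list"
  proof (induction xs)
    case (Cons x xs)
    have "(gcode xs, gcode (x # xs)) \<in> ?R" by (auto simp: gcode_Cons)
    with Cons show ?case by (rule rtrancl_into_rtrancl)
  qed (simp add: gcode_Nil)
  have 2: "n \<in> range (gcode :: 'a list \<Rightarrow> nat)" if "(0, n) \<in> ?R\<^sup>*" for n
    using that
  proof (induction rule: rtrancl_induct)
    case base
    show ?case using gcode_Nil by (metis rangeI)
  next
    case (step y z)
    from step(3) obtain xs :: "'a list" where "y = gcode xs" by blast
    moreover from step(2) obtain x :: 'a where "z = Suc (prod_encode (gcode x, y))" by auto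
    ultimately have "z = gcode (x # xs)" by (simp add: gcode_Cons)
    then show ?case by blast
  qed
  have "range (gcode :: 'a list \<Rightarrow> nat) = {n. prod_encode (0, n) \<in> {n. (pi1 n, pi2 n) \<in> ?R\<^sup>*}}"
    using 1 2 by auto
  moreover have "re {n. prod_encode (0, n) \<in> {n. (pi1 n, pi2 n) \<in> ?R\<^sup>*}}"
    by (intro re_vimage re_rtrancl A rc_pair rc_const rc_proj) simp
  ultimately show "re (range (gcode :: 'a list \<Rightarrow> nat))" by simp
qed

lemma eff_Cons [eff_intros]: "effective f \<Longrightarrow> effective g \<Longrightarrow> effective (\<lambda>x. (f x :: 'a::godel_re) # g x)"
  by (rule eff_ctor2[where F = Suc]) (auto simp: gcode_Cons intro!: rc_Suc rc_proj)

section \<open>Reachability, membership and inductively generated sets\<close>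

lemma semidec_rtranclp:
  fixes R :: "'a::godel_re \<Rightarrow> 'a \<Rightarrow> bool"
  assumes R: "semidec (\<lambda>p. R (fst p) (snd p))" and f: "effective f" and g: "effective g"
  shows "semidec (\<lambda>x. R\<^sup>*\<^sup>* (f x) (g x))"
proof -
  from R obtain A where A: "re A" "\<And>x y. R x y \<longleftrightarrow> prod_encode (gcode x, gcode y) \<in> A"
    unfolding semidec_def gcode_prod_def by auto
  \<comment> \<open>Restricting the targets to codes keeps every intermediate point of a path inside
    the type.\<close>
  let ?B = "A \<inter> {z. pi2 z \<in> range (gcode :: 'a \<Rightarrow> nat)}"
  let ?R = "{(x, y). prod_encode (x, y) \<in> ?B}"
  have B: "re ?B" by (intro re_Int A(1) re_vimage re_range rc_pi2 rc_proj) simp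
  have 1: "(gcode x, gcode y) \<in> ?R\<^sup>*" if "R\<^sup>*\<^sup>* x y" for x y
    using that
  proof induction
    case (step y z)
    then have "(gcode y, gcode z) \<in> ?R" by (auto simp: A(2))
    with step(3) show ?case by (rule rtrancl_into_rtrancl)
  qed simp
  have 2: "\<exists>y. n = gcode y \<and> R\<^sup>*\<^sup>* x y" if "(gcode x, n) \<in> ?R\<^sup>*" for x n
    using that
  proof induction
    case (step y z)
    then show ?case by (auto simp flip: A(2) intro: rtranclp.rtrancl_into_rtrancl)
  qed auto
  have "R\<^sup>*\<^sup>* x y \<longleftrightarrow> (gcode x, gcode y) \<in> ?R\<^sup>*" for x y using 1 2[of x "gcode y"] by auto
  then have "semidec (\<lambda>p. R\<^sup>*\<^sup>* (fst p) (snd p))" unfolding semidec_def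
    by (intro exI[of _ "{n. (pi1 n, pi2 n) \<in> ?R\<^sup>*}"] conjI re_rtrancl[OF B])
      (simp add: gcode_prod_def)
  from semidec_subst[OF this eff_Pair[OF f g]] show ?thesis by simp
qed

lemma in_set_iff_rtranclp: "x \<in> set l \<longleftrightarrow> (\<exists>l'. (\<lambda>l l'. \<exists>a. l = a # l')\<^sup>*\<^sup>* l (x # l'))"
  (is "_ \<longleftrightarrow> (\<exists>l'. ?R\<^sup>*\<^sup>* l (x # l'))")
proof
  show "x \<in> set l \<Longrightarrow> \<exists>l'. ?R\<^sup>*\<^sup>* l (x # l')"
  proof (induction l)
    case (Cons a l)
    have "?R (a # l) l" by simp
    with Cons show ?case by (auto intro: converse_rtranclp_into_rtranclp)
  qed simp
  have "set m \<subseteq> set l" if "?R\<^sup>*\<^sup>* l m" for m using that by induction auto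
  then show "\<exists>l'. ?R\<^sup>*\<^sup>* l (x # l') \<Longrightarrow> x \<in> set l" by fastforce
qed

lemma semidec_in_set [eff_intros]:
  assumes "effective f" "effective g"
  shows "semidec (\<lambda>x. (f x :: 'a::godel_re) \<in> set (g x))"
proof -
  have "semidec (\<lambda>p. (fst p :: 'a) \<in> set (snd p))"
    unfolding in_set_iff_rtranclp by (intro eff_intros semidec_rtranclp)
  from semidec_subst[OF this eff_Pair[OF assms]] show ?thesis by simp
qed

text \<open>The codes of a datatype form such a set; no constructor has more than two recursive arguments.\<close>

inductive_set generated :: "nat set \<Rightarrow> (nat \<times> nat \<times> nat) set \<Rightarrow> nat set" for B R where
  base: "n \<in> B \<Longrightarrow> n \<in> generated B R"
| step: "a \<in> generated B R \<Longrightarrow> b \<in> generated B R \<Longrightarrow> (c, a, b) \<in> R \<Longrightarrow> c \<in> generated B R"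

text \<open>A derivation tree is flattened to the list of its conclusions, each entry justified by
  entries after it. Extending such a list is a semidecidable step, so membership becomes
  reachability from the empty list. The two premises of a step are supplied by concatenating their
  derivations.\<close>

lemma semidec_generated:
  assumes B: "semidec (\<lambda>n. n \<in> B)" and R: "semidec (\<lambda>p. p \<in> R)"
  shows "semidec (\<lambda>n. n \<in> generated B R)"
proof -
  define S where "S l l' \<longleftrightarrow> (\<exists>c. l' = c # l \<and> (c \<in> B \<or> (\<exists>a b. a \<in> set l \<and> b \<in> set l \<and> (c, a, b) \<in> R)))"
    for l l'
  have sound: "set l \<subseteq> generated B R" if "S\<^sup>*\<^sup>* [] l" for l
    using that
  proof induction
    case (step l l')
    from step(2) obtain c where "l' = c # l" "c \<in> B \<or> (\<exists>a b. a \<in> set l \<and> b \<in> set l \<and> (c, a, b) \<in> R)"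
      unfolding S_def by blast
    moreover from this(2) have "c \<in> generated B R"
    proof (elim disjE exE conjE)
      fix a b assume "a \<in> set l" "b \<in> set l" "(c, a, b) \<in> R"
      with step(3) have "a \<in> generated B R" "b \<in> generated B R" by auto
      then show ?thesis using \<open>(c, a, b) \<in> R\<close> by (rule generated.step)
    qed (rule generated.base)
    ultimately show ?case using step(3) by simp
  qed simp
  \<comment> \<open>Justifications survive when further entries are appended at the end.\<close>
  have S_mono: "S (l1 @ l) (l2 @ l)" if "S l1 l2" for l l1 l2 using that unfolding S_def by auto
  have merge: "S\<^sup>*\<^sup>* [] (l1 @ l)" if "S\<^sup>*\<^sup>* [] l1" "S\<^sup>*\<^sup>* [] l" for l l1
    using that(1)
  proof induction
    case base show ?case using that(2) by simp
  next
    case (step l1 l2)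
    from step(3) S_mono[OF step(2)] show ?case by (rule rtranclp.rtrancl_into_rtrancl)
  qed
  have complete: "\<exists>l. S\<^sup>*\<^sup>* [] (n # l)" if "n \<in> generated B R" for n
    using that
  proof induction
    case (base n)
    then have "S [] [n]" by (simp add: S_def)
    then show ?case by blast
  next
    case (step a b c)
    then obtain l l' where "S\<^sup>*\<^sup>* [] (a # l)" "S\<^sup>*\<^sup>* [] (b # l')" by blast
    then have "S\<^sup>*\<^sup>* [] ((a # l) @ (b # l'))" by (rule merge)
    moreover have "S ((a # l) @ (b # l')) (c # (a # l) @ (b # l'))"
      using step(3) by (auto simp: S_def)
    ultimately show ?case by (meson rtranclp.rtrancl_into_rtrancl)
  qed
  have eq: "n \<in> generated B R \<longleftrightarrow> (\<exists>l. S\<^sup>*\<^sup>* [] (n # l))" for n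
    using sound complete by fastforce
  have "semidec (\<lambda>p. S (fst p) (snd p))" unfolding S_def
    by (intro eff_intros semidec_subst[OF B] semidec_subst[OF R])
  then show ?thesis unfolding eq by (intro eff_intros semidec_rtranclp)
qed

subsection \<open>Codes of the syntax\<close>

lemma re_image:
  assumes "re A" "nc f" shows "re (f ` A)"
proof -
  have "re {n. \<exists>m. prod_encode (n, m) \<in> {z. pi2 z \<in> A} \<inter> {z. pi1 z = f (pi2 z)}}"
    by (intro re_proj re_Int re_vimage re_eq assms(1) rc_app1[OF assms(2)] rc_pi1 rc_pi2 rc_proj) simp_all
  moreover have "{n. \<exists>m. prod_encode (n, m) \<in> {z. pi2 z \<in> A} \<inter> {z. pi1 z = f (pi2 z)}} = f ` A" by auto
  ultimately show ?thesis by simp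
qed

instantiation head :: godel
begin
definition "gcode_head = code_head"
instance by standard (simp add: gcode_head_def code_head_inject)
end

primrec code_stp :: "stp \<Rightarrow> nat" where
  "code_stp Base = prod_encode (0, 0)"
| "code_stp (Arr \<tau>2 \<tau>1) = prod_encode (1, prod_encode (code_stp \<tau>2, code_stp \<tau>1))"

lemma code_stp_inject: "code_stp \<tau> = code_stp \<sigma> \<Longrightarrow> \<tau> = \<sigma>"
proof (induction \<tau> arbitrary: \<sigma>)
  case Base then show ?case by (cases \<sigma>) auto
next
  case (Arr \<tau>2 \<tau>1) then show ?case by (cases \<sigma>) auto
qed

instantiation stp :: godel
begin
definition "gcode_stp = code_stp"
instance by standard (simp add: gcode_stp_def code_stp_inject)
end

instance head :: godel_re
proof
  have U: "UNIV = range Var \<union> range Con \<union> range Rec" by (auto, metis head.exhaust rangeI)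
  have "range (gcode :: head \<Rightarrow> nat) = range (\<lambda>n. prod_encode (0, n)) \<union> range (\<lambda>n. prod_encode (1, n)) \<union>
      range (\<lambda>n. prod_encode (2, n))"
    by (subst U) (simp add: image_Un image_image gcode_head_def)
  then show "re (range (gcode :: head \<Rightarrow> nat))"
    by (simp only:) (intro re_Un re_image[OF re_UNIV] rc_pair rc_const rc_proj, simp_all)
qed

text \<open>The three mutually recursive types are generated together, the tags 0, 1 and 2 telling
  terms, neutral terms and spines apart. Constructors with a single recursive argument place no
  condition on the second premise \<open>b\<close>.\<close>

lemma tm_codes_generated:
  fixes R :: "(nat \<times> nat \<times> nat) set"
  defines "R \<equiv> {(c, a, b).
      (\<exists>n. a = prod_encode (1, n) \<and> c = prod_encode (0, prod_encode (0, n))) \<or>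
      (\<exists>n. a = prod_encode (0, n) \<and> c = prod_encode (0, prod_encode (1, n))) \<or>
      (\<exists>n. \<exists>H::head. a = prod_encode (2, n) \<and> c = prod_encode (1, prod_encode (gcode H, n))) \<or>
      (\<exists>m n. a = prod_encode (0, m) \<and> b = prod_encode (2, n) \<and>
        c = prod_encode (2, prod_encode (1, prod_encode (m, n)))) \<or>
      (\<exists>y n. a = prod_encode (2, n) \<and> c = prod_encode (2, prod_encode (2, prod_encode (y, n))))}"
    and "B \<equiv> {prod_encode (2, prod_encode (0, 0))}"
  shows "n \<in> range code_tm \<longleftrightarrow> prod_encode (0, n) \<in> generated B R"
    and "n \<in> range code_neu \<longleftrightarrow> prod_encode (1, n) \<in> generated B R"
    and "n \<in> range code_spine \<longleftrightarrow> prod_encode (2, n) \<in> generated B R"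
    and "semidec (\<lambda>n. n \<in> generated B R)"
proof -
  have gen: "prod_encode (0, code_tm M) \<in> generated B R" "prod_encode (1, code_neu Q) \<in> generated B R"
    "prod_encode (2, code_spine S) \<in> generated B R" for M Q S
  proof (induction M and Q and S)
    case (Neu Q)
    show ?case by (rule generated.step[OF Neu Neu]) (simp add: R_def)
  next
    case (Lam M)
    show ?case by (rule generated.step[OF Lam Lam]) (simp add: R_def)
  next
    case (App H S)
    show ?case by (rule generated.step[OF App App]) (auto simp: R_def gcode_head_def)
  next
    case SNil
    show ?case by (rule generated.base) (simp add: B_def)
  next
    case (SArg M S)
    show ?case by (rule generated.step[OF SArg]) (simp add: R_def)
  next
    case (SPre y S)
    show ?case by (rule generated.step[OF SPre SPre]) (simp add: R_def)
  qed
  have inv: "\<exists>M Q S. z = prod_encode (0, code_tm M) \<or> z = prod_encode (1, code_neu Q) \<or> z = prod_encode (2, code_spine S)"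
    if "z \<in> generated B R" for z
    using that
  proof (induction)
    case (base z)
    then have "z = prod_encode (2, code_spine SNil)" by (simp add: B_def)
    then show ?case by blast
  next
    case (step a b c)
    from step(3) show ?case unfolding R_def mem_Collect_eq prod.case
    proof (elim disjE exE conjE)
      fix n assume "a = prod_encode (1, n)" "c = prod_encode (0, prod_encode (0, n))"
      with step(4) obtain Q where "c = prod_encode (0, code_tm (Neu Q))" by auto
      then show ?thesis by blast
    next
      fix n assume "a = prod_encode (0, n)" "c = prod_encode (0, prod_encode (1, n))"
      with step(4) obtain M where "c = prod_encode (0, code_tm (Lam M))" by auto
      then show ?thesis by blast
    next
      fix n and H :: head assume "a = prod_encode (2, n)" "c = prod_encode (1, prod_encode (gcode H, n))"
      with step(4) obtain S where "c = prod_encode (1, code_neu (App H S))" by (auto simp: gcode_head_def)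
      then show ?thesis by blast
    next
      fix m n assume "a = prod_encode (0, m)" "b = prod_encode (2, n)" "c = prod_encode (2, prod_encode (1, prod_encode (m, n)))"
      with step(4,5) obtain M S where "c = prod_encode (2, code_spine (SArg M S))" by auto
      then show ?thesis by blast
    next
      fix y n assume "a = prod_encode (2, n)" "c = prod_encode (2, prod_encode (2, prod_encode (y, n)))"
      with step(4) obtain S where "c = prod_encode (2, code_spine (SPre y S))" by auto
      then show ?thesis by blast
    qed
  qed
  show "n \<in> range code_tm \<longleftrightarrow> prod_encode (0, n) \<in> generated B R"
    using gen(1) inv by fastforce
  show "n \<in> range code_neu \<longleftrightarrow> prod_encode (1, n) \<in> generated B R"
    using gen(2) inv by fastforce
  show "n \<in> range code_spine \<longleftrightarrow> prod_encode (2, n) \<in> generated B R"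
    using gen(3) inv by fastforce
  show "semidec (\<lambda>n. n \<in> generated B R)"
    by (rule semidec_generated) (unfold B_def R_def mem_Collect_eq split_beta singleton_iff, (intro eff_intros)+)
qed

instance tm :: godel_re
  by standard (simp only: gcode_tm_def re_iff_semidec tm_codes_generated(1),
    intro semidec_subst[OF tm_codes_generated(4)] eff_intros)

instance neu :: godel_re
  by standard (simp only: gcode_neu_def re_iff_semidec tm_codes_generated(2),
    intro semidec_subst[OF tm_codes_generated(4)] eff_intros)

instance spine :: godel_re
  by standard (simp only: gcode_spine_def re_iff_semidec tm_codes_generated(3),
    intro semidec_subst[OF tm_codes_generated(4)] eff_intros)

instance aty :: godel_re
proof
  have U: "UNIV = range (\<lambda>p. Fam (fst p) (snd p))" by (auto simp: image_iff) (metis aty.exhaust)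
  have "range (gcode :: aty \<Rightarrow> nat) = range (gcode :: nat \<times> spine \<Rightarrow> nat)"
    by (subst U) (simp add: image_image gcode_aty_def gcode_prod_def gcode_nat_def gcode_spine_def)
  then show "re (range (gcode :: aty \<Rightarrow> nat))" by (simp add: re_range)
qed

text \<open>A type that is not mutually recursive needs no tags: it is enough that the rules,
  applied to codes, yield codes again.\<close>

lemma binary_codes_generated:
  fixes code :: "'a \<Rightarrow> nat"
  assumes B: "\<And>n. n \<in> B \<Longrightarrow> n \<in> range code" "semidec (\<lambda>n. n \<in> B)"
    and R: "\<And>c a b. (c, code a, code b) \<in> R \<Longrightarrow> c \<in> range code" "semidec (\<lambda>p. p \<in> R)"
    and gen: "\<And>x. code x \<in> generated B R"
  shows "re (range code)"
proof -
  have "z \<in> range code" if "z \<in> generated B R" for z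
    using that by induction (auto intro: B R)
  with gen have "range code = generated B R" by auto
  with semidec_generated[OF B(2) R(2)] show ?thesis by (simp add: re_iff_semidec)
qed

instance stp :: godel_re
proof
  define B where "B = {prod_encode (0, 0)}"
  define R where "R = {(c, a, b). c = prod_encode (1, prod_encode (a, b))}"
  have "code_stp \<tau> \<in> generated B R" for \<tau>
  proof (induction \<tau>)
    case Base show ?case by (rule generated.base) (simp add: B_def)
  next
    case (Arr \<tau>2 \<tau>1) show ?case by (rule generated.step[OF Arr]) (simp add: R_def)
  qed
  then show "re (range (gcode :: stp \<Rightarrow> nat))" unfolding gcode_stp_def
  proof (rule binary_codes_generated[rotated 4])
    fix n assume "n \<in> B"
    then have "n = code_stp Base" by (simp add: B_def)
    then show "n \<in> range code_stp" by blast
  next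
    fix c a b assume "(c, code_stp a, code_stp b) \<in> R"
    then have "c = code_stp (Arr a b)" by (simp add: R_def)
    then show "c \<in> range code_stp" by blast
  qed (unfold B_def R_def mem_Collect_eq split_beta singleton_iff, (intro eff_intros)+)
qed

instance ty :: godel_re
proof
  define B where "B = {n. \<exists>P::aty. n = prod_encode (0, gcode P)}"
  define R where "R = {(c, a, b). c = prod_encode (1, prod_encode (a, b)) \<or> c = prod_encode (2, prod_encode (a, b))}"
  have "code_ty A \<in> generated B R" for A
  proof (induction A)
    case (Atom P) show ?case by (rule generated.base) (auto simp: B_def gcode_aty_def)
  next
    case (Pi A2 A1) show ?case by (rule generated.step[OF Pi]) (simp add: R_def)
  next
    case (PrePi A2 A1) show ?case by (rule generated.step[OF PrePi]) (simp add: R_def)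
  qed
  then show "re (range (gcode :: ty \<Rightarrow> nat))" unfolding gcode_ty_def
  proof (rule binary_codes_generated[rotated 4])
    fix n assume "n \<in> B"
    then obtain P where "n = code_ty (Atom P)" by (auto simp: B_def gcode_aty_def)
    then show "n \<in> range code_ty" by blast
  next
    fix c a b assume "(c, code_ty a, code_ty b) \<in> R"
    then have "c = code_ty (Pi a b) \<or> c = code_ty (PrePi a b)" by (simp add: R_def)
    then show "c \<in> range code_ty" by blast
  qed (unfold B_def R_def mem_Collect_eq split_beta singleton_iff, (intro eff_intros)+)
qed

instance kind :: godel_re
proof
  define B where "B = {n. n = prod_encode (0, 0) \<or> n = prod_encode (1, 0)}"
  define R where "R = {(c, a, b :: nat). \<exists>A::ty. c = prod_encode (2, prod_encode (gcode A, a)) \<or>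
    c = prod_encode (3, prod_encode (gcode A, a))}"
  have "code_kind K \<in> generated B R" for K
  proof (induction K)
    case Type show ?case by (rule generated.base) (simp add: B_def)
  next
    case Cotype show ?case by (rule generated.base) (simp add: B_def)
  next
    case (KPi A K) show ?case by (rule generated.step[OF KPi KPi]) (auto simp: R_def gcode_ty_def)
  next
    case (KPrePi A K) show ?case by (rule generated.step[OF KPrePi KPrePi]) (auto simp: R_def gcode_ty_def)
  qed
  then show "re (range (gcode :: kind \<Rightarrow> nat))" unfolding gcode_kind_def
  proof (rule binary_codes_generated[rotated 4])
    fix n assume "n \<in> B"
    then have "n = code_kind Type \<or> n = code_kind Cotype" by (simp add: B_def)
    then show "n \<in> range code_kind" by blast
  next
    fix c a b assume "(c, code_kind a, code_kind b) \<in> R"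
    then obtain A where "c = code_kind (KPi A a) \<or> c = code_kind (KPrePi A a)"
      by (auto simp: R_def gcode_ty_def)
    then show "c \<in> range code_kind" by blast
  qed (unfold B_def R_def mem_Collect_eq split_beta, (intro eff_intros)+)
qed

instance decl :: godel_re
proof
  have U: "UNIV = range (\<lambda>p. FamDecl (fst p) (snd p)) \<union> range (\<lambda>p. ConDecl (fst p) (snd p)) \<union>
      range (\<lambda>p. RecDecl (fst p) (fst (snd p)) (snd (snd p)))" (is "_ = ?A")
  proof (intro set_eqI iffI)
    fix d show "d \<in> ?A" by (cases d) (auto simp: image_iff)
  qed simp
  have "range (gcode :: decl \<Rightarrow> nat) = (\<lambda>n. prod_encode (0, n)) ` range (gcode :: nat \<times> kind \<Rightarrow> nat) \<union>
      (\<lambda>n. prod_encode (1, n)) ` range (gcode :: nat \<times> ty \<Rightarrow> nat) \<union>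
      (\<lambda>n. prod_encode (2, n)) ` range (gcode :: nat \<times> ty \<times> tm \<Rightarrow> nat)"
    by (subst U) (simp add: image_Un image_image gcode_decl_def gcode_prod_def gcode_nat_def gcode_kind_def gcode_ty_def gcode_tm_def)
  then show "re (range (gcode :: decl \<Rightarrow> nat))"
    by (simp only:) (intro re_Un re_image[OF re_range] rc_pair rc_const rc_proj, simp_all)
qed

instance binding :: godel_re
proof
  have U: "UNIV = range Ord \<union> range Pre" by (auto, metis binding.exhaust rangeI)
  have "range (gcode :: binding \<Rightarrow> nat) = (\<lambda>n. prod_encode (0, n)) ` range (gcode :: ty \<Rightarrow> nat) \<union>
      (\<lambda>n. prod_encode (1, n)) ` range (gcode :: ty \<Rightarrow> nat)"
    by (subst U) (simp add: image_Un image_image gcode_binding_def gcode_ty_def)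
  then show "re (range (gcode :: binding \<Rightarrow> nat))"
    by (simp only:) (intro re_Un re_image[OF re_range] rc_pair rc_const rc_proj, simp_all)
qed

lemmas gcode_syntax_defs =
  gcode_head_def gcode_tm_def gcode_neu_def gcode_spine_def gcode_aty_def gcode_ty_def gcode_kind_def
  gcode_decl_def gcode_binding_def gcode_stp_def gcode_nat_def

lemma eff_ctor1_tagged:
  assumes "\<exists>k. \<forall>x. gcode (C x) = prod_encode (k, gcode x)" "effective f"
  shows "effective (\<lambda>x. C (f x :: 'a::godel_re))"
proof -
  from assms(1) obtain k where k: "\<And>x. gcode (C x) = prod_encode (k, gcode x)" by blast
  show ?thesis
    by (rule eff_ctor1[where F = "\<lambda>n. prod_encode (k, n)"])
      (simp_all add: k assms(2-) rc_pair rc_const rc_proj)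
qed

lemma eff_ctor2_tagged:
  assumes "\<exists>k. \<forall>x y. gcode (C x y) = prod_encode (k, prod_encode (gcode x, gcode y))" "effective f" "effective g"
  shows "effective (\<lambda>x. C (f x :: 'a::godel_re) (g x :: 'b::godel_re))"
proof -
  from assms(1) obtain k where k: "\<And>x y. gcode (C x y) = prod_encode (k, prod_encode (gcode x, gcode y))" by blast
  show ?thesis
    by (rule eff_ctor2[where F = "\<lambda>n. prod_encode (k, n)"])
      (simp_all add: k assms(2-) rc_pair rc_const rc_proj)
qed

lemma eff_unary_constructors [eff_intros]:
  "effective k \<Longrightarrow> effective (\<lambda>x. Var (k x))"
  "effective k \<Longrightarrow> effective (\<lambda>x. Con (k x))"
  "effective k \<Longrightarrow> effective (\<lambda>x. Rec (k x))"
  "effective R \<Longrightarrow> effective (\<lambda>x. Neu (R x))"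
  "effective M \<Longrightarrow> effective (\<lambda>x. Lam (M x))"
  "effective P \<Longrightarrow> effective (\<lambda>x. Atom (P x))"
  "effective A \<Longrightarrow> effective (\<lambda>x. Ord (A x))"
  "effective A \<Longrightarrow> effective (\<lambda>x. Pre (A x))"
  by (rule eff_ctor1_tagged; simp add: gcode_syntax_defs)+

lemma eff_binary_constructors [eff_intros]:
  "effective M \<Longrightarrow> effective S \<Longrightarrow> effective (\<lambda>x. SArg (M x) (S x))"
  "effective k \<Longrightarrow> effective S \<Longrightarrow> effective (\<lambda>x. SPre (k x) (S x))"
  "effective A \<Longrightarrow> effective B \<Longrightarrow> effective (\<lambda>x. Pi (A x) (B x))"
  "effective A \<Longrightarrow> effective B \<Longrightarrow> effective (\<lambda>x. PrePi (A x) (B x))"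
  "effective A \<Longrightarrow> effective K \<Longrightarrow> effective (\<lambda>x. KPi (A x) (K x))"
  "effective A \<Longrightarrow> effective K \<Longrightarrow> effective (\<lambda>x. KPrePi (A x) (K x))"
  "effective k \<Longrightarrow> effective K \<Longrightarrow> effective (\<lambda>x. FamDecl (k x) (K x))"
  "effective k \<Longrightarrow> effective A \<Longrightarrow> effective (\<lambda>x. ConDecl (k x) (A x))"
  "effective s \<Longrightarrow> effective t \<Longrightarrow> effective (\<lambda>x. Arr (s x) (t x))"
  by (rule eff_ctor2_tagged; simp add: gcode_syntax_defs)+

lemma eff_App [eff_intros]: "effective H \<Longrightarrow> effective S \<Longrightarrow> effective (\<lambda>x. App (H x) (S x))"
  and eff_Fam [eff_intros]: "effective k \<Longrightarrow> effective S \<Longrightarrow> effective (\<lambda>x. Fam (k x) (S x))"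
  by (rule eff_ctor2[where F = "\<lambda>n. n"]; simp add: gcode_syntax_defs rc_proj)+

lemma eff_RecDecl [eff_intros]:
  assumes "effective f" "effective g" "effective h"
  shows "effective (\<lambda>x. RecDecl (f x) (g x) (h x))"
  using eff_ctor2_tagged[of "\<lambda>r p. RecDecl r (fst p) (snd p)", OF _ assms(1) eff_Pair[OF assms(2,3)]]
  by (simp add: gcode_syntax_defs gcode_prod_def)

section \<open>Effective recursion\<close>

text \<open>Scott continuity for partial functions. Finite parts are association lists because these
  have Goedel numbers.\<close>

definition finitary :: "(('a \<Rightarrow> 'b option) \<Rightarrow> 'c option) \<Rightarrow> bool" where
  "finitary G \<longleftrightarrow>
    (\<forall>g c. G g = Some c \<longrightarrow> (\<exists>ps. map_of ps \<subseteq>\<^sub>m g \<and> G (map_of ps) = Some c)) \<and>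
    (\<forall>g g' c. g \<subseteq>\<^sub>m g' \<longrightarrow> G g = Some c \<longrightarrow> G g' = Some c)"

text \<open>In essence an enumeration operator on partial functions: it is evaluated on finite
  tables only, and continuity determines it elsewhere. The parameter \<open>e\<close> collects the
  input together with the variables bound by enclosing case distinctions and binds.\<close>

definition eff_op :: "(('a::godel_re \<Rightarrow> 'b::godel_re option) \<Rightarrow> 'e::godel_re \<Rightarrow> 'c::godel_re option) \<Rightarrow> bool" where
  "eff_op F \<longleftrightarrow> (\<forall>e. finitary (\<lambda>g. F g e)) \<and>
    semidec (\<lambda>z. F (map_of (fst (snd z))) (fst z) = Some (snd (snd z)))"

lemma op_finitary: "eff_op F \<Longrightarrow> finitary (\<lambda>g. F g e)"
  by (simp add: eff_op_def)

lemma op_semidec: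
  assumes "eff_op F" "effective a" "effective b" "effective c"
  shows "semidec (\<lambda>x. F (map_of (a x)) (b x) = Some (c x))"
proof -
  have "effective (\<lambda>x. (b x, a x, c x))" by (intro eff_intros assms)
  from semidec_subst[OF _ this] assms(1)[unfolded eff_op_def] show ?thesis by fastforce
qed

lemma eff_opI:
  "(\<And>e. finitary (\<lambda>g. F g e)) \<Longrightarrow>
    semidec (\<lambda>z. F (map_of (fst (snd z))) (fst z) = Some (snd (snd z))) \<Longrightarrow> eff_op F"
  by (simp add: eff_op_def)

lemma finitary_const: "finitary (\<lambda>g. c)"
  by (auto simp: finitary_def intro: exI[of _ "[]"])

lemma op_ret [eff_intros]:
  assumes "effective t" shows "eff_op (\<lambda>g :: 'c::godel_re \<Rightarrow> 'd::godel_re option. \<lambda>e. Some (t e))"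
proof (rule eff_opI)
  show "semidec (\<lambda>z :: _ \<times> ('c \<times> 'd) list \<times> _. Some (t (fst z)) = Some (snd (snd z)))"
    unfolding option.inject by (intro eff_intros eff_compose[OF assms])
qed (rule finitary_const)

lemma op_None [eff_intros]: "eff_op (\<lambda>g e. None)"
  by (rule eff_opI) (simp_all add: finitary_const semidec_const)

text \<open>Table lookup as reachability, like list membership: entries with another key are
  skipped, and the key travels along unchanged in the first component.\<close>

lemma map_of_eq_Some_iff_rtranclp:
  "map_of ps x = Some y \<longleftrightarrow>
    (\<exists>ps'. (\<lambda>u v. fst u = fst v \<and> (\<exists>a b. a \<noteq> fst u \<and> snd u = (a, b) # snd v))\<^sup>*\<^sup>* (x, ps) (x, (x, y) # ps'))"
  (is "_ \<longleftrightarrow> (\<exists>ps'. ?R\<^sup>*\<^sup>* _ _)")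
proof
  show "map_of ps x = Some y \<Longrightarrow> \<exists>ps'. ?R\<^sup>*\<^sup>* (x, ps) (x, (x, y) # ps')"
  proof (induction ps)
    case (Cons p ps)
    show ?case
    proof (cases "fst p = x")
      case True
      with Cons.prems have "p = (x, y)" by (cases p) auto
      then show ?thesis by blast
    next
      case False
      then have R: "?R (x, p # ps) (x, ps)" by (cases p) auto
      from False Cons obtain ps' where "?R\<^sup>*\<^sup>* (x, ps) (x, (x, y) # ps')" by (cases p) auto
      from converse_rtranclp_into_rtranclp[of ?R, OF R this] show ?thesis by blast
    qed
  qed simp
  have inv: "fst u = fst v \<and> map_of (snd u) (fst u) = map_of (snd v) (fst v)" if "?R\<^sup>*\<^sup>* u v" for u v
    using that by induction auto
  show "\<exists>ps'. ?R\<^sup>*\<^sup>* (x, ps) (x, (x, y) # ps') \<Longrightarrow> map_of ps x = Some y"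
    by (elim exE) (drule inv, simp)
qed

lemma semidec_map_of:
  assumes "effective a" "effective b" "effective c"
  shows "semidec (\<lambda>x. map_of (a x) (b x :: 'a::godel_re) = Some (c x :: 'b::godel_re))"
proof -
  have "semidec (\<lambda>z. map_of (fst z) (fst (snd z) :: 'a) = Some (snd (snd z) :: 'b))"
    unfolding map_of_eq_Some_iff_rtranclp by (intro eff_intros semidec_rtranclp)
  from semidec_subst[OF this eff_Pair[OF assms(1) eff_Pair[OF assms(2,3)]]] show ?thesis by simp
qed

text \<open>A call is answered by a table with the single entry for \<open>t e\<close>.\<close>

lemma op_call [eff_intros]:
  fixes t :: "'e::godel_re \<Rightarrow> 'a::godel_re"
  assumes "effective t"
  shows "eff_op (\<lambda>g :: 'a \<Rightarrow> 'b::godel_re option. \<lambda>e. g (t e))"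
proof (rule eff_opI)
  fix e
  show "finitary (\<lambda>g :: 'a \<Rightarrow> 'b option. g (t e))"
    unfolding finitary_def
  proof (intro conjI allI impI)
    fix g :: "'a \<Rightarrow> 'b option" and c
    assume "g (t e) = Some c"
    then show "\<exists>ps. map_of ps \<subseteq>\<^sub>m g \<and> map_of ps (t e) = Some c"
      by (intro exI[of _ "[(t e, c)]"]) (auto simp: map_le_def)
  qed (auto simp: map_le_def dom_def)
  show "semidec (\<lambda>z :: 'e \<times> ('a \<times> 'b) list \<times> 'b. map_of (fst (snd z)) (t (fst z)) = Some (snd (snd z)))"
    by (intro semidec_map_of eff_intros eff_compose[OF assms])
qed

lemma map_leI: "(\<And>x y. m x = Some y \<Longrightarrow> m' x = Some y) \<Longrightarrow> m \<subseteq>\<^sub>m m'"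
  by (auto simp: map_le_def)

lemma map_leD: "m \<subseteq>\<^sub>m m' \<Longrightarrow> m x = Some y \<Longrightarrow> m' x = Some y"
  by (metis domI map_le_def)

text \<open>Appending is safe although the first table shadows the second: both are parts of the
  same \<open>g\<close> and agree where they overlap.\<close>

lemma map_of_append_le:
  assumes "map_of ps \<subseteq>\<^sub>m g" "map_of qs \<subseteq>\<^sub>m g"
  shows "map_of (ps @ qs) \<subseteq>\<^sub>m g" "map_of ps \<subseteq>\<^sub>m map_of (ps @ qs)" "map_of qs \<subseteq>\<^sub>m map_of (ps @ qs)"
proof -
  show "map_of (ps @ qs) \<subseteq>\<^sub>m g" using assms by (simp add: map_add_le_mapI)
  show "map_of ps \<subseteq>\<^sub>m map_of (ps @ qs)" by (simp add: map_le_map_add)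
  show "map_of qs \<subseteq>\<^sub>m map_of (ps @ qs)"
    unfolding map_le_def
  proof
    fix x assume x: "x \<in> dom (map_of qs)"
    then have "map_of qs x = g x" using assms(2) by (simp add: map_le_def)
    moreover have "map_of ps x = g x" if "map_of ps x \<noteq> None"
      using assms(1) that by (auto simp: map_le_def dom_def)
    ultimately show "map_of qs x = map_of (ps @ qs) x" by (auto simp: map_add_def split: option.split)
  qed
qed

lemma finitary_bind:
  assumes F: "finitary F" and G: "\<And>c. finitary (\<lambda>g. G g c)"
  shows "finitary (\<lambda>g. Option.bind (F g) (G g))"
  unfolding finitary_def
proof (intro conjI allI impI)
  fix g d assume "Option.bind (F g) (G g) = Some d"
  then obtain c where c: "F g = Some c" "G g c = Some d" by (auto simp: bind_eq_Some_conv)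
  from F c(1) obtain ps where ps: "map_of ps \<subseteq>\<^sub>m g" "F (map_of ps) = Some c" unfolding finitary_def by blast
  from G[of c] c(2) obtain qs where qs: "map_of qs \<subseteq>\<^sub>m g" "G (map_of qs) c = Some d" unfolding finitary_def by blast
  note le = map_of_append_le[OF ps(1) qs(1)]
  from F le(2) ps(2) have "F (map_of (ps @ qs)) = Some c" unfolding finitary_def by blast
  moreover from G[of c] le(3) qs(2) have "G (map_of (ps @ qs)) c = Some d" unfolding finitary_def by blast
  ultimately show "\<exists>ps. map_of ps \<subseteq>\<^sub>m g \<and> Option.bind (F (map_of ps)) (G (map_of ps)) = Some d"
    using le(1) by (intro exI[of _ "ps @ qs"]) simp
next
  fix g g' d assume le: "g \<subseteq>\<^sub>m g'" and "Option.bind (F g) (G g) = Some d"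
  then obtain c where c: "F g = Some c" "G g c = Some d" by (auto simp: bind_eq_Some_conv)
  have "F g' = Some c" using F le c(1) unfolding finitary_def by blast
  moreover have "G g' c = Some d" using G[of c] le c(2) unfolding finitary_def by blast
  ultimately show "Option.bind (F g') (G g') = Some d" by simp
qed

lemma op_bind [eff_intros]:
  assumes F: "eff_op F" and G: "eff_op (\<lambda>g p. G g (fst p) (snd p))"
  shows "eff_op (\<lambda>g e. Option.bind (F g e) (\<lambda>c. G g e c))"
proof (rule eff_opI)
  fix e
  show "finitary (\<lambda>g. Option.bind (F g e) (\<lambda>c. G g e c))"
    using op_finitary[OF G, of "(e, _)"] by (intro finitary_bind op_finitary[OF F]) simp
  have "semidec (\<lambda>z. \<exists>c. F (map_of (fst (snd z))) (fst z) = Some c \<and>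
      G (map_of (fst (snd z))) (fst z) c = Some (snd (snd z)))"
    using op_semidec[OF G, of "\<lambda>z. fst (snd (fst z))" "\<lambda>z. (fst (fst z), snd z)" "\<lambda>z. snd (snd (fst z))"]
    by (intro semidec_ex semidec_conj op_semidec[OF F]) (simp_all add: eff_intros)
  then show "semidec (\<lambda>z. Option.bind (F (map_of (fst (snd z))) (fst z)) (\<lambda>c. G (map_of (fst (snd z))) (fst z) c) =
      Some (snd (snd z)))"
    by (simp add: bind_eq_Some_conv)
qed

text \<open>The condition does not see the argument function. A test on the result of a call is
  therefore written as \<open>Option.bind\<close> followed by a conditional, the result having
  become part of the parameter.\<close>

lemma op_if [eff_intros]:
  assumes "effective b" "eff_op F" "eff_op G"
  shows "eff_op (\<lambda>g e. if b e then F g e else G g e)"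
proof (rule eff_opI)
  fix e
  show "finitary (\<lambda>g. if b e then F g e else G g e)"
    using assms(2,3) by (cases "b e") (auto dest: op_finitary)
  have "semidec (\<lambda>z. (b (fst z) = True \<and> F (map_of (fst (snd z))) (fst z) = Some (snd (snd z))) \<or>
      (b (fst z) = False \<and> G (map_of (fst (snd z))) (fst z) = Some (snd (snd z))))"
    by (intro semidec_disj semidec_conj op_semidec[OF assms(2)] op_semidec[OF assms(3)])
      (intro eff_intros eff_compose[OF assms(1)])+
  moreover have "(b (fst z) = True \<and> F (map_of (fst (snd z))) (fst z) = Some (snd (snd z))) \<or>
      (b (fst z) = False \<and> G (map_of (fst (snd z))) (fst z) = Some (snd (snd z))) \<longleftrightarrow>
    (if b (fst z) then F (map_of (fst (snd z))) (fst z) else G (map_of (fst (snd z))) (fst z)) = Some (snd (snd z))" for z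
    by auto
  ultimately show "semidec (\<lambda>z. (if b (fst z) then F (map_of (fst (snd z))) (fst z) else G (map_of (fst (snd z))) (fst z)) = Some (snd (snd z)))"
    by simp
qed

lemma op_case_prod [eff_intros]:
  assumes "eff_op (\<lambda>g e. F g e (fst (t e)) (snd (t e)))"
  shows "eff_op (\<lambda>g e. case t e of (x, y) \<Rightarrow> F g e x y)"
  using assms by (simp add: split_beta)

text \<open>Operators that ignore their argument function are ordinary functions. This carries
  conditionals and case distinctions over from operators to functions.\<close>

lemma op_effective:
  assumes "eff_op (\<lambda>g :: nat \<Rightarrow> nat option. \<lambda>e. Some (f e))"
  shows "effective f"
  unfolding effective_def
  using op_semidec[OF assms, of "\<lambda>z. []" fst snd] by (simp add: eff_intros)

text \<open>Kleene's first recursion theorem. The limit of the iterates from the empty function is a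
  fixed point by continuity. Its graph is semidecidable because every value has a finite derivation:
  a table in which each entry is computed from the entries after it.\<close>

theorem op_fixpoint:
  fixes F :: "('a::godel_re \<Rightarrow> 'b::godel_re option) \<Rightarrow> 'a \<Rightarrow> 'b option"
  assumes F: "eff_op F"
  shows "\<exists>h. (\<forall>x. h x = F h x) \<and> semidec (\<lambda>p. h (fst p) = Some (snd p))"
proof -
  define it where "it n = (F ^^ n) Map.empty" for n
  have it_Suc: "it (Suc n) = F (it n)" for n by (simp add: it_def)
  have mono: "F g x = Some y \<Longrightarrow> g \<subseteq>\<^sub>m g' \<Longrightarrow> F g' x = Some y" for g g' x y
    using op_finitary[OF F, of x] unfolding finitary_def by blast
  have mono': "g \<subseteq>\<^sub>m g' \<Longrightarrow> F g \<subseteq>\<^sub>m F g'" for g g'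
    using mono by (blast intro: map_leI)
  have it_le_Suc: "it n \<subseteq>\<^sub>m it (Suc n)" for n
  proof (induction n)
    case 0 show ?case by (simp add: it_def)
  next
    case (Suc n) then show ?case unfolding it_Suc[of "Suc n"] it_Suc[of n] by (rule mono')
  qed
  have it_le: "it m \<subseteq>\<^sub>m it n" if "m \<le> n" for m n
    using that by (induction rule: dec_induct) (auto intro: map_le_trans it_le_Suc)
  \<comment> \<open>The iterates increase, so all stages defining \<open>x\<close> give the same
    value; the least of them is picked.\<close>
  define h where "h x = (if \<exists>n y. it n x = Some y then it (LEAST n. it n x \<noteq> None) x else None)" for x
  have h_iff: "h x = Some y \<longleftrightarrow> (\<exists>n. it n x = Some y)" for x y
  proof
    show "h x = Some y \<Longrightarrow> \<exists>n. it n x = Some y" by (auto simp: h_def split: if_splits)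
    assume "\<exists>n. it n x = Some y"
    then obtain n where n: "it n x = Some y" by blast
    then have "it n x \<noteq> None" by simp
    note l = LeastI[of "\<lambda>n. it n x \<noteq> None", OF this] Least_le[of "\<lambda>n. it n x \<noteq> None", OF this]
    from it_le[OF l(2)] l(1) have "it (LEAST n. it n x \<noteq> None) x = it n x" by (auto simp: map_le_def dom_def)
    with n show "h x = Some y" by (auto simp: h_def)
  qed
  have it_le_h: "it n \<subseteq>\<^sub>m h" for n using h_iff by (blast intro: map_leI)
  \<comment> \<open>The stages at which the keys of the table become defined have a maximum, because
    a table has finitely many keys; that stage already lies above the table.\<close>
  have finite_le: "\<exists>n. map_of ps \<subseteq>\<^sub>m it n" if "map_of ps \<subseteq>\<^sub>m h" for ps
  proof -
    have "\<forall>x\<in>dom (map_of ps). \<exists>n. it n x = map_of ps x"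
    proof
      fix x assume "x \<in> dom (map_of ps)"
      then obtain y where "map_of ps x = Some y" by blast
      moreover from map_leD[OF that this] have "h x = Some y" .
      ultimately show "\<exists>n. it n x = map_of ps x" using h_iff by simp
    qed
    then obtain N where N: "\<And>x. x \<in> dom (map_of ps) \<Longrightarrow> it (N x) x = map_of ps x" by metis
    define n where "n = Max (insert 0 (N ` dom (map_of ps)))"
    have "N x \<le> n" if "x \<in> dom (map_of ps)" for x
      unfolding n_def using that by (intro Max_ge) (auto simp: finite_dom_map_of)
    then have "map_of ps x = it n x" if "x \<in> dom (map_of ps)" for x
      using that N[OF that] it_le[of "N x" n] by (metis domIff map_le_def)
    then show ?thesis unfolding map_le_def by blast
  qed
  have fix_h: "h x = F h x" for x
  proof -
    have "h x = Some y \<longleftrightarrow> F h x = Some y" for y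
    proof
      assume "h x = Some y"
      then obtain n where n: "it n x = Some y" using h_iff by blast
      from map_leD[OF it_le_Suc n] have "it (Suc n) x = Some y" .
      then show "F h x = Some y" unfolding it_Suc using it_le_h by (rule mono)
    next
      assume "F h x = Some y"
      then obtain ps where ps: "map_of ps \<subseteq>\<^sub>m h" "F (map_of ps) x = Some y"
        using op_finitary[OF F, of x] unfolding finitary_def by blast
      from finite_le[OF ps(1)] obtain n where "map_of ps \<subseteq>\<^sub>m it n" by blast
      with ps(2) have "it (Suc n) x = Some y" unfolding it_Suc by (rule mono)
      then show "h x = Some y" using h_iff by blast
    qed
    then show ?thesis by (metis option.exhaust)
  qed
  define D where "D ps ps' \<longleftrightarrow> (\<exists>x y. ps' = (x, y) # ps \<and> F (map_of ps) x = Some y)" for ps ps'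
  have D_le: "map_of ps \<subseteq>\<^sub>m h" if "D\<^sup>*\<^sup>* [] ps" for ps
    using that
  proof induction
    case (step ps ps')
    then obtain x y where xy: "ps' = (x, y) # ps" "F (map_of ps) x = Some y" by (auto simp: D_def)
    from mono[OF xy(2) step(3)] have "h x = Some y" by (simp add: fix_h[of x])
    with step(3) xy(1) show ?case by (auto simp: map_le_def)
  qed simp
  have D_append: "D\<^sup>*\<^sup>* [] (ps @ qs)" if "D\<^sup>*\<^sup>* [] ps" "D\<^sup>*\<^sup>* [] qs" for ps qs
    using that(1)
  proof induction
    case base show ?case using that(2) by simp
  next
    case (step ps ps')
    then obtain x y where xy: "ps' = (x, y) # ps" "F (map_of ps) x = Some y" by (auto simp: D_def)
    \<comment> \<open>Both tables lie below \<open>h\<close>, so enlarging \<open>ps\<close> by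
      \<open>qs\<close> only adds information and preserves the computed value.\<close>
    from mono[OF xy(2) map_of_append_le(2)[OF D_le[OF step(1)] D_le[OF that(2)]]]
    have "D (ps @ qs) (ps' @ qs)" by (auto simp: D_def xy(1))
    with step(3) show ?case by (rule rtranclp.rtrancl_into_rtrancl)
  qed
  have D_it: "\<exists>ps. D\<^sup>*\<^sup>* [] ps \<and> map_of ps x = Some y" if "it n x = Some y" for n x y
    using that
  proof (induction n arbitrary: x y)
    case 0 then show ?case by (simp add: it_def)
  next
    case (Suc n)
    then have "F (it n) x = Some y" by (simp add: it_Suc)
    then obtain qs where qs: "map_of qs \<subseteq>\<^sub>m it n" "F (map_of qs) x = Some y"
      using op_finitary[OF F, of x] unfolding finitary_def by blast
    \<comment> \<open>The finitely many values of \<open>qs\<close> have separate derivations; one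
      key at a time, these are merged into a single table.\<close>
    have "\<exists>ps. D\<^sup>*\<^sup>* [] ps \<and> (\<forall>z\<in>Z. map_of qs z = map_of ps z)" if "finite Z" "Z \<subseteq> dom (map_of qs)" for Z
      using that
    proof induction
      case empty show ?case by blast
    next
      case (insert z Z)
      then obtain ps where ps: "D\<^sup>*\<^sup>* [] ps" "\<forall>z\<in>Z. map_of qs z = map_of ps z" by auto
      from insert.prems obtain w where w: "map_of qs z = Some w" by auto
      from map_leD[OF qs(1) this] have "it n z = Some w" .
      with Suc.IH obtain ps' where ps': "D\<^sup>*\<^sup>* [] ps'" "map_of ps' z = Some w" by blast
      note le = map_of_append_le[OF D_le[OF ps'(1)] D_le[OF ps(1)]]
      have "map_of qs u = map_of (ps' @ ps) u" if "u \<in> insert z Z" for u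
      proof (cases "u = z")
        case True then show ?thesis using ps'(2) w by simp
      next
        case False
        with that ps(2) have "map_of qs u = map_of ps u" by simp
        moreover have "u \<in> dom (map_of qs)" using that insert.prems by blast
        with calculation have "u \<in> dom (map_of ps)" by (simp add: domIff)
        ultimately show ?thesis using le(3) by (simp add: map_le_def)
      qed
      with D_append[OF ps'(1) ps(1)] show ?case by blast
    qed
    from this[OF finite_dom_map_of order.refl] obtain ps where
      ps: "D\<^sup>*\<^sup>* [] ps" "map_of qs \<subseteq>\<^sub>m map_of ps" unfolding map_le_def by blast
    from mono[OF qs(2) ps(2)] have "D ps ((x, y) # ps)" by (auto simp: D_def)
    with ps(1) have "D\<^sup>*\<^sup>* [] ((x, y) # ps)" by (rule rtranclp.rtrancl_into_rtrancl)
    then show ?case by (intro exI[of _ "(x, y) # ps"]) simp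
  qed
  have h_D: "h x = Some y \<longleftrightarrow> (\<exists>ps. D\<^sup>*\<^sup>* [] ps \<and> map_of ps x = Some y)" for x y
  proof
    show "h x = Some y \<Longrightarrow> \<exists>ps. D\<^sup>*\<^sup>* [] ps \<and> map_of ps x = Some y" using h_iff D_it by blast
    assume "\<exists>ps. D\<^sup>*\<^sup>* [] ps \<and> map_of ps x = Some y"
    then obtain ps where ps: "D\<^sup>*\<^sup>* [] ps" "map_of ps x = Some y" by blast
    from map_leD[OF D_le[OF ps(1)] ps(2)] show "h x = Some y" .
  qed
  have "semidec (\<lambda>p. D (fst p) (snd p))"
    unfolding D_def by (intro semidec_ex semidec_conj op_semidec[OF F]) (intro eff_intros)+
  then have "semidec (\<lambda>p. h (fst p) = Some (snd p))"
    unfolding h_D by (intro semidec_ex semidec_conj semidec_rtranclp semidec_map_of eff_intros)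
  with fix_h show ?thesis by blast
qed

text \<open>The third premise knows nothing about \<open>h\<close> but the equation, so each use
  unfolds it along an induction that fits the intended function. The map \<open>t\<close> prepares
  the initial call, such as an empty memo list or an injection into a sum that hosts several
  functions.\<close>

lemma eff_rec:
  fixes F :: "('a::godel_re \<Rightarrow> 'b::godel_re option) \<Rightarrow> 'a \<Rightarrow> 'b option" and t :: "'x::godel_re \<Rightarrow> 'a"
  assumes F: "eff_op F" and t: "effective t"
    and f: "\<And>h x. (\<And>y. h y = F h y) \<Longrightarrow> h (t x) = Some (f x)"
  shows "effective f"
proof -
  from op_fixpoint[OF F] obtain h where h: "\<And>y. h y = F h y" "semidec (\<lambda>p. h (fst p) = Some (snd p))"
    by blast
  have t': "effective (\<lambda>p :: 'x \<times> 'b. (t (fst p), snd p))" by (intro eff_intros eff_compose[OF t])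
  from semidec_subst[OF h(2) t'] show ?thesis
    unfolding effective_def using f[of h, OF h(1)] by simp
qed

lemma op_reindex:
  assumes "eff_op F" "effective t" shows "eff_op (\<lambda>g e. F g (t e))"
proof (rule eff_opI)
  fix e
  show "finitary (\<lambda>g. F g (t e))" using assms(1) by (rule op_finitary)
next
  show "semidec (\<lambda>z. F (map_of (fst (snd z))) (t (fst z)) = Some (snd (snd z)))"
    by (intro op_semidec[OF assms(1)] eff_intros eff_compose[OF assms(2)])
qed

text \<open>One scheme for all datatypes: four constructors are the most that occur, and smaller
  types repeat one. A constructor without arguments is presented as a constant function of a dummy
  number; constructor arguments are added to the parameter as a tuple.\<close>

lemma op_cases:
  fixes t :: "'e::godel_re \<Rightarrow> 't::godel_re"
  assumes exh: "\<And>x. (\<exists>y. x = c1 y) \<or> (\<exists>y. x = c2 y) \<or> (\<exists>y. x = c3 y) \<or> (\<exists>y. x = c4 y)"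
    and t: "effective t" and c: "effective c1" "effective c2" "effective c3" "effective c4"
    and G: "eff_op G1" "eff_op G2" "eff_op G3" "eff_op G4"
    and F: "\<And>g e y. t e = c1 y \<Longrightarrow> F g e = G1 g (e, y)" "\<And>g e y. t e = c2 y \<Longrightarrow> F g e = G2 g (e, y)"
      "\<And>g e y. t e = c3 y \<Longrightarrow> F g e = G3 g (e, y)" "\<And>g e y. t e = c4 y \<Longrightarrow> F g e = G4 g (e, y)"
  shows "eff_op F"
proof (rule eff_opI)
  fix e
  from exh[of "t e"] show "finitary (\<lambda>g. F g e)"
    by (elim disjE exE) (simp_all only: F op_finitary[OF G(1)] op_finitary[OF G(2)] op_finitary[OF G(3)] op_finitary[OF G(4)])
next
  have "F g e = Some r \<longleftrightarrow> (\<exists>y. t e = c1 y \<and> G1 g (e, y) = Some r) \<or> (\<exists>y. t e = c2 y \<and> G2 g (e, y) = Some r) \<or>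
    (\<exists>y. t e = c3 y \<and> G3 g (e, y) = Some r) \<or> (\<exists>y. t e = c4 y \<and> G4 g (e, y) = Some r)"
    (is "_ \<longleftrightarrow> ?R") for g e r
  proof
    show "F g e = Some r \<Longrightarrow> ?R" using exh[of "t e"] by (elim disjE exE) (simp_all only: F, blast+)
    show "?R \<Longrightarrow> F g e = Some r" by (elim disjE exE conjE) (simp_all only: F)
  qed
  then show "semidec (\<lambda>z. F (map_of (fst (snd z))) (fst z) = Some (snd (snd z)))"
    by (simp only:) (intro semidec_disj semidec_ex semidec_conj op_semidec[OF G(1)] op_semidec[OF G(2)]
      op_semidec[OF G(3)] op_semidec[OF G(4)] semidec_eq eff_compose[OF t] c[THEN eff_compose] eff_intros)
qed

lemma op_case_option [eff_intros]:
  assumes "effective t" "eff_op A" "eff_op (\<lambda>g p. B g (fst p) (snd p))"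
  shows "eff_op (\<lambda>g e. case t e of None \<Rightarrow> A g e | Some x \<Rightarrow> B g e x)"
proof (rule op_cases[OF _ assms(1) _ _ _ _ op_reindex[OF assms(2) eff_fst[OF eff_id]] assms(3) assms(3) assms(3),
    where ?c1.0 = "\<lambda>_ :: nat. None" and ?c2.0 = Some and ?c3.0 = Some and ?c4.0 = Some], goal_cases)
  case (1 x) show ?case by (cases x) auto
qed (simp_all add: eff_intros)

lemma op_case_list [eff_intros]:
  assumes "effective t" "eff_op A" "eff_op (\<lambda>g p. B g (fst p) (fst (snd p)) (snd (snd p)))"
  shows "eff_op (\<lambda>g e. case t e of Nil \<Rightarrow> A g e | x # y \<Rightarrow> B g e x y)"
proof (rule op_cases[OF _ assms(1) _ _ _ _ op_reindex[OF assms(2) eff_fst[OF eff_id]] assms(3) assms(3) assms(3),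
    where ?c1.0 = "\<lambda>_ :: nat. Nil" and ?c2.0 = "\<lambda>p. Cons (fst p) (snd p)" and ?c3.0 = "\<lambda>p. Cons (fst p) (snd p)" and ?c4.0 = "\<lambda>p. Cons (fst p) (snd p)"], goal_cases)
  case (1 x) show ?case by (cases x) auto
qed (simp_all add: eff_intros)

lemma op_case_nat [eff_intros]:
  assumes "effective t" "eff_op A" "eff_op (\<lambda>g p. B g (fst p) (snd p))"
  shows "eff_op (\<lambda>g e. case t e of 0 \<Rightarrow> A g e | Suc x \<Rightarrow> B g e x)"
proof (rule op_cases[OF _ assms(1) _ _ _ _ op_reindex[OF assms(2) eff_fst[OF eff_id]] assms(3) assms(3) assms(3),
    where ?c1.0 = "\<lambda>_ :: nat. 0" and ?c2.0 = Suc and ?c3.0 = Suc and ?c4.0 = Suc], goal_cases)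
  case (1 x) show ?case by (cases x) auto
qed (simp_all add: eff_intros)

lemma op_case_sum [eff_intros]:
  assumes "effective t" "eff_op (\<lambda>g p. A g (fst p) (snd p))" "eff_op (\<lambda>g p. B g (fst p) (snd p))"
  shows "eff_op (\<lambda>g e. case t e of Inl x \<Rightarrow> A g e x | Inr x \<Rightarrow> B g e x)"
proof (rule op_cases[OF _ assms(1) _ _ _ _ assms(2) assms(3) assms(3) assms(3),
    where ?c1.0 = Inl and ?c2.0 = Inr and ?c3.0 = Inr and ?c4.0 = Inr], goal_cases)
  case (1 x) show ?case by (cases x) auto
qed (simp_all add: eff_intros)

lemma op_case_head [eff_intros]:
  assumes "effective t" "eff_op (\<lambda>g p. A g (fst p) (snd p))" "eff_op (\<lambda>g p. B g (fst p) (snd p))" "eff_op (\<lambda>g p. C g (fst p) (snd p))"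
  shows "eff_op (\<lambda>g e. case t e of Var x \<Rightarrow> A g e x | Con x \<Rightarrow> B g e x | Rec x \<Rightarrow> C g e x)"
proof (rule op_cases[OF _ assms(1) _ _ _ _ assms(2) assms(3) assms(4) assms(4),
    where ?c1.0 = Var and ?c2.0 = Con and ?c3.0 = Rec and ?c4.0 = Rec], goal_cases)
  case (1 x) show ?case by (cases x) auto
qed (simp_all add: eff_intros)

lemma op_case_tm [eff_intros]:
  assumes "effective t" "eff_op (\<lambda>g p. A g (fst p) (snd p))" "eff_op (\<lambda>g p. B g (fst p) (snd p))"
  shows "eff_op (\<lambda>g e. case t e of Neu x \<Rightarrow> A g e x | Lam x \<Rightarrow> B g e x)"
proof (rule op_cases[OF _ assms(1) _ _ _ _ assms(2) assms(3) assms(3) assms(3),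
    where ?c1.0 = Neu and ?c2.0 = Lam and ?c3.0 = Lam and ?c4.0 = Lam], goal_cases)
  case (1 x) show ?case by (cases x) auto
qed (simp_all add: eff_intros)

lemma op_case_neu [eff_intros]:
  assumes "effective t" "eff_op (\<lambda>g p. A g (fst p) (fst (snd p)) (snd (snd p)))"
  shows "eff_op (\<lambda>g e. case t e of App x y \<Rightarrow> A g e x y)"
proof (rule op_cases[OF _ assms(1) _ _ _ _ assms(2) assms(2) assms(2) assms(2),
    where ?c1.0 = "\<lambda>p. App (fst p) (snd p)" and ?c2.0 = "\<lambda>p. App (fst p) (snd p)" and ?c3.0 = "\<lambda>p. App (fst p) (snd p)" and ?c4.0 = "\<lambda>p. App (fst p) (snd p)"], goal_cases)
  case (1 x) show ?case by (cases x) auto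
qed (simp_all add: eff_intros)

lemma op_case_spine [eff_intros]:
  assumes "effective t" "eff_op A" "eff_op (\<lambda>g p. B g (fst p) (fst (snd p)) (snd (snd p)))" "eff_op (\<lambda>g p. C g (fst p) (fst (snd p)) (snd (snd p)))"
  shows "eff_op (\<lambda>g e. case t e of SNil \<Rightarrow> A g e | SArg x y \<Rightarrow> B g e x y | SPre x y \<Rightarrow> C g e x y)"
proof (rule op_cases[OF _ assms(1) _ _ _ _ op_reindex[OF assms(2) eff_fst[OF eff_id]] assms(3) assms(4) assms(4),
    where ?c1.0 = "\<lambda>_ :: nat. SNil" and ?c2.0 = "\<lambda>p. SArg (fst p) (snd p)" and ?c3.0 = "\<lambda>p. SPre (fst p) (snd p)" and ?c4.0 = "\<lambda>p. SPre (fst p) (snd p)"], goal_cases)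
  case (1 x) show ?case by (cases x) auto
qed (simp_all add: eff_intros)

lemma op_case_aty [eff_intros]:
  assumes "effective t" "eff_op (\<lambda>g p. A g (fst p) (fst (snd p)) (snd (snd p)))"
  shows "eff_op (\<lambda>g e. case t e of Fam x y \<Rightarrow> A g e x y)"
proof (rule op_cases[OF _ assms(1) _ _ _ _ assms(2) assms(2) assms(2) assms(2),
    where ?c1.0 = "\<lambda>p. Fam (fst p) (snd p)" and ?c2.0 = "\<lambda>p. Fam (fst p) (snd p)" and ?c3.0 = "\<lambda>p. Fam (fst p) (snd p)" and ?c4.0 = "\<lambda>p. Fam (fst p) (snd p)"], goal_cases)
  case (1 x) show ?case by (cases x) auto
qed (simp_all add: eff_intros)

lemma op_case_ty [eff_intros]:
  assumes "effective t" "eff_op (\<lambda>g p. A g (fst p) (snd p))" "eff_op (\<lambda>g p. B g (fst p) (fst (snd p)) (snd (snd p)))" "eff_op (\<lambda>g p. C g (fst p) (fst (snd p)) (snd (snd p)))"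
  shows "eff_op (\<lambda>g e. case t e of Atom x \<Rightarrow> A g e x | Pi x y \<Rightarrow> B g e x y | PrePi x y \<Rightarrow> C g e x y)"
proof (rule op_cases[OF _ assms(1) _ _ _ _ assms(2) assms(3) assms(4) assms(4),
    where ?c1.0 = Atom and ?c2.0 = "\<lambda>p. Pi (fst p) (snd p)" and ?c3.0 = "\<lambda>p. PrePi (fst p) (snd p)" and ?c4.0 = "\<lambda>p. PrePi (fst p) (snd p)"], goal_cases)
  case (1 x) show ?case by (cases x) auto
qed (simp_all add: eff_intros)

lemma op_case_kind [eff_intros]:
  assumes "effective t" "eff_op A" "eff_op B" "eff_op (\<lambda>g p. C g (fst p) (fst (snd p)) (snd (snd p)))" "eff_op (\<lambda>g p. D g (fst p) (fst (snd p)) (snd (snd p)))"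
  shows "eff_op (\<lambda>g e. case t e of Type \<Rightarrow> A g e | Cotype \<Rightarrow> B g e | KPi x y \<Rightarrow> C g e x y | KPrePi x y \<Rightarrow> D g e x y)"
proof (rule op_cases[OF _ assms(1) _ _ _ _ op_reindex[OF assms(2) eff_fst[OF eff_id]] op_reindex[OF assms(3) eff_fst[OF eff_id]] assms(4) assms(5),
    where ?c1.0 = "\<lambda>_ :: nat. Type" and ?c2.0 = "\<lambda>_ :: nat. Cotype" and ?c3.0 = "\<lambda>p. KPi (fst p) (snd p)" and ?c4.0 = "\<lambda>p. KPrePi (fst p) (snd p)"], goal_cases)
  case (1 x) show ?case by (cases x) auto
qed (simp_all add: eff_intros)

lemma op_case_decl [eff_intros]:
  assumes "effective t" "eff_op (\<lambda>g p. A g (fst p) (fst (snd p)) (snd (snd p)))" "eff_op (\<lambda>g p. B g (fst p) (fst (snd p)) (snd (snd p)))" "eff_op (\<lambda>g p. C g (fst p) (fst (snd p)) (fst (snd (snd p))) (snd (snd (snd p))))"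
  shows "eff_op (\<lambda>g e. case t e of FamDecl x y \<Rightarrow> A g e x y | ConDecl x y \<Rightarrow> B g e x y | RecDecl x y u \<Rightarrow> C g e x y u)"
proof (rule op_cases[OF _ assms(1) _ _ _ _ assms(2) assms(3) assms(4) assms(4),
    where ?c1.0 = "\<lambda>p. FamDecl (fst p) (snd p)" and ?c2.0 = "\<lambda>p. ConDecl (fst p) (snd p)" and ?c3.0 = "\<lambda>p. RecDecl (fst p) (fst (snd p)) (snd (snd p))" and ?c4.0 = "\<lambda>p. RecDecl (fst p) (fst (snd p)) (snd (snd p))"], goal_cases)
  case (1 x) show ?case by (cases x) auto
qed (simp_all add: eff_intros)

lemma op_case_binding [eff_intros]:
  assumes "effective t" "eff_op (\<lambda>g p. A g (fst p) (snd p))" "eff_op (\<lambda>g p. B g (fst p) (snd p))"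
  shows "eff_op (\<lambda>g e. case t e of Ord x \<Rightarrow> A g e x | Pre x \<Rightarrow> B g e x)"
proof (rule op_cases[OF _ assms(1) _ _ _ _ assms(2) assms(3) assms(3) assms(3),
    where ?c1.0 = Ord and ?c2.0 = Pre and ?c3.0 = Pre and ?c4.0 = Pre], goal_cases)
  case (1 x) show ?case by (cases x) auto
qed (simp_all add: eff_intros)

lemma op_case_stp [eff_intros]:
  assumes "effective t" "eff_op A" "eff_op (\<lambda>g p. B g (fst p) (fst (snd p)) (snd (snd p)))"
  shows "eff_op (\<lambda>g e. case t e of Base \<Rightarrow> A g e | Arr x y \<Rightarrow> B g e x y)"
proof (rule op_cases[OF _ assms(1) _ _ _ _ op_reindex[OF assms(2) eff_fst[OF eff_id]] assms(3) assms(3) assms(3),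
    where ?c1.0 = "\<lambda>_ :: nat. Base" and ?c2.0 = "\<lambda>p. Arr (fst p) (snd p)" and ?c3.0 = "\<lambda>p. Arr (fst p) (snd p)" and ?c4.0 = "\<lambda>p. Arr (fst p) (snd p)"], goal_cases)
  case (1 x) show ?case by (cases x) auto
qed (simp_all add: eff_intros)

section \<open>Effective predicates, case distinctions and list functions\<close>

lemma eff_app1:
  assumes "effective f" "effective a"
  shows "effective (\<lambda>x. f (a x :: 'a::godel_re))"
  by (rule eff_compose[OF assms])

lemma eff_app3:
  assumes "effective (\<lambda>p. f (fst p) (fst (snd p)) (snd (snd p)))" "effective a" "effective b" "effective c"
  shows "effective (\<lambda>x. f (a x :: 'a::godel_re) (b x :: 'b::godel_re) (c x :: 'c::godel_re))"
  using eff_compose[OF assms(1), of "\<lambda>x. (a x, b x, c x)"] by (simp add: eff_Pair assms)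

lemma eff_app4:
  assumes "effective (\<lambda>p. f (fst p) (fst (snd p)) (fst (snd (snd p))) (snd (snd (snd p))))"
    "effective a" "effective b" "effective c" "effective d"
  shows "effective (\<lambda>x. f (a x :: 'a::godel_re) (b x :: 'b::godel_re) (c x :: 'c::godel_re) (d x :: 'd::godel_re))"
  using eff_compose[OF assms(1), of "\<lambda>x. (a x, b x, c x, d x)"] by (simp add: eff_Pair assms)

lemma eff_app5:
  assumes "effective (\<lambda>p. f (fst p) (fst (snd p)) (fst (snd (snd p))) (fst (snd (snd (snd p)))) (snd (snd (snd (snd p)))))"
    "effective a" "effective b" "effective c" "effective d" "effective e"
  shows "effective (\<lambda>x. f (a x :: 'a::godel_re) (b x :: 'b::godel_re) (c x :: 'c::godel_re) (d x :: 'd::godel_re)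
    (e x :: 'e::godel_re))"
  using eff_compose[OF assms(1), of "\<lambda>x. (a x, b x, c x, d x, e x)"] by (simp add: eff_Pair assms)

lemma eff_app6:
  assumes "effective (\<lambda>p. f (fst p) (fst (snd p)) (fst (snd (snd p))) (fst (snd (snd (snd p))))
      (fst (snd (snd (snd (snd p))))) (snd (snd (snd (snd (snd p))))))"
    "effective a" "effective b" "effective c" "effective d" "effective e" "effective k"
  shows "effective (\<lambda>x. f (a x :: 'a::godel_re) (b x :: 'b::godel_re) (c x :: 'c::godel_re) (d x :: 'd::godel_re)
    (e x :: 'e::godel_re) (k x :: 'k::godel_re))"
  using eff_compose[OF assms(1), of "\<lambda>x. (a x, b x, c x, d x, e x, k x)"] by (simp add: eff_Pair assms)

lemma eff_eq [eff_intros]: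
  "effective f \<Longrightarrow> effective g \<Longrightarrow> effective (\<lambda>x. f x = (g x :: 'a::godel_re))"
  by (intro eff_decide semidec_eq semidec_neq)

lemma eff_not [eff_intros]: "effective P \<Longrightarrow> effective (\<lambda>x. \<not> P x)"
  by (intro eff_decide) (simp_all add: semidec_eff semidec_not_eff)

lemma eff_conj [eff_intros]: "effective P \<Longrightarrow> effective Q \<Longrightarrow> effective (\<lambda>x. P x \<and> Q x)"
  by (rule eff_decide[OF semidec_conj[OF semidec_eff semidec_eff]],
    assumption, assumption, unfold de_Morgan_conj, rule semidec_disj[OF semidec_not_eff semidec_not_eff])

lemma eff_disj [eff_intros]: "effective P \<Longrightarrow> effective Q \<Longrightarrow> effective (\<lambda>x. P x \<or> Q x)"
  by (rule eff_decide[OF semidec_disj[OF semidec_eff semidec_eff]],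
    assumption, assumption, unfold de_Morgan_disj, rule semidec_conj[OF semidec_not_eff semidec_not_eff])

lemma eff_imp [eff_intros]: "effective P \<Longrightarrow> effective Q \<Longrightarrow> effective (\<lambda>x. P x \<longrightarrow> Q x)"
  unfolding imp_conv_disj by (intro eff_intros)

lemma eff_le [eff_intros]: "effective f \<Longrightarrow> effective g \<Longrightarrow> effective (\<lambda>x. f x \<le> (g x :: nat))"
proof (rule eff_decide)
  assume fg: "effective f" "effective g"
  have "semidec (\<lambda>x. f x < Suc (g x))" "semidec (\<lambda>x. g x < f x)" by (intro eff_intros fg)+
  then show "semidec (\<lambda>x. f x \<le> g x)" "semidec (\<lambda>x. \<not> f x \<le> g x)"
    by (simp_all add: less_Suc_eq_le not_le)
qed

lemma eff_less [eff_intros]: "effective f \<Longrightarrow> effective g \<Longrightarrow> effective (\<lambda>x. f x < (g x :: nat))"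
  unfolding Suc_le_eq[symmetric] by (intro eff_intros)

lemma eff_if [eff_intros]:
  fixes b :: "'a::godel_re \<Rightarrow> bool" and f g :: "'a \<Rightarrow> 'b::godel_re"
  assumes "effective b" "effective f" "effective g"
  shows "effective (\<lambda>x. if b x then f x else g x)"
proof (rule op_effective)
  have "eff_op (\<lambda>(h :: nat \<Rightarrow> nat option) x. if b x then Some (f x) else Some (g x))"
    by (intro eff_intros assms)
  then show "eff_op (\<lambda>(h :: nat \<Rightarrow> nat option) x. Some (if b x then f x else g x))"
    by (simp add: if_distrib[of Some] cong: if_cong)
qed

lemma eff_case_prod [eff_intros]:
  assumes "effective (\<lambda>e. F e (fst (t e)) (snd (t e)))"
  shows "effective (\<lambda>e. case t e of (x, y) \<Rightarrow> F e x y)"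
  using assms by (simp add: split_beta)

text \<open>Two levels of \<open>option\<close> occur: the outer \<open>None\<close> stands for a
  recursive call without value, the inner one for the failure of a partial function such as
  hereditary substitution. Failure is passed on as a value.\<close>

definition obind :: "'a option option \<Rightarrow> ('a \<Rightarrow> 'b option option) \<Rightarrow> 'b option option" where
  "obind m k = Option.bind m (\<lambda>r. case r of None \<Rightarrow> Some None | Some v \<Rightarrow> k v)"

lemma obind_simps [simp]:
  "obind None k = None" "obind (Some None) k = Some None" "obind (Some (Some v)) k = k v"
  by (simp_all add: obind_def)

lemma op_obind [eff_intros]:
  fixes F :: "('a::godel_re \<Rightarrow> 'b::godel_re option) \<Rightarrow> 'e::godel_re \<Rightarrow> 'c::godel_re option option"
    and G :: "('a \<Rightarrow> 'b option) \<Rightarrow> 'e \<Rightarrow> 'c \<Rightarrow> 'd::godel_re option option"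
  assumes "eff_op F" and "eff_op (\<lambda>g p. G g (fst p) (snd p))"
  shows "eff_op (\<lambda>g e. obind (F g e) (\<lambda>c. G g e c))"
  unfolding obind_def
proof (intro op_bind op_case_option op_ret eff_const eff_snd eff_id assms)
  let ?t = "\<lambda>p :: ('e \<times> 'c option) \<times> 'c. (fst (fst p), snd p)"
  show "eff_op (\<lambda>g (p :: ('e \<times> 'c option) \<times> 'c). G g (fst (fst p)) (snd p))"
    using op_reindex[OF assms(2), of ?t] by (simp add: eff_intros)
qed

lemma eff_case_option [eff_intros]:
  fixes t :: "'e::godel_re \<Rightarrow> 'x::godel_re option"
  assumes "effective t" "effective A" "effective (\<lambda>p. B (fst p) (snd p))"
  shows "effective (\<lambda>e. (case t e of None \<Rightarrow> A e | Some x \<Rightarrow> B e x) :: 'r::godel_re)"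
  using op_case_option[OF assms(1) op_ret[OF assms(2)] op_ret[OF assms(3)]]
  by (intro op_effective) (simp add: option.case_distrib[of Some])

lemma eff_case_head [eff_intros]:
  fixes t :: "'e::godel_re \<Rightarrow> head"
  assumes "effective t" "effective (\<lambda>p. A (fst p) (snd p))" "effective (\<lambda>p. B (fst p) (snd p))" "effective (\<lambda>p. C (fst p) (snd p))"
  shows "effective (\<lambda>e. (case t e of Var x \<Rightarrow> A e x | Con x \<Rightarrow> B e x | Rec x \<Rightarrow> C e x) :: 'r::godel_re)"
  using op_case_head[OF assms(1) op_ret[OF assms(2)] op_ret[OF assms(3)] op_ret[OF assms(4)]]
  by (intro op_effective) (simp add: head.case_distrib[of Some])

lemma eff_case_neu [eff_intros]:
  fixes t :: "'e::godel_re \<Rightarrow> neu"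
  assumes "effective t" "effective (\<lambda>p. A (fst p) (fst (snd p)) (snd (snd p)))"
  shows "effective (\<lambda>e. (case t e of App x y \<Rightarrow> A e x y) :: 'r::godel_re)"
  using op_case_neu[OF assms(1) op_ret[OF assms(2)]]
  by (intro op_effective) (simp add: neu.case_distrib[of Some])

lemma eff_case_tm [eff_intros]:
  fixes t :: "'e::godel_re \<Rightarrow> tm"
  assumes "effective t" "effective (\<lambda>p. A (fst p) (snd p))" "effective (\<lambda>p. B (fst p) (snd p))"
  shows "effective (\<lambda>e. (case t e of Neu x \<Rightarrow> A e x | Lam x \<Rightarrow> B e x) :: 'r::godel_re)"
  using op_case_tm[OF assms(1) op_ret[OF assms(2)] op_ret[OF assms(3)]]
  by (intro op_effective) (simp add: tm.case_distrib[of Some])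

lemma eff_case_spine [eff_intros]:
  fixes t :: "'e::godel_re \<Rightarrow> spine"
  assumes "effective t" "effective A" "effective (\<lambda>p. B (fst p) (fst (snd p)) (snd (snd p)))" "effective (\<lambda>p. C (fst p) (fst (snd p)) (snd (snd p)))"
  shows "effective (\<lambda>e. (case t e of SNil \<Rightarrow> A e | SArg x y \<Rightarrow> B e x y | SPre x y \<Rightarrow> C e x y) :: 'r::godel_re)"
  using op_case_spine[OF assms(1) op_ret[OF assms(2)] op_ret[OF assms(3)] op_ret[OF assms(4)]]
  by (intro op_effective) (simp add: spine.case_distrib[of Some])

lemma eff_case_aty [eff_intros]:
  fixes t :: "'e::godel_re \<Rightarrow> aty"
  assumes "effective t" "effective (\<lambda>p. A (fst p) (fst (snd p)) (snd (snd p)))"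
  shows "effective (\<lambda>e. (case t e of Fam x y \<Rightarrow> A e x y) :: 'r::godel_re)"
  using op_case_aty[OF assms(1) op_ret[OF assms(2)]]
  by (intro op_effective) (simp add: aty.case_distrib[of Some])

lemma eff_case_binding [eff_intros]:
  fixes t :: "'e::godel_re \<Rightarrow> binding"
  assumes "effective t" "effective (\<lambda>p. A (fst p) (snd p))" "effective (\<lambda>p. B (fst p) (snd p))"
  shows "effective (\<lambda>e. (case t e of Ord x \<Rightarrow> A e x | Pre x \<Rightarrow> B e x) :: 'r::godel_re)"
  using op_case_binding[OF assms(1) op_ret[OF assms(2)] op_ret[OF assms(3)]]
  by (intro op_effective) (simp add: binding.case_distrib[of Some])


lemma eff_bind [eff_intros]:
  fixes f :: "'e::godel_re \<Rightarrow> 'a::godel_re option" and g :: "'e \<Rightarrow> 'a \<Rightarrow> 'b::godel_re option"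
  assumes "effective f" "effective (\<lambda>p. g (fst p) (snd p))"
  shows "effective (\<lambda>e. Option.bind (f e) (\<lambda>y. g e y))"
proof -
  have "Option.bind (f e) (g e) = (case f e of None \<Rightarrow> None | Some y \<Rightarrow> g e y)" for e by (cases "f e") simp_all
  then show ?thesis by (simp add: eff_intros assms)
qed

lemma eff_length [eff_intros]:
  assumes "effective f" shows "effective (\<lambda>e. length (f e :: 'a::godel_re list))"
proof (rule eff_app1[OF _ assms], rule eff_rec[where t = "\<lambda>xs. xs" and
    F = "\<lambda>h xs. case xs of [] \<Rightarrow> Some 0 | x # xs \<Rightarrow> Option.bind (h xs) (\<lambda>n. Some (Suc n))"], goal_cases)
  case (3 h xs)
  \<comment> \<open>Fact \<open>3\<close> is the recursion equation of the arbitrary solution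
    \<open>h\<close>. As a rewrite rule it would loop, hence one \<open>subst\<close> per
    constructor.\<close>
  show ?case by (induction xs) (subst 3, simp)+
qed (intro eff_intros)+

lemma eff_append [eff_intros]:
  assumes "effective f" "effective g" shows "effective (\<lambda>e. (f e :: 'a::godel_re list) @ g e)"
proof (rule eff_app2[OF _ assms], rule eff_rec[where t = "\<lambda>p. p" and
    F = "\<lambda>h p. case fst p of [] \<Rightarrow> Some (snd p) | x # xs \<Rightarrow> Option.bind (h (xs, snd p)) (\<lambda>zs. Some (x # zs))"], goal_cases)
  case (3 h p)
  have "h (xs, ys) = Some (xs @ ys)" for xs ys by (induction xs) (subst 3, simp)+
  then show ?case by (cases p) simp
qed (intro eff_intros)+

text \<open>Since \<open>xs ! i\<close> is unspecified beyond the length, the bounds check is made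
  part of the value.\<close>

definition nth_opt :: "'a list \<Rightarrow> nat \<Rightarrow> 'a option" where
  "nth_opt xs i = (if i < length xs then Some (xs ! i) else None)"

lemma eff_nth_opt [eff_intros]:
  assumes "effective f" "effective g" shows "effective (\<lambda>e. nth_opt (f e :: 'a::godel_re list) (g e))"
proof (rule eff_app2[OF _ assms], rule eff_rec[where t = "\<lambda>p. p" and
    F = "\<lambda>h p. case fst p of [] \<Rightarrow> Some None | x # xs \<Rightarrow>
      (case snd p of 0 \<Rightarrow> Some (Some x) | Suc i \<Rightarrow> h (xs, i))"], goal_cases)
  case (3 h p)
  have "h (xs, i) = Some (nth_opt xs i)" for xs i
    by (induction xs arbitrary: i) (subst 3, simp add: nth_opt_def split: nat.split)+
  then show ?case by (cases p) simp
qed (intro eff_intros)+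

lemma eff_list_all:
  fixes P :: "'e::godel_re \<Rightarrow> 'a::godel_re \<Rightarrow> bool"
  assumes P: "effective (\<lambda>p. P (fst p) (snd p))" and f: "effective f"
  shows "effective (\<lambda>e. \<forall>x\<in>set (f e). P e x)"
proof -
  have "effective (\<lambda>p. \<forall>x\<in>set (snd p). P (fst p) x)"
  proof (rule eff_rec[where t = "\<lambda>p. p" and F = "\<lambda>h p. case snd p of [] \<Rightarrow> Some True | x # xs \<Rightarrow>
      (if P (fst p) x then h (fst p, xs) else Some False)"], goal_cases)
    case 1
    have "effective (\<lambda>q :: ('e \<times> 'a list) \<times> 'a \<times> 'a list. P (fst (fst q)) (fst (snd q)))"
      using eff_compose[OF P, of "\<lambda>q :: ('e \<times> 'a list) \<times> 'a \<times> 'a list. (fst (fst q), fst (snd q))"]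
      by (simp add: eff_intros)
    then show ?case by (intro eff_intros)
  next
    case (3 h p)
    have "h (e, xs) = Some (\<forall>x\<in>set xs. P e x)" for e xs
      by (induction xs) (subst 3, simp)+
    then show ?case by (cases p) simp
  qed (intro eff_intros)
  from eff_compose[OF this, of "\<lambda>e. (e, f e)"] show ?thesis by (simp add: eff_intros f)
qed

lemma eff_list_ex:
  fixes P :: "'e::godel_re \<Rightarrow> 'a::godel_re \<Rightarrow> bool"
  assumes "effective (\<lambda>p. P (fst p) (snd p))" "effective f"
  shows "effective (\<lambda>e. \<exists>x\<in>set (f e). P e x)"
  using eff_not[OF eff_list_all[of "\<lambda>e x. \<not> P e x", OF eff_not[OF assms(1)] assms(2)]] by simp

lemma eff_in_set [eff_intros]:
  fixes f :: "'e::godel_re \<Rightarrow> 'a::godel_re"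
  assumes "effective f" "effective g" shows "effective (\<lambda>e. f e \<in> set (g e))"
proof -
  have "effective (\<lambda>e. \<exists>x\<in>set (g e). f e = x)"
    by (intro eff_list_ex eff_intros assms(2) eff_compose[OF assms(1)])
  then show ?thesis by simp
qed

section \<open>Effectiveness of the syntactic operations\<close>

text \<open>\<open>rn b k m\<close> is \<open>up ^^ k\<close> of a shift by \<open>m\<close> (\<open>b = 0\<close>), of \<open>inst m\<close> (\<open>b = 1\<close>), or of the constant
  function \<open>0\<close>.\<close>

definition rn :: "nat \<Rightarrow> nat \<Rightarrow> nat \<Rightarrow> nat \<Rightarrow> nat" where
  "rn b k m i = (if i < k then i else k + (if b = 0 then (i - k) + m
     else if b = 1 then (if i = k then m else i - k - 1) else 0))"

text \<open>A renaming is a function and cannot be an input. Closure of the family under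
  \<open>up\<close> lets three numbers describe it also below binders.\<close>

lemma up_rn: "up (rn b k m) = rn b (Suc k) m"
proof
  fix i show "up (rn b k m) i = rn b (Suc k) m i" by (cases i) (auto simp: up_def rn_def)
qed

lemma rn_Suc: "rn 0 0 1 = Suc" and rn_shift: "rn 0 0 m = (\<lambda>i. i + m)"
  and rn_inst: "rn 1 0 y = inst y" and rn_zero: "rn 2 0 0 = (\<lambda>_. 0)"
  by (auto simp: rn_def inst_def fun_eq_iff split: nat.split)

lemma eff_rn [eff_intros]:
  assumes "effective f" "effective g" "effective h" "effective k"
  shows "effective (\<lambda>e. rn (f e) (g e) (h e) (k e))"
  by (rule eff_app4[OF _ assms]) (unfold rn_def, intro eff_intros)

lemma ren_head_case: "ren_head \<rho> H = (case H of Var x \<Rightarrow> Var (\<rho> x) | Con c \<Rightarrow> Con c | Rec r \<Rightarrow> Rec r)"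
  by (cases H) simp_all

text \<open>The mutually recursive renamings become one recursion on spines: a term occurs as the
  first argument of a spine, and a neutral term is opened on the spot. Below an abstraction the body
  travels as \<open>SArg M SNil\<close> and is extracted from the resulting spine.\<close>

definition ren_spine_op :: "(nat \<times> nat \<times> nat \<times> spine \<Rightarrow> spine option) \<Rightarrow> nat \<times> nat \<times> nat \<times> spine \<Rightarrow> spine option" where
  "ren_spine_op h = (\<lambda>(b, k, m, S). case S of
      SNil \<Rightarrow> Some SNil
    | SArg M S \<Rightarrow> Option.bind (h (b, k, m, S)) (\<lambda>S'. case M of
          Neu R \<Rightarrow> (case R of App H T \<Rightarrow> Option.bind (h (b, k, m, T)) (\<lambda>T'.
            Some (SArg (Neu (App (case H of Var x \<Rightarrow> Var (rn b k m x) | Con c \<Rightarrow> Con c | Rec r \<Rightarrow> Rec r) T')) S')))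
        | Lam M \<Rightarrow> Option.bind (h (b, Suc k, m, SArg M SNil)) (\<lambda>T. case T of
            SNil \<Rightarrow> None | SArg M' S'' \<Rightarrow> Some (SArg (Lam M') S') | SPre y S'' \<Rightarrow> None))
    | SPre y S \<Rightarrow> Option.bind (h (b, k, m, S)) (\<lambda>S'. Some (SPre (rn b k m y) S')))"

lemma eff_ren_spine [eff_intros]:
  assumes "effective S" "effective b" "effective k" "effective m"
  shows "effective (\<lambda>e. ren_spine (S e) (rn (b e) (k e) (m e)))"
proof -
  have "effective (\<lambda>(b, k, m, S). ren_spine S (rn b k m))"
  proof (rule eff_rec[where t = "\<lambda>p. p" and F = ren_spine_op], goal_cases)
    case 1 show ?case unfolding ren_spine_op_def by (intro eff_intros)
  next
    case 2 show ?case by (intro eff_intros)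
  next
    case (3 h p)
    have h: "h (b, k, m, S) = ren_spine_op h (b, k, m, S)" for b k m S by (rule 3)
    \<comment> \<open>The claims for terms are relative to the value of \<open>h\<close> on the
      remaining spine \<open>S\<close>, because the operator renames that spine before it looks at
      the first argument.\<close>
    have "\<forall>k S S'. h (b, k, m, S) = Some S' \<longrightarrow> h (b, k, m, SArg M S) = Some (SArg (ren_tm M (rn b k m)) S')"
      "\<forall>k S S'. h (b, k, m, S) = Some S' \<longrightarrow> h (b, k, m, SArg (Neu R) S) = Some (SArg (Neu (ren_neu R (rn b k m))) S')"
      "\<forall>k. h (b, k, m, S) = Some (ren_spine S (rn b k m))" for b m M R S
    proof (induction M and R and S)
      case (Lam M)
      have "h (b, k, m, SNil) = Some SNil" for k by (subst h) (simp add: ren_spine_op_def)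
      with Lam show ?case by (subst (2) h) (auto simp: ren_spine_op_def up_rn)
    next
      case (App H S)
      then show ?case by (subst (2) h) (auto simp: ren_spine_op_def ren_head_case split: head.split)
    next
      case SNil
      show ?case by (subst h) (simp add: ren_spine_op_def)
    next
      case (SPre y S)
      then show ?case by (subst h) (simp add: ren_spine_op_def)
    qed auto
    then show ?case by (cases p) auto
  qed
  from eff_compose[OF this, of "\<lambda>e. (b e, k e, m e, S e)"] show ?thesis by (simp add: eff_intros assms)
qed

lemma eff_ren_neu [eff_intros]:
  assumes "effective R" "effective b" "effective k" "effective m"
  shows "effective (\<lambda>e. ren_neu (R e) (rn (b e) (k e) (m e)))"
proof (rule eff_app4[OF _ assms, of "\<lambda>R b k m. ren_neu R (rn b k m)"])
  have eq: "ren_neu R \<rho> = (case R of App H S \<Rightarrow>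
      App (case H of Var x \<Rightarrow> Var (\<rho> x) | Con c \<Rightarrow> Con c | Rec r \<Rightarrow> Rec r) (ren_spine S \<rho>))" for R \<rho>
    by (cases R) (simp add: ren_head_case)
  show "effective (\<lambda>p. ren_neu (fst p) (rn (fst (snd p)) (fst (snd (snd p))) (snd (snd (snd p)))))"
    unfolding eq by (intro eff_intros)
qed

lemma eff_ren_tm [eff_intros]:
  assumes "effective M" "effective b" "effective k" "effective m"
  shows "effective (\<lambda>e. ren_tm (M e) (rn (b e) (k e) (m e)))"
proof (rule eff_app4[OF _ assms, of "\<lambda>M b k m. ren_tm M (rn b k m)"])
  have eq: "ren_tm M \<rho> = (case ren_spine (SArg M SNil) \<rho> of SNil \<Rightarrow> M | SArg M' S \<Rightarrow> M' | SPre y S \<Rightarrow> M)" for M \<rho>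
    by simp
  show "effective (\<lambda>p. ren_tm (fst p) (rn (fst (snd p)) (fst (snd (snd p))) (snd (snd (snd p)))))"
    unfolding eq by (intro eff_intros)
qed

lemma eff_ren_tm_Suc [eff_intros]: "effective M \<Longrightarrow> effective (\<lambda>e. ren_tm (M e) Suc)"
  unfolding rn_Suc[symmetric] by (intro eff_intros)

lemma eff_ren_tm_inst [eff_intros]: "effective M \<Longrightarrow> effective y \<Longrightarrow> effective (\<lambda>e. ren_tm (M e) (inst (y e)))"
  unfolding rn_inst[symmetric] by (intro eff_intros)

definition ren_ty_op :: "(nat \<times> nat \<times> nat \<times> ty \<Rightarrow> ty option) \<Rightarrow> nat \<times> nat \<times> nat \<times> ty \<Rightarrow> ty option" where
  "ren_ty_op h = (\<lambda>(b, k, m, A). case A of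
      Atom P \<Rightarrow> Some (Atom (case P of Fam a S \<Rightarrow> Fam a (ren_spine S (rn b k m))))
    | Pi A2 A1 \<Rightarrow> Option.bind (h (b, k, m, A2)) (\<lambda>A2'. Option.bind (h (b, Suc k, m, A1)) (\<lambda>A1'. Some (Pi A2' A1')))
    | PrePi A2 A1 \<Rightarrow> Option.bind (h (b, k, m, A2)) (\<lambda>A2'. Option.bind (h (b, Suc k, m, A1)) (\<lambda>A1'. Some (PrePi A2' A1'))))"

lemma eff_ren_ty [eff_intros]:
  assumes "effective A" "effective b" "effective k" "effective m"
  shows "effective (\<lambda>e. ren_ty (A e) (rn (b e) (k e) (m e)))"
proof -
  have "effective (\<lambda>(b, k, m, A). ren_ty A (rn b k m))"
  proof (rule eff_rec[where t = "\<lambda>p. p" and F = ren_ty_op], goal_cases)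
    case 1 show ?case unfolding ren_ty_op_def by (intro eff_intros)
  next
    case 2 show ?case by (intro eff_intros)
  next
    case (3 h p)
    have "h (b, k, m, A) = Some (ren_ty A (rn b k m))" for b k m A
      by (induction A arbitrary: k) (subst 3, simp add: ren_ty_op_def up_rn split: aty.split)+
    then show ?case by (cases p) auto
  qed
  from eff_compose[OF this, of "\<lambda>e. (b e, k e, m e, A e)"] show ?thesis by (simp add: eff_intros assms)
qed

lemma eff_ren_ty_inst [eff_intros]: "effective A \<Longrightarrow> effective y \<Longrightarrow> effective (\<lambda>e. ren_ty (A e) (inst (y e)))"
  unfolding rn_inst[symmetric] by (intro eff_intros)

lemma eff_ren_ty_shift [eff_intros]: "effective A \<Longrightarrow> effective m \<Longrightarrow> effective (\<lambda>e. ren_ty (A e) (\<lambda>i. i + m e))"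
  unfolding rn_shift[symmetric] by (intro eff_intros)

definition ren_kind_op :: "(nat \<times> nat \<times> nat \<times> kind \<Rightarrow> kind option) \<Rightarrow> nat \<times> nat \<times> nat \<times> kind \<Rightarrow> kind option" where
  "ren_kind_op h = (\<lambda>(b, k, m, K). case K of
      Type \<Rightarrow> Some Type
    | Cotype \<Rightarrow> Some Cotype
    | KPi A K \<Rightarrow> Option.bind (h (b, Suc k, m, K)) (\<lambda>K'. Some (KPi (ren_ty A (rn b k m)) K'))
    | KPrePi A K \<Rightarrow> Option.bind (h (b, Suc k, m, K)) (\<lambda>K'. Some (KPrePi (ren_ty A (rn b k m)) K')))"

lemma eff_ren_kind [eff_intros]:
  assumes "effective K" "effective b" "effective k" "effective m"
  shows "effective (\<lambda>e. ren_kind (K e) (rn (b e) (k e) (m e)))"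
proof -
  have "effective (\<lambda>(b, k, m, K). ren_kind K (rn b k m))"
  proof (rule eff_rec[where t = "\<lambda>p. p" and F = ren_kind_op], goal_cases)
    case 1 show ?case unfolding ren_kind_op_def by (intro eff_intros)
  next
    case 2 show ?case by (intro eff_intros)
  next
    case (3 h p)
    have "h (b, k, m, K) = Some (ren_kind K (rn b k m))" for b k m K
      by (induction K arbitrary: k) (subst 3, simp add: ren_kind_op_def up_rn)+
    then show ?case by (cases p) auto
  qed
  from eff_compose[OF this, of "\<lambda>e. (b e, k e, m e, K e)"] show ?thesis by (simp add: eff_intros assms)
qed

lemma eff_ren_kind_inst [eff_intros]: "effective K \<Longrightarrow> effective y \<Longrightarrow> effective (\<lambda>e. ren_kind (K e) (inst (y e)))"
  unfolding rn_inst[symmetric] by (intro eff_intros)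

section \<open>Erasure, hereditary substitution and application\<close>

lemma eff_erase [eff_intros]:
  assumes "effective A" shows "effective (\<lambda>e. erase (A e))"
proof (rule eff_app1[OF _ assms], rule eff_rec[where t = "\<lambda>A. A" and F = "\<lambda>h A. case A of
      Atom P \<Rightarrow> Some Base
    | Pi A2 A1 \<Rightarrow> Option.bind (h A2) (\<lambda>\<tau>2. Option.bind (h A1) (\<lambda>\<tau>1. Some (Arr \<tau>2 \<tau>1)))
    | PrePi A2 A1 \<Rightarrow> Option.bind (h A1) (\<lambda>\<tau>1. Some (Arr Base \<tau>1))"], goal_cases)
  case (3 h A)
  show ?case by (induction A) (subst 3, simp)+
qed (intro eff_intros)+

lemma eff_drop_var [eff_intros]: "effective f \<Longrightarrow> effective g \<Longrightarrow> effective (\<lambda>e. drop_var (f e) (g e))"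
  by (rule eff_app2) (unfold drop_var_def, intro eff_intros)

text \<open>One operator for hereditary substitution into spines (left) and for application (right); a term
  \<open>M\<close> is passed as the spine \<open>SArg M SNil\<close>.\<close>

definition hsub_op :: "((stp \<times> nat \<times> tm \<times> spine) + (stp \<times> spine \<times> tm) \<Rightarrow> spine option option) \<Rightarrow>
    (stp \<times> nat \<times> tm \<times> spine) + (stp \<times> spine \<times> tm) \<Rightarrow> spine option option" where
  "hsub_op h z = (case z of
      Inl q \<Rightarrow> (case q of (\<tau>, x, N, S) \<Rightarrow> case S of
          SNil \<Rightarrow> Some (Some SNil)
        | SArg M S \<Rightarrow>
            obind (case M of
                Neu R \<Rightarrow> (case R of App H T \<Rightarrow> obind (h (Inl (\<tau>, x, N, T))) (\<lambda>T'.
                  if H = Var x then obind (h (Inr (\<tau>, T', N))) (\<lambda>Q. case Q of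
                      SNil \<Rightarrow> None | SArg M' S' \<Rightarrow> Some (Some M') | SPre y S' \<Rightarrow> None)
                  else Some (Some (Neu (App (case H of Var y \<Rightarrow> Var (drop_var x y) | Con c \<Rightarrow> Con c | Rec r \<Rightarrow> Rec r) T')))))
              | Lam M \<Rightarrow> obind (h (Inl (\<tau>, Suc x, ren_tm N Suc, SArg M SNil))) (\<lambda>Q. case Q of
                      SNil \<Rightarrow> None | SArg M' S' \<Rightarrow> Some (Some (Lam M')) | SPre y S' \<Rightarrow> None))
              (\<lambda>M'. obind (h (Inl (\<tau>, x, N, S))) (\<lambda>S'. Some (Some (SArg M' S'))))
        | SPre y S \<Rightarrow> if y = x then Some None
            else obind (h (Inl (\<tau>, x, N, S))) (\<lambda>S'. Some (Some (SPre (drop_var x y) S'))))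
    | Inr q \<Rightarrow> (case q of (\<tau>, S, M) \<Rightarrow> case \<tau> of
          Base \<Rightarrow> (case S of
              SNil \<Rightarrow> (case M of Neu R \<Rightarrow> Some (Some (SArg (Neu R) SNil)) | Lam M \<Rightarrow> Some None)
            | SArg N S \<Rightarrow> Some None | SPre y S \<Rightarrow> Some None)
        | Arr \<tau>2 \<tau>1 \<Rightarrow> (case M of
              Neu R \<Rightarrow> Some None
            | Lam M \<Rightarrow> (case S of
                  SNil \<Rightarrow> Some None
                | SArg N S \<Rightarrow> obind (h (Inl (\<tau>2, 0, N, SArg M SNil))) (\<lambda>Q. case Q of
                      SNil \<Rightarrow> None | SArg M' S' \<Rightarrow> h (Inr (\<tau>1, S, M')) | SPre y S' \<Rightarrow> None)
                | SPre y S \<Rightarrow> if \<tau>2 = Base then h (Inr (\<tau>1, S, ren_tm M (inst y))) else Some None))))"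

lemma op_hsub: "eff_op hsub_op"
  unfolding hsub_op_def by (intro eff_intros)

text \<open>The induction rule of the mutually recursive substitution functions carries their
  lexicographic descent, simple type first, so every call is defined. Application yields a neutral
  term, wrapped as \<open>SArg (Neu R) SNil\<close> so that both summands share one output
  type.\<close>

lemma hsub_op_fixpoint:
  assumes h: "\<And>z. h z = hsub_op h z"
  shows "h (Inl (\<tau>, x, N, SArg M S)) = obind (Some (hsub_tm \<tau> x N M)) (\<lambda>M'.
      obind (h (Inl (\<tau>, x, N, S))) (\<lambda>S'. Some (Some (SArg M' S'))))"
    and "h (Inl (\<tau>, x, N, SArg (Neu R) S)) = obind (Some (hsub_neu \<tau> x N R)) (\<lambda>R'.
      obind (h (Inl (\<tau>, x, N, S))) (\<lambda>S'. Some (Some (SArg (Neu R') S'))))"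
    and "h (Inl (\<tau>, x, N, S)) = Some (hsub_spine \<tau> x N S)"
    and "h (Inr (\<tau>, S, M)) = Some (map_option (\<lambda>R. SArg (Neu R) SNil) (happ \<tau> S M))"
proof -
  have nil: "h (Inl (\<tau>, x, N, SNil)) = Some (Some SNil)" for \<tau> x N
    by (subst h) (simp add: hsub_op_def)
  have "(\<forall>S. h (Inl (\<tau>, x, N, SArg M S)) = obind (Some (hsub_tm \<tau> x N M)) (\<lambda>M'.
      obind (h (Inl (\<tau>, x, N, S))) (\<lambda>S'. Some (Some (SArg M' S')))))"
    "(\<forall>S. h (Inl (\<tau>', x', N', SArg (Neu R) S)) = obind (Some (hsub_neu \<tau>' x' N' R)) (\<lambda>R'.
      obind (h (Inl (\<tau>', x', N', S))) (\<lambda>S'. Some (Some (SArg (Neu R') S')))))"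
    "h (Inl (\<tau>2, x2, N2, S2)) = Some (hsub_spine \<tau>2 x2 N2 S2)"
    "h (Inr (\<tau>3, S3, M3)) = Some (map_option (\<lambda>R. SArg (Neu R) SNil) (happ \<tau>3 S3 M3))"
    for \<tau> x N M \<tau>' x' N' R \<tau>2 x2 N2 S2 \<tau>3 S3 M3
  proof (induction \<tau> x N M and \<tau>' x' N' R and \<tau>2 x2 N2 S2 and \<tau>3 S3 M3
      rule: hsub_tm_hsub_neu_hsub_spine_happ.induct)
    case (1 \<tau> x N R)
    then show ?case by (auto split: option.split bind_split)
  next
    case (2 \<tau> x N M)
    then show ?case
      by (intro allI, subst h) (cases "hsub_tm \<tau> (Suc x) (ren_tm N Suc) M"; simp add: hsub_op_def nil)
  next
    case (3 \<tau> x N H S)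
    show ?case
    proof (intro allI, cases "hsub_spine \<tau> x N S")
      case None
      fix S'
      show "h (Inl (\<tau>, x, N, SArg (Neu (App H S)) S')) = obind (Some (hsub_neu \<tau> x N (App H S))) (\<lambda>R'.
          obind (h (Inl (\<tau>, x, N, S'))) (\<lambda>S'. Some (Some (SArg (Neu R') S'))))"
        by (subst h) (simp add: hsub_op_def 3(1) None)
    next
      case (Some T)
      fix S'
      show "h (Inl (\<tau>, x, N, SArg (Neu (App H S)) S')) = obind (Some (hsub_neu \<tau> x N (App H S))) (\<lambda>R'.
          obind (h (Inl (\<tau>, x, N, S'))) (\<lambda>S'. Some (Some (SArg (Neu R') S'))))"
      proof (cases "H = Var x")
        case True
        with 3(2)[OF Some] show ?thesis
          by (subst h) (cases "happ \<tau> T N"; simp add: hsub_op_def 3(1) Some)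
      next
        case False
        then show ?thesis
          by (subst h) (simp add: hsub_op_def 3(1) Some ren_head_case)
      qed
    qed
  next
    case (4 \<tau> x N)
    show ?case by (simp add: nil)
  next
    case (5 \<tau> x N M S)
    then show ?case by (cases "hsub_tm \<tau> x N M"; cases "hsub_spine \<tau> x N S"; simp)
  next
    case (6 \<tau> x N y S)
    then show ?case by (subst h) (cases "hsub_spine \<tau> x N S"; simp add: hsub_op_def)
  next
    case (8 \<tau>2 \<tau>1 N S M)
    then show ?case by (subst h) (cases "hsub_tm \<tau>2 0 N M"; simp add: hsub_op_def nil)
  qed (subst h, simp add: hsub_op_def split: stp.split tm.split spine.split)+
  then show "h (Inl (\<tau>, x, N, SArg M S)) = obind (Some (hsub_tm \<tau> x N M)) (\<lambda>M'.
      obind (h (Inl (\<tau>, x, N, S))) (\<lambda>S'. Some (Some (SArg M' S'))))"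
    and "h (Inl (\<tau>, x, N, SArg (Neu R) S)) = obind (Some (hsub_neu \<tau> x N R)) (\<lambda>R'.
      obind (h (Inl (\<tau>, x, N, S))) (\<lambda>S'. Some (Some (SArg (Neu R') S'))))"
    and "h (Inl (\<tau>, x, N, S)) = Some (hsub_spine \<tau> x N S)"
    and "h (Inr (\<tau>, S, M)) = Some (map_option (\<lambda>R. SArg (Neu R) SNil) (happ \<tau> S M))" by blast+
qed

lemma eff_hsub_spine [eff_intros]:
  assumes "effective \<tau>" "effective x" "effective N" "effective S"
  shows "effective (\<lambda>e. hsub_spine (\<tau> e) (x e) (N e) (S e))"
proof (rule eff_app4[OF _ assms], rule eff_rec[OF op_hsub, where t = Inl], goal_cases)
  case (2 h p)
  show ?case using hsub_op_fixpoint(3)[OF 2, of "fst p" "fst (snd p)" "fst (snd (snd p))" "snd (snd (snd p))"] by simp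
qed (intro eff_intros)

lemma eff_happ [eff_intros]:
  assumes "effective \<tau>" "effective S" "effective M"
  shows "effective (\<lambda>e. happ (\<tau> e) (S e) (M e))"
proof (rule eff_app3[OF _ assms])
  have 1: "effective (\<lambda>p :: stp \<times> spine \<times> tm. map_option (\<lambda>R. SArg (Neu R) SNil) (happ (fst p) (fst (snd p)) (snd (snd p))))"
  proof (rule eff_rec[OF op_hsub, where t = Inr], goal_cases)
    case (2 h p)
    show ?case using hsub_op_fixpoint(4)[OF 2, of "fst p" "fst (snd p)" "snd (snd p)"] by simp
  qed (intro eff_intros)
  have "effective (\<lambda>p :: stp \<times> spine \<times> tm. Option.bind
      (map_option (\<lambda>R. SArg (Neu R) SNil) (happ (fst p) (fst (snd p)) (snd (snd p))))
      (\<lambda>T. case T of SNil \<Rightarrow> None | SArg M' T' \<Rightarrow> (case M' of Neu R \<Rightarrow> Some R | Lam M'' \<Rightarrow> None) | SPre y T' \<Rightarrow> None))"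
    (is "effective ?f") by (intro eff_intros 1)
  moreover have "?f p = happ (fst p) (fst (snd p)) (snd (snd p))" for p
    by (cases "happ (fst p) (fst (snd p)) (snd (snd p))") simp_all
  ultimately show "effective (\<lambda>p. happ (fst p) (fst (snd p)) (snd (snd p)))" by simp
qed

lemma eff_hsub_aty [eff_intros]:
  assumes "effective \<tau>" "effective x" "effective N" "effective P"
  shows "effective (\<lambda>e. hsub_aty (\<tau> e) (x e) (N e) (P e))"
proof (rule eff_app4[OF _ assms])
  have eq: "hsub_aty \<tau> x N P = (case P of Fam a S \<Rightarrow> Option.bind (hsub_spine \<tau> x N S) (\<lambda>S'. Some (Fam a S')))" for \<tau> x N P
    by (cases P) simp
  show "effective (\<lambda>p. hsub_aty (fst p) (fst (snd p)) (fst (snd (snd p))) (snd (snd (snd p))))"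
    unfolding eq by (intro eff_intros)
qed

definition hsub_ty_op :: "(stp \<times> nat \<times> tm \<times> ty \<Rightarrow> ty option option) \<Rightarrow> stp \<times> nat \<times> tm \<times> ty \<Rightarrow> ty option option" where
  "hsub_ty_op h = (\<lambda>(\<tau>, x, N, A). case A of
      Atom P \<Rightarrow> Some (Option.bind (hsub_aty \<tau> x N P) (\<lambda>P'. Some (Atom P')))
    | Pi A2 A1 \<Rightarrow> obind (h (\<tau>, x, N, A2)) (\<lambda>A2'. obind (h (\<tau>, Suc x, ren_tm N Suc, A1)) (\<lambda>A1'. Some (Some (Pi A2' A1'))))
    | PrePi A2 A1 \<Rightarrow> obind (h (\<tau>, x, N, A2)) (\<lambda>A2'. obind (h (\<tau>, Suc x, ren_tm N Suc, A1)) (\<lambda>A1'. Some (Some (PrePi A2' A1')))))"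

text \<open>When call and continuation are both defined, only failure has to be propagated, and the
  two-level bind becomes the ordinary one.\<close>

lemma obind_Some [simp]: "obind (Some m) (\<lambda>x. Some (f x)) = Some (Option.bind m f)"
  by (cases m) simp_all

lemma eff_hsub_ty [eff_intros]:
  assumes "effective \<tau>" "effective x" "effective N" "effective A"
  shows "effective (\<lambda>e. hsub_ty (\<tau> e) (x e) (N e) (A e))"
proof (rule eff_app4[OF _ assms], rule eff_rec[where t = "\<lambda>p. p" and F = hsub_ty_op], goal_cases)
  case 1 show ?case unfolding hsub_ty_op_def by (intro eff_intros)
next
  case 2 show ?case by (intro eff_intros)
next
  case (3 h p)
  have "h (\<tau>, x, N, A) = Some (hsub_ty \<tau> x N A)" for \<tau> x N A
    by (induction A arbitrary: x N) (subst 3, simp add: hsub_ty_op_def)+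
  then show ?case by (cases p) auto
qed

definition hsub_kind_op :: "(stp \<times> nat \<times> tm \<times> kind \<Rightarrow> kind option option) \<Rightarrow> stp \<times> nat \<times> tm \<times> kind \<Rightarrow> kind option option" where
  "hsub_kind_op h = (\<lambda>(\<tau>, x, N, K). case K of
      Type \<Rightarrow> Some (Some Type)
    | Cotype \<Rightarrow> Some (Some Cotype)
    | KPi A K \<Rightarrow> obind (Some (hsub_ty \<tau> x N A)) (\<lambda>A'. obind (h (\<tau>, Suc x, ren_tm N Suc, K)) (\<lambda>K'. Some (Some (KPi A' K'))))
    | KPrePi A K \<Rightarrow> obind (Some (hsub_ty \<tau> x N A)) (\<lambda>A'. obind (h (\<tau>, Suc x, ren_tm N Suc, K)) (\<lambda>K'. Some (Some (KPrePi A' K')))))"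

lemma eff_hsub_kind [eff_intros]:
  assumes "effective \<tau>" "effective x" "effective N" "effective K"
  shows "effective (\<lambda>e. hsub_kind (\<tau> e) (x e) (N e) (K e))"
proof (rule eff_app4[OF _ assms], rule eff_rec[where t = "\<lambda>p. p" and F = hsub_kind_op], goal_cases)
  case 1 show ?case unfolding hsub_kind_op_def by (intro eff_intros)
next
  case 2 show ?case by (intro eff_intros)
next
  case (3 h p)
  have "h (\<tau>, x, N, K) = Some (hsub_kind \<tau> x N K)" for \<tau> x N K
    by (induction K arbitrary: x N) (subst 3, simp add: hsub_kind_op_def)+
  then show ?case by (cases p) auto
qed

section \<open>Signature lookups and syntactic side conditions\<close>

lemma eff_fam_kind [eff_intros]:
  assumes "effective \<Xi>" "effective a" shows "effective (\<lambda>e. fam_kind (\<Xi> e) (a e))"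
proof (rule eff_app2[OF _ assms], rule eff_rec[where t = "\<lambda>p. p" and F = "\<lambda>h p. case fst p of
      [] \<Rightarrow> Some None
    | d # \<Xi> \<Rightarrow> (case d of FamDecl b K \<Rightarrow> if b = snd p then Some (Some K) else h (\<Xi>, snd p)
        | ConDecl b A \<Rightarrow> h (\<Xi>, snd p) | RecDecl b A M \<Rightarrow> h (\<Xi>, snd p))"], goal_cases)
  case (3 h p)
  have "h (\<Xi>, a) = Some (fam_kind \<Xi> a)" for \<Xi> a by (induction \<Xi>) (subst 3, simp split: decl.split)+
  then show ?case by (cases p) auto
qed (intro eff_intros)+

lemma eff_con_type [eff_intros]:
  assumes "effective \<Xi>" "effective a" shows "effective (\<lambda>e. con_type (\<Xi> e) (a e))"
proof (rule eff_app2[OF _ assms], rule eff_rec[where t = "\<lambda>p. p" and F = "\<lambda>h p. case fst p of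
      [] \<Rightarrow> Some None
    | d # \<Xi> \<Rightarrow> (case d of FamDecl b K \<Rightarrow> h (\<Xi>, snd p)
        | ConDecl b A \<Rightarrow> if b = snd p then Some (Some A) else h (\<Xi>, snd p) | RecDecl b A M \<Rightarrow> h (\<Xi>, snd p))"], goal_cases)
  case (3 h p)
  have "h (\<Xi>, a) = Some (con_type \<Xi> a)" for \<Xi> a by (induction \<Xi>) (subst 3, simp split: decl.split)+
  then show ?case by (cases p) auto
qed (intro eff_intros)+

lemma eff_rec_def [eff_intros]:
  assumes "effective \<Xi>" "effective a" shows "effective (\<lambda>e. rec_def (\<Xi> e) (a e))"
proof (rule eff_app2[OF _ assms], rule eff_rec[where t = "\<lambda>p. p" and F = "\<lambda>h p. case fst p of
      [] \<Rightarrow> Some None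
    | d # \<Xi> \<Rightarrow> (case d of FamDecl b K \<Rightarrow> h (\<Xi>, snd p)
        | ConDecl b A \<Rightarrow> h (\<Xi>, snd p) | RecDecl b A M \<Rightarrow> if b = snd p then Some (Some (A, M)) else h (\<Xi>, snd p))"], goal_cases)
  case (3 h p)
  have "h (\<Xi>, a) = Some (rec_def \<Xi> a)" for \<Xi> a by (induction \<Xi>) (subst 3, simp split: decl.split)+
  then show ?case by (cases p) auto
qed (intro eff_intros)+

lemma eff_fam_prio [eff_intros]:
  assumes "effective \<Xi>" "effective a" shows "effective (\<lambda>e. fam_prio (\<Xi> e) (a e))"
proof (rule eff_app2[OF _ assms], rule eff_rec[where t = "\<lambda>p. p" and F = "\<lambda>h p. case fst p of
      [] \<Rightarrow> Some None
    | d # \<Xi> \<Rightarrow> (case d of FamDecl b K \<Rightarrow> if b = snd p then Some (Some (length \<Xi>)) else h (\<Xi>, snd p)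
        | ConDecl b A \<Rightarrow> h (\<Xi>, snd p) | RecDecl b A M \<Rightarrow> h (\<Xi>, snd p))"], goal_cases)
  case (3 h p)
  have "h (\<Xi>, a) = Some (fam_prio \<Xi> a)" for \<Xi> a by (induction \<Xi>) (subst 3, simp split: decl.split)+
  then show ?case by (cases p) auto
qed (intro eff_intros)+

lemma eff_prepattern_spine [eff_intros]:
  assumes "effective S" shows "effective (\<lambda>e. prepattern_spine (S e))"
proof (rule eff_app1[OF _ assms], rule eff_rec[where t = "\<lambda>p. p" and F = "\<lambda>h S. case S of
      SNil \<Rightarrow> Some True | SArg M S \<Rightarrow> Some False | SPre y S \<Rightarrow> h S"], goal_cases)
  case (3 h S)
  \<comment> \<open>In the mutual induction rule, terms and neutral terms receive the trivial
    predicate.\<close>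
  show ?case by (rule spine.induct[of "\<lambda>_. True" "\<lambda>_. True" "\<lambda>S. h S = Some (prepattern_spine S)"])
      (rule TrueI | subst 3, simp)+
qed (intro eff_intros)+

lemma eff_prepattern_ty [eff_intros]:
  assumes "effective A" shows "effective (\<lambda>e. prepattern_ty (A e))"
proof (rule eff_app1[OF _ assms], rule eff_rec[where t = "\<lambda>A. A" and F = "\<lambda>h A. case A of
      Atom P \<Rightarrow> Some True | Pi A2 A1 \<Rightarrow> Some False | PrePi A2 A1 \<Rightarrow> h A1"], goal_cases)
  case (3 h A)
  show ?case by (induction A) (subst 3, simp)+
qed (intro eff_intros)+

lemma eff_rec_headed [eff_intros]:
  assumes "effective R" shows "effective (\<lambda>e. rec_headed (R e))"
proof (rule eff_app1[OF _ assms])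
  have eq: "rec_headed R = (case R of App H S \<Rightarrow> (case H of Var x \<Rightarrow> False | Con c \<Rightarrow> False | Rec r \<Rightarrow> True))" for R
    by (cases R) (simp split: head.split)
  show "effective rec_headed" unfolding eq[abs_def] by (intro eff_intros)
qed

lemma eff_contractive [eff_intros]:
  assumes "effective M" shows "effective (\<lambda>e. contractive (M e))"
proof (rule eff_app1[OF _ assms], rule eff_rec[where t = "\<lambda>M. M" and F = "\<lambda>h M. case M of
      Neu R \<Rightarrow> Some (\<not> rec_headed R) | Lam M \<Rightarrow> h M"], goal_cases)
  case (3 h M)
  show ?case by (rule tm.induct[of "\<lambda>_. True" "\<lambda>M. h M = Some (contractive M)" "\<lambda>_. True"])
      (rule TrueI | subst 3, simp)+
qed (intro eff_intros)+

lemma eff_target [eff_intros]: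
  assumes "effective A" shows "effective (\<lambda>e. target (A e))"
proof (rule eff_app1[OF _ assms], rule eff_rec[where t = "\<lambda>A. A" and F = "\<lambda>h A. case A of
      Atom P \<Rightarrow> Some (case P of Fam a S \<Rightarrow> a) | Pi A2 A1 \<Rightarrow> h A1 | PrePi A2 A1 \<Rightarrow> h A1"], goal_cases)
  case (3 h A)
  show ?case by (induction A) (subst 3, simp)+
qed (intro eff_intros)+

lemma eff_cotype_kind [eff_intros]:
  assumes "effective K" shows "effective (\<lambda>e. cotype_kind (K e))"
proof (rule eff_app1[OF _ assms], rule eff_rec[where t = "\<lambda>K. K" and F = "\<lambda>h K. case K of
      Type \<Rightarrow> Some False | Cotype \<Rightarrow> Some True | KPi A K \<Rightarrow> h K | KPrePi A K \<Rightarrow> h K"], goal_cases)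
  case (3 h K)
  show ?case by (induction K) (subst 3, simp)+
qed (intro eff_intros)+

section \<open>Decidability of equality\<close>

subsection \<open>Free variable occurrences and renamings\<close>

text \<open>Occurrences are listed from left to right with repetitions, and indices are lowered by
  the number \<open>d\<close> of enclosing binders. Lists rather than sets are needed because terms
  of equal skeleton will be compared position by position.\<close>

primrec fv_tm :: "tm \<Rightarrow> nat \<Rightarrow> nat list" and fv_neu :: "neu \<Rightarrow> nat \<Rightarrow> nat list" and fv_spine :: "spine \<Rightarrow> nat \<Rightarrow> nat list" where
  "fv_tm (Neu R) d = fv_neu R d"
| "fv_tm (Lam M) d = fv_tm M (Suc d)"
| "fv_neu (App H S) d = (case H of Var x \<Rightarrow> if x < d then [] else [x - d] | Con c \<Rightarrow> [] | Rec r \<Rightarrow> []) @ fv_spine S d"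
| "fv_spine SNil d = []"
| "fv_spine (SArg M S) d = fv_tm M d @ fv_spine S d"
| "fv_spine (SPre y S) d = (if y < d then [] else [y - d]) @ fv_spine S d"

text \<open>The closed form of \<open>up\<close> iterated \<open>d\<close> times.\<close>

definition upn :: "nat \<Rightarrow> (nat \<Rightarrow> nat) \<Rightarrow> nat \<Rightarrow> nat" where
  "upn d \<rho> x = (if x < d then x else d + \<rho> (x - d))"

lemma upn_0 [simp]: "upn 0 \<rho> = \<rho>" by (simp add: upn_def fun_eq_iff)

lemma up_upn [simp]: "up (upn d \<rho>) = upn (Suc d) \<rho>"
  by (auto simp: up_def upn_def fun_eq_iff split: nat.split)

lemma up_comp: "up \<sigma> \<circ> up \<rho> = up (\<sigma> \<circ> \<rho>)"
  by (auto simp: up_def fun_eq_iff split: nat.split)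

lemma ren_ren:
  "ren_tm (ren_tm M \<rho>) \<sigma> = ren_tm M (\<sigma> \<circ> \<rho>)"
  "ren_neu (ren_neu R \<rho>) \<sigma> = ren_neu R (\<sigma> \<circ> \<rho>)"
  "ren_spine (ren_spine S \<rho>) \<sigma> = ren_spine S (\<sigma> \<circ> \<rho>)"
proof (induction M and R and S arbitrary: \<rho> \<sigma> and \<rho> \<sigma> and \<rho> \<sigma>)
  case (App H S) then show ?case by (cases H) auto
qed (auto simp: up_comp)

text \<open>Collapsing all free variables to one index forgets what a renaming can change, which
  makes the skeleton a renaming invariant; bound variables are untouched.\<close>

abbreviation skeleton :: "neu \<Rightarrow> neu" where
  "skeleton R \<equiv> ren_neu R (\<lambda>_. 0)"

lemma skeleton_ren [simp]: "skeleton (ren_neu R \<rho>) = skeleton R"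
  by (simp add: ren_ren comp_def)

lemma fv_ren:
  "fv_tm (ren_tm M (upn d \<rho>)) d = map \<rho> (fv_tm M d)"
  "fv_neu (ren_neu R (upn d \<rho>)) d = map \<rho> (fv_neu R d)"
  "fv_spine (ren_spine S (upn d \<rho>)) d = map \<rho> (fv_spine S d)"
proof (induction M and R and S arbitrary: d and d and d)
  case (App H S) then show ?case by (cases H) (auto simp: upn_def)
qed (auto simp: upn_def)

lemma fv_neu_ren: "fv_neu (ren_neu R \<rho>) 0 = map \<rho> (fv_neu R 0)"
  using fv_ren(2)[of R 0 \<rho>] by simp

text \<open>A term is recovered from its skeleton and its list of free occurrences. Hence a map that
  carries one occurrence list to the other renames one term into the other, whatever its values
  elsewhere.\<close>

lemma ren_eqI:
  "ren_tm M (upn d (\<lambda>_. 0)) = ren_tm M' (upn d (\<lambda>_. 0)) \<Longrightarrow> fv_tm M' d = map \<rho> (fv_tm M d) \<Longrightarrow>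
    M' = ren_tm M (upn d \<rho>)"
  "ren_neu R (upn d (\<lambda>_. 0)) = ren_neu R' (upn d (\<lambda>_. 0)) \<Longrightarrow> fv_neu R' d = map \<rho> (fv_neu R d) \<Longrightarrow>
    R' = ren_neu R (upn d \<rho>)"
  "ren_spine S (upn d (\<lambda>_. 0)) = ren_spine S' (upn d (\<lambda>_. 0)) \<Longrightarrow> fv_spine S' d = map \<rho> (fv_spine S d) \<Longrightarrow>
    S' = ren_spine S (upn d \<rho>)"
proof (induction M and R and S arbitrary: d M' and d R' and d S')
  case (Neu R) then show ?case by (cases M') auto
next
  case (Lam M) then show ?case by (cases M') auto
next
  case (App H S)
  obtain H' S' where R': "R' = App H' S'" by (cases R')
  with App.prems(1) have eq: "ren_head (upn d (\<lambda>_. 0)) H = ren_head (upn d (\<lambda>_. 0)) H'"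
    "ren_spine S (upn d (\<lambda>_. 0)) = ren_spine S' (upn d (\<lambda>_. 0))" by auto
  have "H' = ren_head (upn d \<rho>) H \<and> fv_spine S' d = map \<rho> (fv_spine S d)"
    using App.prems(2) eq(1) unfolding R'
    by (cases H; cases H') (auto simp: upn_def split: if_splits)
  with App.IH[OF eq(2)] R' show ?case by simp
next
  case SNil then show ?case by (cases S') auto
next
  case (SArg M S)
  from SArg.prems(1) obtain M' T' where S': "S' = SArg M' T'" by (cases S') auto
  with SArg.prems(1) have eq: "ren_tm M (upn d (\<lambda>_. 0)) = ren_tm M' (upn d (\<lambda>_. 0))"
    "ren_spine S (upn d (\<lambda>_. 0)) = ren_spine T' (upn d (\<lambda>_. 0))" by auto
  \<comment> \<open>Equal lengths allow the concatenated occurrence list to be split at the boundary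
    between the argument and the remaining spine.\<close>
  have "length (fv_tm M d) = length (fv_tm M' d)"
    using arg_cong[OF eq(1), of "\<lambda>M. length (fv_tm M d)"] by (simp add: fv_ren)
  with SArg.prems(2) have "fv_tm M' d = map \<rho> (fv_tm M d)" "fv_spine T' d = map \<rho> (fv_spine S d)"
    by (auto simp: S')
  with SArg.IH(1)[OF eq(1)] SArg.IH(2)[OF eq(2)] S' show ?case by simp
next
  case (SPre y S)
  from SPre.prems(1) obtain y' T' where S': "S' = SPre y' T'" by (cases S') auto
  with SPre.prems(1) have eq: "upn d (\<lambda>_. 0) y = upn d (\<lambda>_. 0) y'"
    "ren_spine S (upn d (\<lambda>_. 0)) = ren_spine T' (upn d (\<lambda>_. 0))" by auto
  have "y' = upn d \<rho> y \<and> fv_spine T' d = map \<rho> (fv_spine S d)"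
    using SPre.prems(2) eq(1) unfolding S' by (auto simp: upn_def split: if_splits)
  with SPre.IH[OF eq(2)] S' show ?case by simp
qed

lemma ren_neu_eqI: "skeleton R = skeleton R' \<Longrightarrow> fv_neu R' 0 = map \<rho> (fv_neu R 0) \<Longrightarrow> R' = ren_neu R \<rho>"
  using ren_eqI(2)[of R 0 R' \<rho>] by simp

definition fv_eqn :: "eqn \<Rightarrow> nat list" where
  "fv_eqn e = (case e of (n, R, R') \<Rightarrow> fv_neu R 0 @ fv_neu R' 0)"

definition skeleton_eqn :: "eqn \<Rightarrow> neu \<times> neu" where
  "skeleton_eqn e = (case e of (n, R, R') \<Rightarrow> (skeleton R, skeleton R'))"

text \<open>A renaming maps the occurrence list pointwise, so collapsing to the skeleton preserves
  its length.\<close>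

lemma fv_eqn_skeleton: "skeleton_eqn e = skeleton_eqn e' \<Longrightarrow> length (fv_eqn e) = length (fv_eqn e')"
proof -
  have len: "length (fv_neu R 0) = length (fv_neu R' 0)" if "skeleton R = skeleton R'" for R R'
    using arg_cong[OF that, of "\<lambda>R. length (fv_neu R 0)"] by (simp add: fv_neu_ren)
  obtain n R R' k Q Q' where "e = (n, R, R')" "e' = (k, Q, Q')" by (cases e, cases e')
  with len[of R Q] len[of R' Q'] show "skeleton_eqn e = skeleton_eqn e' \<Longrightarrow> length (fv_eqn e) = length (fv_eqn e')"
    by (simp add: skeleton_eqn_def fv_eqn_def)
qed

text \<open>\<open>is_renaming_of\<close> wants an injection on the whole old scope
  \<open>{..<k}\<close>, but only occurring variables have prescribed images. As
  \<open>k \<le> n\<close>, counting shows that enough targets remain for the others. Members of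
  \<open>V\<close> outside the scope keep their image under \<open>f\<close> and are exempt from
  injectivity.\<close>

lemma extend_injection:
  fixes f :: "nat \<Rightarrow> nat"
  assumes "inj_on f (V \<inter> {..<k})" "f ` (V \<inter> {..<k}) \<subseteq> {..<n}" "k \<le> n"
  shows "\<exists>\<rho>. inj_on \<rho> {..<k} \<and> \<rho> ` {..<k} \<subseteq> {..<n} \<and> (\<forall>x\<in>V. \<rho> x = f x)"
proof -
  let ?A = "{..<k} - V" and ?B = "{..<n} - f ` (V \<inter> {..<k})"
  have "?A = {..<k} - (V \<inter> {..<k})" by blast
  then have "card ?A = k - card (V \<inter> {..<k})" by (simp add: card_Diff_subset)
  also have "\<dots> \<le> n - card (f ` (V \<inter> {..<k}))" using assms(1,3) by (simp add: card_image)
  also have "\<dots> = card ?B" using assms(2) by (simp add: card_Diff_subset)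
  finally have "\<exists>g. inj_on g ?A \<and> g ` ?A \<subseteq> ?B" by (subst inj_on_iff_card_le) simp_all
  then obtain g where g: "inj_on g ?A" "g ` ?A \<subseteq> ?B" by blast
  define \<rho> where "\<rho> x = (if x \<in> V then f x else g x)" for x
  have "inj_on \<rho> (V \<inter> {..<k})" using assms(1) by (auto simp: \<rho>_def inj_on_def)
  moreover have "inj_on \<rho> ?A" using g(1) by (auto simp: \<rho>_def inj_on_def)
  moreover have img: "\<rho> ` (V \<inter> {..<k}) = f ` (V \<inter> {..<k})" "\<rho> ` ?A = g ` ?A" by (auto simp: \<rho>_def)
  moreover have "\<rho> ` (V \<inter> {..<k}) \<inter> \<rho> ` ?A = {}" unfolding img using g(2) by blast
  ultimately have "inj_on \<rho> ((V \<inter> {..<k}) \<union> ?A)" unfolding inj_on_Un by blast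
  moreover have "(V \<inter> {..<k}) \<union> ?A = {..<k}" by blast
  moreover from this have "\<rho> ` {..<k} = f ` (V \<inter> {..<k}) \<union> g ` ?A" by (metis image_Un img)
  ultimately show ?thesis using assms(2) g(2) by (intro exI[of _ \<rho>]) (auto simp: \<rho>_def)
qed

text \<open>The existential over functions becomes a check of finitely many pairs of corresponding
  occurrences: functional on all of them, injective and scope-preserving on those in the scope of
  \<open>e'\<close>. Both effectiveness and the key argument rest on this form.\<close>

lemma is_renaming_of_iff:
  "is_renaming_of e e' \<longleftrightarrow> skeleton_eqn e = skeleton_eqn e' \<and> fst e' \<le> fst e \<and>
    (\<forall>p\<in>set (zip (fv_eqn e') (fv_eqn e)). \<forall>q\<in>set (zip (fv_eqn e') (fv_eqn e)).
      (fst p = fst q \<longrightarrow> snd p = snd q) \<and>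
      (fst p < fst e' \<and> fst q < fst e' \<and> snd p = snd q \<longrightarrow> fst p = fst q)) \<and>
    (\<forall>p\<in>set (zip (fv_eqn e') (fv_eqn e)). fst p < fst e' \<longrightarrow> snd p < fst e)"
  (is "_ \<longleftrightarrow> _ \<and> _ \<and> (\<forall>p\<in>?Z. \<forall>q\<in>?Z. _) \<and> _")
proof -
  obtain n R R' where e: "e = (n, R, R')" by (cases e)
  obtain k Q Q' where e': "e' = (k, Q, Q')" by (cases e')
  show ?thesis
  proof
    assume "is_renaming_of e e'"
    then obtain \<rho> where \<rho>: "inj_on \<rho> {..<k}" "\<rho> ` {..<k} \<subseteq> {..<n}" "R = ren_neu Q \<rho>" "R' = ren_neu Q' \<rho>"
      unfolding is_renaming_of_def e e' by auto
    have "k \<le> n" using card_inj_on_le[OF \<rho>(1,2)] by simp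
    moreover have "skeleton_eqn e = skeleton_eqn e'" by (simp add: e e' skeleton_eqn_def \<rho>(3,4))
    moreover have "fv_eqn e = map \<rho> (fv_eqn e')" by (simp add: e e' fv_eqn_def \<rho>(3,4) fv_neu_ren)
    then have "snd p = \<rho> (fst p)" if "p \<in> ?Z" for p using that by (auto simp: zip_map2 in_set_zip)
    ultimately show "skeleton_eqn e = skeleton_eqn e' \<and> fst e' \<le> fst e \<and>
      (\<forall>p\<in>?Z. \<forall>q\<in>?Z. (fst p = fst q \<longrightarrow> snd p = snd q) \<and>
        (fst p < fst e' \<and> fst q < fst e' \<and> snd p = snd q \<longrightarrow> fst p = fst q)) \<and>
      (\<forall>p\<in>?Z. fst p < fst e' \<longrightarrow> snd p < fst e)"
      using \<rho>(1,2) by (auto simp: e e' inj_on_def)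
  next
    assume asm: "skeleton_eqn e = skeleton_eqn e' \<and> fst e' \<le> fst e \<and>
      (\<forall>p\<in>?Z. \<forall>q\<in>?Z. (fst p = fst q \<longrightarrow> snd p = snd q) \<and>
        (fst p < fst e' \<and> fst q < fst e' \<and> snd p = snd q \<longrightarrow> fst p = fst q)) \<and>
      (\<forall>p\<in>?Z. fst p < fst e' \<longrightarrow> snd p < fst e)"
    then have sk: "skeleton_eqn e = skeleton_eqn e'" by (elim conjE)
    from asm have kn: "k \<le> n" unfolding e e' fst_conv by (elim conjE)
    from asm have fun_Z: "y = y'" if "(x, y) \<in> ?Z" "(x, y') \<in> ?Z" for x y y'
      using that by (metis fst_conv snd_conv)
    from asm have inj_Z: "x = x'" if "(x, y) \<in> ?Z" "(x', y) \<in> ?Z" "x < k" "x' < k" for x x' y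
      using that unfolding e e' by (metis fst_conv snd_conv)
    from asm have scope_Z: "y < n" if "(x, y) \<in> ?Z" "x < k" for x y
      using that unfolding e e' by (metis fst_conv snd_conv)
    have len: "length (fv_eqn e') = length (fv_eqn e)" using fv_eqn_skeleton[OF sk] by (rule sym)
    \<comment> \<open>The map read off the pairs; \<open>fun_Z\<close> makes the described value
      unique.\<close>
    define f where "f x = (THE y. (x, y) \<in> ?Z)" for x
    have f: "f x = y" if "(x, y) \<in> ?Z" for x y
      unfolding f_def using that fun_Z by (intro the_equality) blast+
    define V where "V = set (fv_eqn e')"
    have V: "\<exists>y. (x, y) \<in> ?Z" if "x \<in> V" for x
      using that len unfolding V_def by (metis in_set_impl_in_set_zip1 prod.collapse)
    have "inj_on f (V \<inter> {..<k})"
    proof (rule inj_onI)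
      fix x x' assume x: "x \<in> V \<inter> {..<k}" "x' \<in> V \<inter> {..<k}" "f x = f x'"
      then obtain y y' where y: "(x, y) \<in> ?Z" "(x', y') \<in> ?Z" using V by blast
      with f x(3) have "y = y'" by auto
      with y x inj_Z show "x = x'" by blast
    qed
    moreover have "f ` (V \<inter> {..<k}) \<subseteq> {..<n}"
    proof (rule image_subsetI)
      fix x assume "x \<in> V \<inter> {..<k}"
      then have "x \<in> V" "x \<in> {..<k}" by blast+
      with V obtain y where "(x, y) \<in> ?Z" by blast
      with f scope_Z \<open>x \<in> {..<k}\<close> show "f x \<in> {..<n}" by auto
    qed
    ultimately obtain \<rho> where \<rho>: "inj_on \<rho> {..<k}" "\<rho> ` {..<k} \<subseteq> {..<n}" "\<forall>x\<in>V. \<rho> x = f x"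
      using extend_injection[of f V k n] kn by blast
    have "fv_eqn e = map \<rho> (fv_eqn e')"
    proof (rule nth_equalityI)
      fix i assume i: "i < length (fv_eqn e)"
      then have "(fv_eqn e' ! i, fv_eqn e ! i) \<in> ?Z" using len by (auto simp: in_set_zip)
      with f \<rho>(3) i len show "fv_eqn e ! i = map \<rho> (fv_eqn e') ! i" by (simp add: V_def)
    qed (simp add: len)
    moreover have "length (fv_neu R 0) = length (fv_neu Q 0)"
      using sk fv_eqn_skeleton[of "(n, R, R)" "(n, Q, Q)"] by (simp add: e e' skeleton_eqn_def fv_eqn_def)
    ultimately have "fv_neu R 0 = map \<rho> (fv_neu Q 0)" "fv_neu R' 0 = map \<rho> (fv_neu Q' 0)"
      by (auto simp: e e' fv_eqn_def)
    moreover have "skeleton Q = skeleton R" "skeleton Q' = skeleton R'"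
      using sk by (simp_all add: e e' skeleton_eqn_def)
    ultimately have "R = ren_neu Q \<rho>" "R' = ren_neu Q' \<rho>" using ren_neu_eqI by blast+
    with \<rho>(1,2) show "is_renaming_of e e'" by (auto simp: e e' is_renaming_of_def)
  qed
qed

text \<open>Up to the number of variables in scope, the key of an equation determines it up to renaming, and
  there are only finitely many keys over finitely many skeletons.\<close>

definition eqn_key :: "eqn \<Rightarrow> (neu \<times> neu) \<times> (nat \<times> nat) set \<times> nat set" where
  "eqn_key e = (skeleton_eqn e,
    {(i, j). i < length (fv_eqn e) \<and> j < length (fv_eqn e) \<and> fv_eqn e ! i = fv_eqn e ! j},
    {i. i < length (fv_eqn e) \<and> fv_eqn e ! i < fst e})"

text \<open>Equal coincidence patterns give a map between occurrences that is well defined and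
  injective, and equal scope patterns keep it in scope. The inequality between the scopes is not
  part of the key; it will hold because the algorithm never leaves a binder along a branch.\<close>

lemma is_renaming_of_key:
  assumes key: "eqn_key e = eqn_key e'" and le: "fst e' \<le> fst e"
  shows "is_renaming_of e e'"
proof -
  have sk: "skeleton_eqn e = skeleton_eqn e'" using key by (simp add: eqn_key_def)
  then have len: "length (fv_eqn e) = length (fv_eqn e')" by (rule fv_eqn_skeleton)
  have pat: "fv_eqn e ! i = fv_eqn e ! j \<longleftrightarrow> fv_eqn e' ! i = fv_eqn e' ! j"
    if "i < length (fv_eqn e')" "j < length (fv_eqn e')" for i j
  proof -
    have "{(i, j). i < length (fv_eqn e) \<and> j < length (fv_eqn e) \<and> fv_eqn e ! i = fv_eqn e ! j} =
      {(i, j). i < length (fv_eqn e') \<and> j < length (fv_eqn e') \<and> fv_eqn e' ! i = fv_eqn e' ! j}"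
      using key by (simp add: eqn_key_def)
    from eqset_imp_iff[OF this, of "(i, j)"] that len show ?thesis by simp
  qed
  have scope: "fv_eqn e ! i < fst e \<longleftrightarrow> fv_eqn e' ! i < fst e'" if "i < length (fv_eqn e')" for i
  proof -
    have "{i. i < length (fv_eqn e) \<and> fv_eqn e ! i < fst e} =
      {i. i < length (fv_eqn e') \<and> fv_eqn e' ! i < fst e'}"
      using key by (simp add: eqn_key_def)
    from eqset_imp_iff[OF this, of i] that len show ?thesis by simp
  qed
  show ?thesis unfolding is_renaming_of_iff using sk le pat scope len
    by (auto simp: in_set_zip)
qed

text \<open>The number of occurrences is fixed by the skeletons, so over each pair of skeletons the
  patterns range over a finite set.\<close>

definition keys :: "neu set \<Rightarrow> ((neu \<times> neu) \<times> (nat \<times> nat) set \<times> nat set) set" where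
  "keys U = (SIGMA z : U \<times> U. let l = length (fv_neu (fst z) 0) + length (fv_neu (snd z) 0) in
    Pow ({..<l} \<times> {..<l}) \<times> Pow {..<l})"

lemma finite_keys: "finite U \<Longrightarrow> finite (keys U)"
  unfolding keys_def by (intro finite_SigmaI) (auto simp: Let_def)

lemma eqn_key_in_keys: "skeleton R \<in> U \<Longrightarrow> skeleton R' \<in> U \<Longrightarrow> eqn_key (n, R, R') \<in> keys U"
  by (auto simp: eqn_key_def keys_def Let_def skeleton_eqn_def fv_eqn_def fv_neu_ren)

text \<open>The skeletons that structural comparison can meet. Variables bound by an enclosing
  abstraction are collapsed too, because they are free once the comparison has passed the
  binder.\<close>

primrec sks_tm :: "tm \<Rightarrow> neu set" and sks_neu :: "neu \<Rightarrow> neu set" and sks_spine :: "spine \<Rightarrow> neu set" where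
  "sks_tm (Neu R) = sks_neu R"
| "sks_tm (Lam M) = sks_tm M"
| "sks_neu (App H S) = insert (skeleton (App H S)) (sks_spine S)"
| "sks_spine SNil = {}"
| "sks_spine (SArg M S) = sks_tm M \<union> sks_spine S"
| "sks_spine (SPre y S) = sks_spine S"

lemma finite_sks: "finite (sks_tm M)" "finite (sks_neu R)" "finite (sks_spine S)"
  by (induction M and R and S) auto

lemma sks_ren:
  "sks_tm (ren_tm M \<rho>) = sks_tm M" "sks_neu (ren_neu R \<rho>) = sks_neu R" "sks_spine (ren_spine S \<rho>) = sks_spine S"
proof (induction M and R and S arbitrary: \<rho> and \<rho> and \<rho>)
  case (App H S)
  then show ?case using skeleton_ren[of "App H S" \<rho>] by simp
qed auto

lemma skeleton_in_sks: "skeleton R \<in> sks_neu R"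
  by (cases R) simp

definition unfold_neu :: "sig \<Rightarrow> neu \<Rightarrow> neu option" where
  "unfold_neu \<Sigma> R = (case R of App H S \<Rightarrow> (case H of Var x \<Rightarrow> None | Con c \<Rightarrow> None
    | Rec r \<Rightarrow> Option.bind (rec_def \<Sigma> r) (\<lambda>d. if prepattern_spine S then happ (erase (fst d)) S (snd d) else None)))"

definition body_sks :: "sig \<Rightarrow> neu set" where
  "body_sks \<Sigma> = (\<Union>d\<in>set \<Sigma>. case d of RecDecl r A M \<Rightarrow> sks_tm M | _ \<Rightarrow> {})"

lemma finite_body_sks: "finite (body_sks \<Sigma>)"
  unfolding body_sks_def by (auto simp: finite_sks split: decl.split)

lemma rec_def_in_set: "rec_def \<Sigma> r = Some (A, M) \<Longrightarrow> RecDecl r A M \<in> set \<Sigma>"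
  by (induction \<Sigma>) (auto split: decl.splits if_splits)

text \<open>A prepattern spine triggers only the renaming clause of \<open>happ\<close>, never a
  hereditary substitution. The result is the neutral body of \<open>M\<close>, renamed, and by
  \<open>sks_ren\<close> no new skeleton appears.\<close>

lemma sks_happ_prepattern: "prepattern_spine S \<Longrightarrow> happ \<tau> S M = Some R \<Longrightarrow> sks_neu R \<subseteq> sks_tm M"
proof -
  have "\<forall>\<tau> M R. prepattern_spine S \<longrightarrow> happ \<tau> S M = Some R \<longrightarrow> sks_neu R \<subseteq> sks_tm M"
  proof (rule spine.induct[of "\<lambda>_. True" "\<lambda>_. True"
      "\<lambda>S. \<forall>\<tau> M R. prepattern_spine S \<longrightarrow> happ \<tau> S M = Some R \<longrightarrow> sks_neu R \<subseteq> sks_tm M"])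
    show "\<forall>\<tau> M R. prepattern_spine SNil \<longrightarrow> happ \<tau> SNil M = Some R \<longrightarrow> sks_neu R \<subseteq> sks_tm M"
    proof (intro allI impI)
      fix \<tau> M R assume "happ \<tau> SNil M = Some R"
      then show "sks_neu R \<subseteq> sks_tm M" by (cases \<tau>; cases M) auto
    qed
  next
    fix y S
    assume IH: "\<forall>\<tau> M R. prepattern_spine S \<longrightarrow> happ \<tau> S M = Some R \<longrightarrow> sks_neu R \<subseteq> sks_tm M"
    show "\<forall>\<tau> M R. prepattern_spine (SPre y S) \<longrightarrow> happ \<tau> (SPre y S) M = Some R \<longrightarrow> sks_neu R \<subseteq> sks_tm M"
    proof (intro allI impI)
      fix \<tau> M R assume S: "prepattern_spine (SPre y S)" and happ: "happ \<tau> (SPre y S) M = Some R"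
      from happ obtain \<tau>2 \<tau>1 where \<tau>: "\<tau> = Arr \<tau>2 \<tau>1" by (cases \<tau>) auto
      with happ have "\<tau>2 = Base" by (cases \<tau>2) auto
      moreover from happ \<tau> obtain N where N: "M = Lam N" by (cases M) auto
      ultimately have "happ \<tau>1 S (ren_tm N (inst y)) = Some R" using happ \<tau> by simp
      with IH S have "sks_neu R \<subseteq> sks_tm (ren_tm N (inst y))" by simp
      then show "sks_neu R \<subseteq> sks_tm M" by (simp add: N sks_ren)
    qed
  qed simp_all
  then show "prepattern_spine S \<Longrightarrow> happ \<tau> S M = Some R \<Longrightarrow> sks_neu R \<subseteq> sks_tm M" by blast
qed

lemma sks_unfold: "unfold_neu \<Sigma> R = Some R' \<Longrightarrow> sks_neu R' \<subseteq> body_sks \<Sigma>"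
proof -
  assume "unfold_neu \<Sigma> R = Some R'"
  then obtain r S A M where "rec_def \<Sigma> r = Some (A, M)" "prepattern_spine S" "happ (erase A) S M = Some R'"
    by (auto simp: unfold_neu_def bind_eq_Some_conv split: neu.splits head.splits if_splits)
  then have "RecDecl r A M \<in> set \<Sigma>" "sks_neu R' \<subseteq> sks_tm M"
    by (simp_all add: rec_def_in_set sks_happ_prepattern)
  then show ?thesis by (force simp: body_sks_def)
qed

subsection \<open>The algorithm\<close>

definition memoised :: "eqn list \<Rightarrow> eqn \<Rightarrow> bool" where
  "memoised \<Delta> e \<longleftrightarrow> (\<exists>e'\<in>set \<Delta>. is_renaming_of e e')"

lemma spine_eq_simps:
  "spine_eq \<Sigma> \<Delta> n SNil SNil"
  "\<not> spine_eq \<Sigma> \<Delta> n SNil (SArg M' S')" "\<not> spine_eq \<Sigma> \<Delta> n SNil (SPre y' S')"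
  "\<not> spine_eq \<Sigma> \<Delta> n (SArg M S) SNil" "\<not> spine_eq \<Sigma> \<Delta> n (SArg M S) (SPre y' S')"
  "\<not> spine_eq \<Sigma> \<Delta> n (SPre y S) SNil" "\<not> spine_eq \<Sigma> \<Delta> n (SPre y S) (SArg M' S')"
  "spine_eq \<Sigma> \<Delta> n (SArg M S) (SArg M' S') \<longleftrightarrow> tm_eq \<Sigma> \<Delta> n M M' \<and> spine_eq \<Sigma> \<Delta> n S S'"
  "spine_eq \<Sigma> \<Delta> n (SPre y S) (SPre y' S') \<longleftrightarrow> y = y' \<and> y < n \<and> spine_eq \<Sigma> \<Delta> n S S'"
  by (subst spine_eq.simps, simp; blast)+

lemma tm_eq_simps:
  "tm_eq \<Sigma> \<Delta> n (Lam M) (Lam M') \<longleftrightarrow> tm_eq \<Sigma> \<Delta> (Suc n) M M'"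
  "tm_eq \<Sigma> \<Delta> n (Neu R) (Neu R') \<longleftrightarrow> neu_eq \<Sigma> \<Delta> n R R'"
  "\<not> tm_eq \<Sigma> \<Delta> n (Lam M) (Neu R')" "\<not> tm_eq \<Sigma> \<Delta> n (Neu R) (Lam M')"
  by (subst tm_eq.simps, simp)+

text \<open>The rules overlap only through \<open>eq_memo\<close>: the others are separated by which
  side is headed by a recursion constant, the left side taking precedence.\<close>

lemma neu_eq_iff:
  "neu_eq \<Sigma> \<Delta> n (App H S) (App H' S') \<longleftrightarrow> memoised \<Delta> (n, App H S, App H' S') \<or>
    (if rec_headed (App H S) then
       (\<exists>R. unfold_neu \<Sigma> (App H S) = Some R \<and> neu_eq \<Sigma> ((n, App H S, App H' S') # \<Delta>) n R (App H' S'))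
     else if rec_headed (App H' S') then
       (\<exists>R. unfold_neu \<Sigma> (App H' S') = Some R \<and> neu_eq \<Sigma> ((n, App H S, App H' S') # \<Delta>) n (App H S) R)
     else H = H' \<and> (case H of Var x \<Rightarrow> x < n | Con c \<Rightarrow> True | Rec r \<Rightarrow> True) \<and> spine_eq \<Sigma> \<Delta> n S S')"
  by (subst neu_eq.simps, cases H; cases H')
    (auto simp: memoised_def unfold_neu_def bind_eq_Some_conv)

type_synonym eq_input = "sig \<times> eqn list \<times> nat \<times> spine \<times> spine"

text \<open>As for renaming, everything is a recursion on spines, and unfolded equations are passed
  as one-element spines. Trying the memo list first loses nothing, since a memoised equation is
  derivable outright.\<close>

definition eq_op :: "(eq_input \<Rightarrow> bool option) \<Rightarrow> eq_input \<Rightarrow> bool option" where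
  "eq_op h = (\<lambda>(\<Sigma>, \<Delta>, n, S, S'). case S of
      SNil \<Rightarrow> Some (S' = SNil)
    | SArg M T \<Rightarrow> (case S' of
          SNil \<Rightarrow> Some False
        | SArg M' T' \<Rightarrow> Option.bind
            (case M of
              Neu R \<Rightarrow> (case M' of
                  Neu R' \<Rightarrow>
                    if memoised \<Delta> (n, R, R') then Some True
                    else if rec_headed R then (case unfold_neu \<Sigma> R of
                        None \<Rightarrow> Some False
                      | Some R1 \<Rightarrow> h (\<Sigma>, (n, R, R') # \<Delta>, n, SArg (Neu R1) SNil, SArg (Neu R') SNil))
                    else if rec_headed R' then (case unfold_neu \<Sigma> R' of
                        None \<Rightarrow> Some False
                      | Some R1 \<Rightarrow> h (\<Sigma>, (n, R, R') # \<Delta>, n, SArg (Neu R) SNil, SArg (Neu R1) SNil))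
                    else (case R of App H U \<Rightarrow> (case R' of App H' U' \<Rightarrow>
                      if H = H' \<and> (case H of Var x \<Rightarrow> x < n | Con c \<Rightarrow> True | Rec r \<Rightarrow> True)
                      then h (\<Sigma>, \<Delta>, n, U, U') else Some False))
                | Lam N' \<Rightarrow> Some False)
            | Lam N \<Rightarrow> (case M' of
                  Neu R' \<Rightarrow> Some False
                | Lam N' \<Rightarrow> h (\<Sigma>, \<Delta>, Suc n, SArg N SNil, SArg N' SNil)))
            (\<lambda>b. if b then h (\<Sigma>, \<Delta>, n, T, T') else Some False)
        | SPre y' T' \<Rightarrow> Some False)
    | SPre y T \<Rightarrow> (case S' of
          SNil \<Rightarrow> Some False
        | SArg M' T' \<Rightarrow> Some False
        | SPre y' T' \<Rightarrow> if y = y' \<and> y < n then h (\<Sigma>, \<Delta>, n, T, T') else Some False))"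

text \<open>Lexicographic descent: the number of keys over \<open>U\<close> not yet memoised, then
  the size of the left spine. Unfolding may enlarge terms but memoises an equation with a new key;
  all other calls keep the memo list and shrink the left spine. \<open>U\<close> is closed under
  these steps because unfoldings contribute only skeletons from \<open>body_sks\<close>.\<close>

lemma eq_op_terminates:
  fixes \<Sigma> :: sig and U :: "neu set"
  assumes h: "\<And>z. h z = eq_op h z" and U: "finite U" "body_sks \<Sigma> \<subseteq> U"
  shows "\<forall>e\<in>set \<Delta>. fst e \<le> n \<Longrightarrow> sks_spine S \<subseteq> U \<Longrightarrow> sks_spine S' \<subseteq> U \<Longrightarrow>
    h (\<Sigma>, \<Delta>, n, S, S') = Some (spine_eq \<Sigma> \<Delta> n S S')"
proof -
  let ?m = "\<lambda>(\<Delta> :: eqn list, n :: nat, S :: spine, S' :: spine). (card (keys U - eqn_key ` set \<Delta>), size S)"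
  have wf: "wf (inv_image (less_than <*lex*> less_than) ?m)" by (intro wf_inv_image wf_lex_prod wf_less_than)
  have unf: "h (\<Sigma>, \<Delta>, n, S, S') = eq_op h (\<Sigma>, \<Delta>, n, S, S')" for \<Delta> n S S' by (rule h)
  have "(\<forall>e\<in>set (fst x). fst e \<le> fst (snd x)) \<longrightarrow> sks_spine (fst (snd (snd x))) \<subseteq> U \<longrightarrow>
      sks_spine (snd (snd (snd x))) \<subseteq> U \<longrightarrow>
      h (\<Sigma>, x) = Some (spine_eq \<Sigma> (fst x) (fst (snd x)) (fst (snd (snd x))) (snd (snd (snd x))))" for x
  proof (induction x rule: wf_induct_rule[OF wf])
    case (1 x)
    obtain \<Delta> n S S' where x: "x = (\<Delta>, n, S, S')" by (cases x)
    show ?case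
    proof (intro impI, unfold x fst_conv snd_conv)
      assume \<Delta>: "\<forall>e\<in>set \<Delta>. fst e \<le> n" and S: "sks_spine S \<subseteq> U" and S': "sks_spine S' \<subseteq> U"
      \<comment> \<open>Calls that keep the memo list. The scope may grow under a binder, which
        preserves the bound on the memoised scopes.\<close>
      have smaller: "h (\<Sigma>, \<Delta>, n', T, T') = Some (spine_eq \<Sigma> \<Delta> n' T T')"
        if "size T < size S" "n \<le> n'" "sks_spine T \<subseteq> U" "sks_spine T' \<subseteq> U" for n' T T'
        using 1[of "(\<Delta>, n', T, T')"] that \<Delta> by (force simp: x)
      have memo: "h (\<Sigma>, (n, R, R') # \<Delta>, n, T, T') = Some (spine_eq \<Sigma> ((n, R, R') # \<Delta>) n T T')"
        if "\<not> memoised \<Delta> (n, R, R')" "skeleton R \<in> U" "skeleton R' \<in> U" "sks_spine T \<subseteq> U" "sks_spine T' \<subseteq> U"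
        for R R' T T'
      proof -
        \<comment> \<open>A memoised equation with the same key has no larger scope by the
          invariant, so the current equation would be a renaming of it and the goal would already be
          closed.\<close>
        have "eqn_key (n, R, R') \<notin> eqn_key ` set \<Delta>"
        proof
          assume "eqn_key (n, R, R') \<in> eqn_key ` set \<Delta>"
          then obtain e where e: "e \<in> set \<Delta>" "eqn_key (n, R, R') = eqn_key e" by blast
          with is_renaming_of_key[OF e(2)] \<Delta> have "is_renaming_of (n, R, R') e" by simp
          with e(1) that(1) show False by (auto simp: memoised_def)
        qed
        moreover have "eqn_key (n, R, R') \<in> keys U" using that(2,3) by (rule eqn_key_in_keys)
        ultimately have "keys U - eqn_key ` set ((n, R, R') # \<Delta>) \<subset> keys U - eqn_key ` set \<Delta>" by auto
        then have "card (keys U - eqn_key ` set ((n, R, R') # \<Delta>)) < card (keys U - eqn_key ` set \<Delta>)"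
          using finite_keys[OF U(1)] by (intro psubset_card_mono) auto
        with 1[of "((n, R, R') # \<Delta>, n, T, T')"] that(4,5) \<Delta> show ?thesis by (simp add: x)
      qed
      show "h (\<Sigma>, \<Delta>, n, S, S') = Some (spine_eq \<Sigma> \<Delta> n S S')"
      proof (cases S)
        case SNil
        then show ?thesis by (subst unf) (cases S'; simp add: eq_op_def spine_eq_simps)
      next
        case (SPre y T)
        have "h (\<Sigma>, \<Delta>, n, T, T') = Some (spine_eq \<Sigma> \<Delta> n T T')" if "S' = SPre y' T'" for y' T'
          using SPre S S' that by (intro smaller) auto
        then show ?thesis unfolding SPre
          by (subst unf) (cases S'; auto simp: eq_op_def spine_eq_simps)
      next
        case (SArg M T)
        show ?thesis
        proof (cases "\<exists>M' T'. S' = SArg M' T'")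
          case False
          then show ?thesis unfolding SArg
            by (subst unf) (cases S'; simp add: eq_op_def spine_eq_simps)
        next
          case True
          then obtain M' T' where SArg': "S' = SArg M' T'" by blast
          have T: "h (\<Sigma>, \<Delta>, n, T, T') = Some (spine_eq \<Sigma> \<Delta> n T T')"
            using SArg SArg' S S' by (intro smaller) auto
          \<comment> \<open>The rest of the spine is settled by \<open>T\<close>, so only the
            comparison of the first arguments remains to be computed.\<close>
          have step: "h (\<Sigma>, \<Delta>, n, S, S') = Some (spine_eq \<Sigma> \<Delta> n S S')"
            if "eq_op h (\<Sigma>, \<Delta>, n, S, S') =
              Option.bind (Some (tm_eq \<Sigma> \<Delta> n M M')) (\<lambda>b. if b then h (\<Sigma>, \<Delta>, n, T, T') else Some False)"
            using that T by (subst unf) (simp add: SArg SArg' spine_eq_simps)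
          show ?thesis
          proof (cases M)
            case (Lam N)
            show ?thesis
            proof (cases M')
              case (Lam N')
              have "h (\<Sigma>, \<Delta>, Suc n, SArg N SNil, SArg N' SNil) = Some (spine_eq \<Sigma> \<Delta> (Suc n) (SArg N SNil) (SArg N' SNil))"
                using S S' by (intro smaller) (auto simp: SArg SArg' Lam \<open>M = Lam N\<close>)
              then show ?thesis
                by (intro step) (simp add: eq_op_def SArg SArg' Lam \<open>M = Lam N\<close> spine_eq_simps tm_eq_simps)
            next
              case (Neu R')
              then show ?thesis
                by (intro step) (simp add: eq_op_def SArg SArg' Lam tm_eq_simps)
            qed
          next
            case (Neu R)
            show ?thesis
            proof (cases M')
              case (Lam N')
              then show ?thesis
                by (intro step) (simp add: eq_op_def SArg SArg' Neu tm_eq_simps)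
            next
              case (Neu R')
              note MM = \<open>M = Neu R\<close> Neu
              obtain H V where R: "R = App H V" by (cases R)
              obtain H' V' where R': "R' = App H' V'" by (cases R')
              have sk: "sks_neu R \<subseteq> U" "sks_neu R' \<subseteq> U" using S S' by (simp_all add: SArg SArg' MM)
              then have sk': "skeleton R \<in> U" "skeleton R' \<in> U" using skeleton_in_sks by blast+
              show ?thesis
              proof (cases "memoised \<Delta> (n, R, R')")
                case True
                then have "neu_eq \<Sigma> \<Delta> n R R'" unfolding R R' by (subst neu_eq_iff) simp
                with True show ?thesis
                  by (intro step) (simp add: eq_op_def SArg SArg' MM tm_eq_simps)
              next
                case nm: False
                note m = memo[OF nm sk']
                have left: "h (\<Sigma>, (n, R, R') # \<Delta>, n, SArg (Neu R1) SNil, SArg (Neu R') SNil) =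
                    Some (neu_eq \<Sigma> ((n, R, R') # \<Delta>) n R1 R')" if "unfold_neu \<Sigma> R = Some R1" for R1
                  using m[of "SArg (Neu R1) SNil" "SArg (Neu R') SNil"] sks_unfold[OF that] U(2) sk(2)
                  by (simp add: spine_eq_simps tm_eq_simps)
                have right: "h (\<Sigma>, (n, R, R') # \<Delta>, n, SArg (Neu R) SNil, SArg (Neu R1) SNil) =
                    Some (neu_eq \<Sigma> ((n, R, R') # \<Delta>) n R R1)" if "unfold_neu \<Sigma> R' = Some R1" for R1
                  using m[of "SArg (Neu R) SNil" "SArg (Neu R1) SNil"] sks_unfold[OF that] U(2) sk(1)
                  by (simp add: spine_eq_simps tm_eq_simps)
                have down: "h (\<Sigma>, \<Delta>, n, V, V') = Some (spine_eq \<Sigma> \<Delta> n V V')"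
                  using sk by (intro smaller) (auto simp: SArg MM R R')
                have "neu_eq \<Sigma> \<Delta> n R R' \<longleftrightarrow>
                  (if rec_headed R then (\<exists>R1. unfold_neu \<Sigma> R = Some R1 \<and> neu_eq \<Sigma> ((n, R, R') # \<Delta>) n R1 R')
                   else if rec_headed R' then (\<exists>R1. unfold_neu \<Sigma> R' = Some R1 \<and> neu_eq \<Sigma> ((n, R, R') # \<Delta>) n R R1)
                   else H = H' \<and> (case H of Var x \<Rightarrow> x < n | Con c \<Rightarrow> True | Rec r \<Rightarrow> True) \<and> spine_eq \<Sigma> \<Delta> n V V')"
                  using nm unfolding R R' by (subst neu_eq_iff) simp
                then have "(if rec_headed R then (case unfold_neu \<Sigma> R of
                        None \<Rightarrow> Some False
                      | Some R1 \<Rightarrow> h (\<Sigma>, (n, R, R') # \<Delta>, n, SArg (Neu R1) SNil, SArg (Neu R') SNil))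
                    else if rec_headed R' then (case unfold_neu \<Sigma> R' of
                        None \<Rightarrow> Some False
                      | Some R1 \<Rightarrow> h (\<Sigma>, (n, R, R') # \<Delta>, n, SArg (Neu R) SNil, SArg (Neu R1) SNil))
                    else (case R of App H U \<Rightarrow> (case R' of App H' U' \<Rightarrow>
                      if H = H' \<and> (case H of Var x \<Rightarrow> x < n | Con c \<Rightarrow> True | Rec r \<Rightarrow> True)
                      then h (\<Sigma>, \<Delta>, n, U, U') else Some False))) = Some (neu_eq \<Sigma> \<Delta> n R R')"
                  using left right down
                  by (cases "rec_headed R"; cases "rec_headed R'"; cases "unfold_neu \<Sigma> R"; cases "unfold_neu \<Sigma> R'"; cases "H = H'")
                    (simp_all add: R R')
                with nm show ?thesis
                  by (intro step) (simp add: eq_op_def SArg SArg' MM tm_eq_simps)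
              qed
            qed
          qed
        qed
      qed
    qed
  qed
  from this[of "(\<Delta>, n, S, S')"] show "\<forall>e\<in>set \<Delta>. fst e \<le> n \<Longrightarrow> sks_spine S \<subseteq> U \<Longrightarrow> sks_spine S' \<subseteq> U \<Longrightarrow>
    h (\<Sigma>, \<Delta>, n, S, S') = Some (spine_eq \<Sigma> \<Delta> n S S')" by simp
qed

subsection \<open>Effectiveness of the algorithm\<close>

lemma eff_unfold_neu [eff_intros]: "effective f \<Longrightarrow> effective g \<Longrightarrow> effective (\<lambda>e. unfold_neu (f e) (g e))"
  by (rule eff_app2) (unfold unfold_neu_def, intro eff_intros)

lemma eff_fv_neu [eff_intros]:
  assumes "effective R" "effective d" shows "effective (\<lambda>e. fv_neu (R e) (d e))"
proof -
  let ?F = "\<lambda>h p. case fst p of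
      SNil \<Rightarrow> Some []
    | SArg M S \<Rightarrow> Option.bind (h (S, snd p)) (\<lambda>ys. Option.bind
        (case M of
          Neu R \<Rightarrow> (case R of App H S \<Rightarrow> Option.bind (h (S, snd p)) (\<lambda>xs.
            Some ((case H of Var x \<Rightarrow> if x < snd p then [] else [x - snd p] | Con c \<Rightarrow> [] | Rec r \<Rightarrow> []) @ xs)))
        | Lam M \<Rightarrow> h (SArg M SNil, Suc (snd p))) (\<lambda>xs. Some (xs @ ys)))
    | SPre y S \<Rightarrow> Option.bind (h (S, snd p)) (\<lambda>ys. Some ((if y < snd p then [] else [y - snd p]) @ ys))"
  have 1: "effective (\<lambda>p. fv_spine (fst p) (snd p))"
  proof (rule eff_rec[where t = "\<lambda>p. p" and F = ?F], goal_cases)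
    case 1 show ?case by (intro eff_intros)
  next
    case 2 show ?case by (intro eff_intros)
  next
    case (3 h p)
    have "\<forall>d S ys. h (S, d) = Some ys \<longrightarrow> h (SArg M S, d) = Some (fv_tm M d @ ys)"
      "\<forall>d S ys. h (S, d) = Some ys \<longrightarrow> h (SArg (Neu R) S, d) = Some (fv_neu R d @ ys)"
      "\<forall>d. h (S, d) = Some (fv_spine S d)" for M R S
    proof (induction M and R and S)
      case (Lam M)
      have "h (SNil, d) = Some []" for d by (subst 3) simp
      with Lam show ?case by (intro allI impI) (subst 3, simp)
    next
      case (App H S)
      then show ?case by (intro allI impI) (subst 3, simp split: head.split)
    next
      case SNil show ?case by (intro allI) (subst 3, simp)
    next
      case (SPre y S) then show ?case by (intro allI) (subst 3, simp)
    qed simp_all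
    then show ?case by (cases p) simp
  qed
  have eq: "fv_neu R d = fv_spine (SArg (Neu R) SNil) d" for R d by simp
  show ?thesis unfolding eq
    by (rule eff_app2[OF 1]) (intro eff_intros assms)+
qed

lemma eff_zip [eff_intros]:
  assumes "effective f" "effective g" shows "effective (\<lambda>e. zip (f e :: 'a::godel_re list) (g e :: 'b::godel_re list))"
proof (rule eff_app2[OF _ assms], rule eff_rec[where t = "\<lambda>p. p" and
    F = "\<lambda>h p. case fst p of [] \<Rightarrow> Some [] | x # xs \<Rightarrow> (case snd p of [] \<Rightarrow> Some [] | y # ys \<Rightarrow>
      Option.bind (h (xs, ys)) (\<lambda>zs. Some ((x, y) # zs)))"], goal_cases)
  case (3 h p)
  have "h (xs, ys) = Some (zip xs ys)" for xs ys
    by (induction xs ys rule: list_induct2') (subst 3, simp)+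
  then show ?case by (cases p) simp
qed (intro eff_intros)+

lemma eff_skeleton [eff_intros]: "effective R \<Longrightarrow> effective (\<lambda>e. skeleton (R e))"
  unfolding rn_zero[symmetric] by (intro eff_intros)

lemma eff_is_renaming_of [eff_intros]:
  assumes "effective f" "effective g" shows "effective (\<lambda>e. is_renaming_of (f e) (g e))"
  by (rule eff_app2[OF _ assms], unfold is_renaming_of_iff fv_eqn_def skeleton_eqn_def)
    (intro eff_intros eff_list_all)

lemma eff_memoised [eff_intros]:
  assumes "effective f" "effective g" shows "effective (\<lambda>e. memoised (f e) (g e))"
  by (rule eff_app2[OF _ assms]) (unfold memoised_def, intro eff_intros eff_list_ex)

lemma eff_spine_eq [eff_intros]:
  assumes "effective \<Sigma>" "effective n" "effective S" "effective S'"
  shows "effective (\<lambda>e. spine_eq (\<Sigma> e) [] (n e) (S e) (S' e))"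
proof (rule eff_app4[OF _ assms, of "\<lambda>\<Sigma> n S S'. spine_eq \<Sigma> [] n S S'"],
    rule eff_rec[where t = "\<lambda>p. (fst p, [], snd p)" and F = eq_op], goal_cases)
  case 1 show ?case unfolding eq_op_def by (intro eff_intros)
next
  case 2 show ?case by (intro eff_intros)
next
  case (3 h p)
  obtain \<Sigma> n S S' where p: "p = (\<Sigma>, n, S, S')" by (cases p)
  have "h (\<Sigma>, [], n, S, S') = Some (spine_eq \<Sigma> [] n S S')"
    \<comment> \<open>All skeletons met by a run come from the two inputs or from the bodies of the
      signature.\<close>
    by (rule eq_op_terminates[OF 3, of "body_sks \<Sigma> \<union> sks_spine S \<union> sks_spine S'"])
      (auto simp: finite_body_sks finite_sks)
  then show ?case by (simp add: p)
qed

lemma eff_aty_eq [eff_intros]: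
  assumes "effective \<Sigma>" "effective \<Gamma>" "effective P" "effective P'"
  shows "effective (\<lambda>e. aty_eq (\<Sigma> e) (\<Gamma> e) (P e) (P' e))"
proof (rule eff_app4[OF _ assms])
  have eq: "aty_eq \<Sigma> \<Gamma> P P' \<longleftrightarrow> (case P of Fam a S \<Rightarrow> (case P' of Fam a' S' \<Rightarrow>
      a = a' \<and> spine_eq \<Sigma> [] (length \<Gamma>) S S'))" for \<Sigma> \<Gamma> P P'
    by (cases P; cases P') (auto simp: aty_eq.simps)
  show "effective (\<lambda>p. aty_eq (fst p) (fst (snd p)) (fst (snd (snd p))) (snd (snd (snd p))))"
    unfolding eq by (intro eff_intros)
qed

definition ty_eq_op :: "(sig \<times> ctx \<times> ty \<times> ty \<Rightarrow> bool option) \<Rightarrow> sig \<times> ctx \<times> ty \<times> ty \<Rightarrow> bool option" where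
  "ty_eq_op h = (\<lambda>(\<Sigma>, \<Gamma>, A, A'). case A of
      Atom P \<Rightarrow> (case A' of Atom P' \<Rightarrow> Some (aty_eq \<Sigma> \<Gamma> P P') | Pi A2 A1 \<Rightarrow> Some False | PrePi A2 A1 \<Rightarrow> Some False)
    | Pi A2 A1 \<Rightarrow> (case A' of Atom P' \<Rightarrow> Some False
        | Pi A2' A1' \<Rightarrow> Option.bind (h (\<Sigma>, \<Gamma>, A2, A2')) (\<lambda>b. if b then h (\<Sigma>, Ord A2 # \<Gamma>, A1, A1') else Some False)
        | PrePi A2' A1' \<Rightarrow> Some False)
    | PrePi A2 A1 \<Rightarrow> (case A' of Atom P' \<Rightarrow> Some False
        | Pi A2' A1' \<Rightarrow> Some False
        | PrePi A2' A1' \<Rightarrow> Option.bind (h (\<Sigma>, \<Gamma>, A2, A2')) (\<lambda>b. if b then h (\<Sigma>, Pre A2 # \<Gamma>, A1, A1') else Some False)))"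

lemma eff_ty_eq [eff_intros]:
  assumes "effective \<Sigma>" "effective \<Gamma>" "effective A" "effective A'"
  shows "effective (\<lambda>e. ty_eq (\<Sigma> e) (\<Gamma> e) (A e) (A' e))"
proof (rule eff_app4[OF _ assms], rule eff_rec[where t = "\<lambda>p. p" and F = ty_eq_op], goal_cases)
  case 1 show ?case unfolding ty_eq_op_def by (intro eff_intros)
next
  case 2 show ?case by (intro eff_intros)
next
  case (3 h p)
  have "h (\<Sigma>, \<Gamma>, A, A') = Some (ty_eq \<Sigma> \<Gamma> A A')" for \<Sigma> \<Gamma> A A'
  proof (induction A arbitrary: \<Gamma> A')
    case (Atom P)
    show ?case by (subst 3, subst ty_eq.simps) (cases A'; simp add: ty_eq_op_def)
  next
    case (Pi A2 A1)
    then show ?case by (subst 3, subst ty_eq.simps) (cases A'; simp add: ty_eq_op_def)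
  next
    case (PrePi A2 A1)
    then show ?case by (subst 3, subst ty_eq.simps) (cases A'; simp add: ty_eq_op_def)
  qed
  then show ?case by (cases p) auto
qed

section \<open>Decidability of typing\<close>

definition var_ty_opt :: "ctx \<Rightarrow> nat \<Rightarrow> ty option" where
  "var_ty_opt \<Gamma> x = Option.bind (nth_opt \<Gamma> x) (\<lambda>b. Some (ren_ty (binding_ty b) (\<lambda>i. i + Suc x)))"

definition pre_ty :: "ctx \<Rightarrow> nat \<Rightarrow> ty option" where
  "pre_ty \<Gamma> x = Option.bind (nth_opt \<Gamma> x) (\<lambda>b. case b of Ord A \<Rightarrow> None | Pre A \<Rightarrow> Some (ren_ty A (\<lambda>i. i + Suc x)))"

lemma var_ty_opt_eq: "var_ty_opt \<Gamma> x = (if x < length \<Gamma> then Some (var_ty \<Gamma> x) else None)"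
  by (simp add: var_ty_opt_def var_ty_def nth_opt_def)

lemma pre_ty_eq_Some: "pre_ty \<Gamma> x = Some A \<longleftrightarrow> x < length \<Gamma> \<and> (\<exists>B. \<Gamma> ! x = Pre B) \<and> A = var_ty \<Gamma> x"
  by (auto simp: pre_ty_def var_ty_def nth_opt_def split: binding.splits if_splits)

definition head_ty :: "sig \<Rightarrow> sig \<Rightarrow> bool \<Rightarrow> ctx \<Rightarrow> head \<Rightarrow> ty option" where
  "head_ty \<Xi> \<Sigma> \<delta> \<Gamma> H = (case H of Var x \<Rightarrow> var_ty_opt \<Gamma> x | Con c \<Rightarrow> con_type \<Xi> c
    | Rec r \<Rightarrow> Option.bind (rec_def (rec_scope \<Xi> \<Sigma> \<delta>) r) (\<lambda>d. Some (fst d)))"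

lemma synth_neu_iff: "synth_neu \<Xi> \<Sigma> \<delta> \<Gamma> (App H S) P \<longleftrightarrow> (\<exists>A. head_ty \<Xi> \<Sigma> \<delta> \<Gamma> H = Some A \<and> ty_spine \<Xi> \<Sigma> \<delta> \<Gamma> S A P)"
  by (subst synth_neu.simps, cases H) (auto simp: head_ty_def var_ty_opt_eq bind_eq_Some_conv)

lemma synth_neu_iff_ty_spine: "synth_neu \<Xi> \<Sigma> \<delta> \<Gamma> R P \<longleftrightarrow> (case R of App H S \<Rightarrow>
    (\<exists>A. head_ty \<Xi> \<Sigma> \<delta> \<Gamma> H = Some A \<and> ty_spine \<Xi> \<Sigma> \<delta> \<Gamma> S A P))"
  by (cases R) (simp add: synth_neu_iff)

text \<open>Recursion is on the term or spine, not on the type, which substitution may change;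
  ill-formed types therefore cause no termination problem. Neutral terms are inlined, and
  \<open>spn\<close> returns the synthesized type as a value, which makes it unique.\<close>

fun chk :: "sig \<Rightarrow> sig \<Rightarrow> bool \<Rightarrow> ctx \<Rightarrow> tm \<Rightarrow> ty \<Rightarrow> bool"
  and spn :: "sig \<Rightarrow> sig \<Rightarrow> bool \<Rightarrow> ctx \<Rightarrow> spine \<Rightarrow> ty \<Rightarrow> aty option" where
  "chk \<Xi> \<Sigma> \<delta> \<Gamma> (Lam M) (Pi A2 A1) = chk \<Xi> \<Sigma> \<delta> (Ord A2 # \<Gamma>) M A1"
| "chk \<Xi> \<Sigma> \<delta> \<Gamma> (Lam M) (PrePi A2 A1) = chk \<Xi> \<Sigma> \<delta> (Pre A2 # \<Gamma>) M A1"
| "chk \<Xi> \<Sigma> \<delta> \<Gamma> (Neu (App H S)) (Atom P) = (case head_ty \<Xi> \<Sigma> \<delta> \<Gamma> H of None \<Rightarrow> False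
    | Some A \<Rightarrow> (case spn \<Xi> \<Sigma> \<delta> \<Gamma> S A of None \<Rightarrow> False | Some P' \<Rightarrow> aty_eq \<Sigma> \<Gamma> P' P))"
| "chk \<Xi> \<Sigma> \<delta> \<Gamma> M A = False"
| "spn \<Xi> \<Sigma> \<delta> \<Gamma> SNil (Atom P) = Some P"
| "spn \<Xi> \<Sigma> \<delta> \<Gamma> (SArg M S) (Pi A2 A1) = (if chk \<Xi> \<Sigma> \<delta> \<Gamma> M A2 then (case hsub_ty (erase A2) 0 M A1 of
      None \<Rightarrow> None | Some A1' \<Rightarrow> spn \<Xi> \<Sigma> \<delta> \<Gamma> S A1') else None)"
| "spn \<Xi> \<Sigma> \<delta> \<Gamma> (SPre y S) (PrePi A2 A1) = (case pre_ty \<Gamma> y of None \<Rightarrow> None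
    | Some A \<Rightarrow> if ty_eq \<Sigma> \<Gamma> A A2 then spn \<Xi> \<Sigma> \<delta> \<Gamma> S (ren_ty A1 (inst y)) else None)"
| "spn \<Xi> \<Sigma> \<delta> \<Gamma> S A = None"

lemma check_tm_simps:
  "check_tm \<Xi> \<Sigma> \<delta> \<Gamma> (Lam M) (Pi A2 A1) \<longleftrightarrow> check_tm \<Xi> \<Sigma> \<delta> (Ord A2 # \<Gamma>) M A1"
  "check_tm \<Xi> \<Sigma> \<delta> \<Gamma> (Lam M) (PrePi A2 A1) \<longleftrightarrow> check_tm \<Xi> \<Sigma> \<delta> (Pre A2 # \<Gamma>) M A1"
  "check_tm \<Xi> \<Sigma> \<delta> \<Gamma> (Neu R) (Atom P) \<longleftrightarrow> (\<exists>P'. synth_neu \<Xi> \<Sigma> \<delta> \<Gamma> R P' \<and> aty_eq \<Sigma> \<Gamma> P' P)"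
  "\<not> check_tm \<Xi> \<Sigma> \<delta> \<Gamma> (Lam M) (Atom P)"
  "\<not> check_tm \<Xi> \<Sigma> \<delta> \<Gamma> (Neu R) (Pi A2 A1)" "\<not> check_tm \<Xi> \<Sigma> \<delta> \<Gamma> (Neu R) (PrePi A2 A1)"
  by (subst check_tm.simps, simp)+

lemma ty_spine_simps:
  "ty_spine \<Xi> \<Sigma> \<delta> \<Gamma> SNil (Atom Q) P \<longleftrightarrow> P = Q"
  "\<not> ty_spine \<Xi> \<Sigma> \<delta> \<Gamma> SNil (Pi A2 A1) P" "\<not> ty_spine \<Xi> \<Sigma> \<delta> \<Gamma> SNil (PrePi A2 A1) P"
  "ty_spine \<Xi> \<Sigma> \<delta> \<Gamma> (SArg M S) (Pi A2 A1) P \<longleftrightarrow> check_tm \<Xi> \<Sigma> \<delta> \<Gamma> M A2 \<and>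
    (\<exists>A1'. hsub_ty (erase A2) 0 M A1 = Some A1' \<and> ty_spine \<Xi> \<Sigma> \<delta> \<Gamma> S A1' P)"
  "\<not> ty_spine \<Xi> \<Sigma> \<delta> \<Gamma> (SArg M S) (Atom Q) P" "\<not> ty_spine \<Xi> \<Sigma> \<delta> \<Gamma> (SArg M S) (PrePi A2 A1) P"
  "ty_spine \<Xi> \<Sigma> \<delta> \<Gamma> (SPre y S) (PrePi A2 A1) P \<longleftrightarrow> (\<exists>A. pre_ty \<Gamma> y = Some A \<and> ty_eq \<Sigma> \<Gamma> A A2) \<and>
    ty_spine \<Xi> \<Sigma> \<delta> \<Gamma> S (ren_ty A1 (inst y)) P"
  "\<not> ty_spine \<Xi> \<Sigma> \<delta> \<Gamma> (SPre y S) (Atom Q) P" "\<not> ty_spine \<Xi> \<Sigma> \<delta> \<Gamma> (SPre y S) (Pi A2 A1) P"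
  by (subst ty_spine.simps, simp add: pre_ty_eq_Some, blast?)+

lemma check_tm_iff_chk: "check_tm \<Xi> \<Sigma> \<delta> \<Gamma> M A \<longleftrightarrow> chk \<Xi> \<Sigma> \<delta> \<Gamma> M A"
  and ty_spine_iff_spn: "ty_spine \<Xi> \<Sigma> \<delta> \<Gamma> S A P \<longleftrightarrow> spn \<Xi> \<Sigma> \<delta> \<Gamma> S A = Some P"
proof -
  have "check_tm \<Xi> \<Sigma> \<delta> \<Gamma> M A \<longleftrightarrow> chk \<Xi> \<Sigma> \<delta> \<Gamma> M A"
    "\<forall>P. ty_spine \<Xi>' \<Sigma>' \<delta>' \<Gamma>' S A' P \<longleftrightarrow> spn \<Xi>' \<Sigma>' \<delta>' \<Gamma>' S A' = Some P" for \<Xi> \<Sigma> \<delta> \<Gamma> M A \<Xi>' \<Sigma>' \<delta>' \<Gamma>' S A'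
    by (induction \<Xi> \<Sigma> \<delta> \<Gamma> M A and \<Xi>' \<Sigma>' \<delta>' \<Gamma>' S A' rule: chk_spn.induct)
      (auto simp: check_tm_simps ty_spine_simps synth_neu_iff split: option.split)
  then show "check_tm \<Xi> \<Sigma> \<delta> \<Gamma> M A \<longleftrightarrow> chk \<Xi> \<Sigma> \<delta> \<Gamma> M A"
    "ty_spine \<Xi> \<Sigma> \<delta> \<Gamma> S A P \<longleftrightarrow> spn \<Xi> \<Sigma> \<delta> \<Gamma> S A = Some P" by blast+
qed

lemma eff_binding_ty [eff_intros]:
  assumes "effective f" shows "effective (\<lambda>e. binding_ty (f e))"
proof (rule eff_app1[OF _ assms])
  have eq: "binding_ty b = (case b of Ord A \<Rightarrow> A | Pre A \<Rightarrow> A)" for b by (cases b) simp_all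
  show "effective binding_ty" unfolding eq[abs_def] by (intro eff_intros)
qed

lemma eff_var_ty_opt [eff_intros]: "effective f \<Longrightarrow> effective g \<Longrightarrow> effective (\<lambda>e. var_ty_opt (f e) (g e))"
  by (rule eff_app2) (unfold var_ty_opt_def, intro eff_intros)

lemma eff_pre_ty [eff_intros]: "effective f \<Longrightarrow> effective g \<Longrightarrow> effective (\<lambda>e. pre_ty (f e) (g e))"
  by (rule eff_app2) (unfold pre_ty_def, intro eff_intros)

lemma eff_head_ty [eff_intros]:
  assumes "effective \<Xi>" "effective \<Sigma>" "effective \<delta>" "effective \<Gamma>" "effective H"
  shows "effective (\<lambda>e. head_ty (\<Xi> e) (\<Sigma> e) (\<delta> e) (\<Gamma> e) (H e))"
  by (rule eff_app5[OF _ assms]) (unfold head_ty_def rec_scope_def, intro eff_intros)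

type_synonym chk_input = "sig \<times> sig \<times> bool \<times> ctx \<times> ((tm \<times> ty) + (spine \<times> ty))"

text \<open>One recursion hosts both functions: the sum in the input selects checking or synthesis,
  and correspondingly the first or the second component of the output carries the answer.\<close>

definition chk_op :: "(chk_input \<Rightarrow> (bool \<times> aty option) option) \<Rightarrow> chk_input \<Rightarrow> (bool \<times> aty option) option" where
  "chk_op h = (\<lambda>(\<Xi>, \<Sigma>, \<delta>, \<Gamma>, q). case q of
      Inl z \<Rightarrow> (case z of (M, A) \<Rightarrow> case M of
          Neu R \<Rightarrow> (case A of
              Atom P \<Rightarrow> (case R of App H S \<Rightarrow> (case head_ty \<Xi> \<Sigma> \<delta> \<Gamma> H of
                  None \<Rightarrow> Some (False, None)
                | Some B \<Rightarrow> Option.bind (h (\<Xi>, \<Sigma>, \<delta>, \<Gamma>, Inr (S, B))) (\<lambda>r.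
                    Some (case snd r of None \<Rightarrow> False | Some P' \<Rightarrow> aty_eq \<Sigma> \<Gamma> P' P, None))))
            | Pi A2 A1 \<Rightarrow> Some (False, None)
            | PrePi A2 A1 \<Rightarrow> Some (False, None))
        | Lam N \<Rightarrow> (case A of
              Atom P \<Rightarrow> Some (False, None)
            | Pi A2 A1 \<Rightarrow> h (\<Xi>, \<Sigma>, \<delta>, Ord A2 # \<Gamma>, Inl (N, A1))
            | PrePi A2 A1 \<Rightarrow> h (\<Xi>, \<Sigma>, \<delta>, Pre A2 # \<Gamma>, Inl (N, A1))))
    | Inr z \<Rightarrow> (case z of (S, A) \<Rightarrow> case S of
          SNil \<Rightarrow> (case A of
              Atom P \<Rightarrow> Some (False, Some P)
            | Pi A2 A1 \<Rightarrow> Some (False, None)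
            | PrePi A2 A1 \<Rightarrow> Some (False, None))
        | SArg M T \<Rightarrow> (case A of
              Atom P \<Rightarrow> Some (False, None)
            | Pi A2 A1 \<Rightarrow> Option.bind (h (\<Xi>, \<Sigma>, \<delta>, \<Gamma>, Inl (M, A2))) (\<lambda>r.
                if fst r then (case hsub_ty (erase A2) 0 M A1 of
                    None \<Rightarrow> Some (False, None)
                  | Some A1' \<Rightarrow> h (\<Xi>, \<Sigma>, \<delta>, \<Gamma>, Inr (T, A1')))
                else Some (False, None))
            | PrePi A2 A1 \<Rightarrow> Some (False, None))
        | SPre y T \<Rightarrow> (case A of
              Atom P \<Rightarrow> Some (False, None)
            | Pi A2 A1 \<Rightarrow> Some (False, None)
            | PrePi A2 A1 \<Rightarrow> (case pre_ty \<Gamma> y of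
                  None \<Rightarrow> Some (False, None)
                | Some B \<Rightarrow> if ty_eq \<Sigma> \<Gamma> B A2 then h (\<Xi>, \<Sigma>, \<delta>, \<Gamma>, Inr (T, ren_ty A1 (inst y)))
                    else Some (False, None)))))"

lemma op_chk: "eff_op chk_op"
  unfolding chk_op_def by (intro eff_intros)

lemma chk_op_fixpoint:
  assumes h: "\<And>z. h z = chk_op h z"
  shows "h (\<Xi>, \<Sigma>, \<delta>, \<Gamma>, Inl (M, A)) = Some (chk \<Xi> \<Sigma> \<delta> \<Gamma> M A, None)"
    and "h (\<Xi>', \<Sigma>', \<delta>', \<Gamma>', Inr (S, A')) = Some (False, spn \<Xi>' \<Sigma>' \<delta>' \<Gamma>' S A')"
  by (induction \<Xi> \<Sigma> \<delta> \<Gamma> M A and \<Xi>' \<Sigma>' \<delta>' \<Gamma>' S A' rule: chk_spn.induct)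
    (subst h, simp add: chk_op_def split: option.split neu.split)+

lemma eff_chk [eff_intros]:
  assumes "effective \<Xi>" "effective \<Sigma>" "effective \<delta>" "effective \<Gamma>" "effective M" "effective A"
  shows "effective (\<lambda>e. chk (\<Xi> e) (\<Sigma> e) (\<delta> e) (\<Gamma> e) (M e) (A e))"
proof (rule eff_app6[OF _ assms])
  have "effective (\<lambda>(\<Xi>, \<Sigma>, \<delta>, \<Gamma>, M, A). (chk \<Xi> \<Sigma> \<delta> \<Gamma> M A, None :: aty option))"
  proof (rule eff_rec[OF op_chk, where t = "\<lambda>(\<Xi>, \<Sigma>, \<delta>, \<Gamma>, M, A). (\<Xi>, \<Sigma>, \<delta>, \<Gamma>, Inl (M, A))"], goal_cases)
    case (2 h p)
    show ?case by (cases p) (simp add: chk_op_fixpoint(1)[OF 2])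
  qed (intro eff_intros)
  from eff_fst[OF this] show "effective (\<lambda>p. chk (fst p) (fst (snd p)) (fst (snd (snd p))) (fst (snd (snd (snd p))))
      (fst (snd (snd (snd (snd p))))) (snd (snd (snd (snd (snd p))))))"
    by (simp add: split_beta)
qed

lemma eff_spn [eff_intros]:
  assumes "effective \<Xi>" "effective \<Sigma>" "effective \<delta>" "effective \<Gamma>" "effective S" "effective A"
  shows "effective (\<lambda>e. spn (\<Xi> e) (\<Sigma> e) (\<delta> e) (\<Gamma> e) (S e) (A e))"
proof (rule eff_app6[OF _ assms])
  have "effective (\<lambda>(\<Xi>, \<Sigma>, \<delta>, \<Gamma>, S, A). (False, spn \<Xi> \<Sigma> \<delta> \<Gamma> S A))"
  proof (rule eff_rec[OF op_chk, where t = "\<lambda>(\<Xi>, \<Sigma>, \<delta>, \<Gamma>, S, A). (\<Xi>, \<Sigma>, \<delta>, \<Gamma>, Inr (S, A))"], goal_cases)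
    case (2 h p)
    show ?case by (cases p) (simp add: chk_op_fixpoint(2)[OF 2])
  qed (intro eff_intros)
  from eff_snd[OF this] show "effective (\<lambda>p. spn (fst p) (fst (snd p)) (fst (snd (snd p))) (fst (snd (snd (snd p))))
      (fst (snd (snd (snd (snd p))))) (snd (snd (snd (snd (snd p))))))"
    by (simp add: split_beta)
qed

section \<open>Kinds, types and contexts\<close>

fun kspn :: "sig \<Rightarrow> sig \<Rightarrow> bool \<Rightarrow> ctx \<Rightarrow> spine \<Rightarrow> kind \<Rightarrow> kind option" where
  "kspn \<Xi> \<Sigma> \<delta> \<Gamma> SNil K = Some K"
| "kspn \<Xi> \<Sigma> \<delta> \<Gamma> (SArg M S) (KPi A2 K) = (if chk \<Xi> \<Sigma> \<delta> \<Gamma> M A2 then (case hsub_kind (erase A2) 0 M K of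
      None \<Rightarrow> None | Some K1 \<Rightarrow> kspn \<Xi> \<Sigma> \<delta> \<Gamma> S K1) else None)"
| "kspn \<Xi> \<Sigma> \<delta> \<Gamma> (SPre y S) (KPrePi A2 K) = (case pre_ty \<Gamma> y of None \<Rightarrow> None
    | Some A \<Rightarrow> if ty_eq \<Sigma> \<Gamma> A A2 then kspn \<Xi> \<Sigma> \<delta> \<Gamma> S (ren_kind K (inst y)) else None)"
| "kspn \<Xi> \<Sigma> \<delta> \<Gamma> S K = None"

lemma kind_spine_iff_kspn: "kind_spine \<Xi> \<Sigma> \<delta> \<Gamma> S K K' \<longleftrightarrow> kspn \<Xi> \<Sigma> \<delta> \<Gamma> S K = Some K'"
proof (induction \<Xi> \<Sigma> \<delta> \<Gamma> S K rule: kspn.induct)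
  case (2 \<Xi> \<Sigma> \<delta> \<Gamma> M S A2 K)
  then show ?case by (subst kind_spine.simps) (auto simp: check_tm_iff_chk split: option.split)
next
  case (3 \<Xi> \<Sigma> \<delta> \<Gamma> y S A2 K)
  have "kind_spine \<Xi> \<Sigma> \<delta> \<Gamma> (SPre y S) (KPrePi A2 K) K' \<longleftrightarrow> (\<exists>A. pre_ty \<Gamma> y = Some A \<and> ty_eq \<Sigma> \<Gamma> A A2) \<and>
      kind_spine \<Xi> \<Sigma> \<delta> \<Gamma> S (ren_kind K (inst y)) K'"
    by (subst kind_spine.simps) (auto simp: pre_ty_eq_Some)
  with 3 show ?case by (auto split: option.split)
qed (subst kind_spine.simps, force)+

definition kspn_op :: "(sig \<times> sig \<times> bool \<times> ctx \<times> spine \<times> kind \<Rightarrow> kind option option) \<Rightarrow>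
    sig \<times> sig \<times> bool \<times> ctx \<times> spine \<times> kind \<Rightarrow> kind option option" where
  "kspn_op h = (\<lambda>(\<Xi>, \<Sigma>, \<delta>, \<Gamma>, S, K). case S of
      SNil \<Rightarrow> Some (Some K)
    | SArg M T \<Rightarrow> (case K of
          Type \<Rightarrow> Some None | Cotype \<Rightarrow> Some None
        | KPi A2 K \<Rightarrow> if chk \<Xi> \<Sigma> \<delta> \<Gamma> M A2 then (case hsub_kind (erase A2) 0 M K of
            None \<Rightarrow> Some None | Some K1 \<Rightarrow> h (\<Xi>, \<Sigma>, \<delta>, \<Gamma>, T, K1)) else Some None
        | KPrePi A2 K \<Rightarrow> Some None)
    | SPre y T \<Rightarrow> (case K of
          Type \<Rightarrow> Some None | Cotype \<Rightarrow> Some None | KPi A2 K \<Rightarrow> Some None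
        | KPrePi A2 K \<Rightarrow> (case pre_ty \<Gamma> y of None \<Rightarrow> Some None
            | Some A \<Rightarrow> if ty_eq \<Sigma> \<Gamma> A A2 then h (\<Xi>, \<Sigma>, \<delta>, \<Gamma>, T, ren_kind K (inst y)) else Some None)))"

lemma eff_kspn [eff_intros]:
  assumes "effective \<Xi>" "effective \<Sigma>" "effective \<delta>" "effective \<Gamma>" "effective S" "effective K"
  shows "effective (\<lambda>e. kspn (\<Xi> e) (\<Sigma> e) (\<delta> e) (\<Gamma> e) (S e) (K e))"
proof (rule eff_app6[OF _ assms], rule eff_rec[where t = "\<lambda>p. p" and F = kspn_op], goal_cases)
  case 1 show ?case unfolding kspn_op_def by (intro eff_intros)
next
  case 2 show ?case by (intro eff_intros)
next
  case (3 h p)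
  have "h (\<Xi>, \<Sigma>, \<delta>, \<Gamma>, S, K) = Some (kspn \<Xi> \<Sigma> \<delta> \<Gamma> S K)" for \<Xi> \<Sigma> \<delta> \<Gamma> S K
    by (induction \<Xi> \<Sigma> \<delta> \<Gamma> S K rule: kspn.induct) (subst 3, simp add: kspn_op_def split: option.split)+
  then show ?case by (cases p) auto
qed

definition syn_aty :: "sig \<Rightarrow> sig \<Rightarrow> bool \<Rightarrow> ctx \<Rightarrow> aty \<Rightarrow> kind option" where
  "syn_aty \<Xi> \<Sigma> \<delta> \<Gamma> P = (case P of Fam a S \<Rightarrow> Option.bind (fam_kind \<Xi> a) (\<lambda>K. kspn \<Xi> \<Sigma> \<delta> \<Gamma> S K))"

lemma synth_aty_iff: "synth_aty \<Xi> \<Sigma> \<delta> \<Gamma> P K \<longleftrightarrow> syn_aty \<Xi> \<Sigma> \<delta> \<Gamma> P = Some K"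
  by (cases P, subst synth_aty.simps) (auto simp: syn_aty_def kind_spine_iff_kspn bind_eq_Some_conv)

lemma eff_syn_aty [eff_intros]:
  assumes "effective \<Xi>" "effective \<Sigma>" "effective \<delta>" "effective \<Gamma>" "effective P"
  shows "effective (\<lambda>e. syn_aty (\<Xi> e) (\<Sigma> e) (\<delta> e) (\<Gamma> e) (P e))"
  by (rule eff_app5[OF _ assms]) (unfold syn_aty_def, intro eff_intros)

definition check_ty_op :: "(sig \<times> sig \<times> bool \<times> ctx \<times> ty \<Rightarrow> bool option) \<Rightarrow> sig \<times> sig \<times> bool \<times> ctx \<times> ty \<Rightarrow> bool option" where
  "check_ty_op h = (\<lambda>(\<Xi>, \<Sigma>, \<delta>, \<Gamma>, A). case A of
      Atom P \<Rightarrow> Some (syn_aty \<Xi> \<Sigma> \<delta> \<Gamma> P = Some Type \<or> syn_aty \<Xi> \<Sigma> \<delta> \<Gamma> P = Some Cotype)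
    | Pi A2 A1 \<Rightarrow> Option.bind (h (\<Xi>, \<Sigma>, \<delta>, \<Gamma>, A2)) (\<lambda>b. if b then h (\<Xi>, \<Sigma>, \<delta>, Ord A2 # \<Gamma>, A1) else Some False)
    | PrePi A2 A1 \<Rightarrow> Option.bind (h (\<Xi>, \<Sigma>, \<delta>, \<Gamma>, A2)) (\<lambda>b. if b then h (\<Xi>, \<Sigma>, \<delta>, Pre A2 # \<Gamma>, A1) else Some False))"

lemma eff_check_ty [eff_intros]:
  assumes "effective \<Xi>" "effective \<Sigma>" "effective \<delta>" "effective \<Gamma>" "effective A"
  shows "effective (\<lambda>e. check_ty (\<Xi> e) (\<Sigma> e) (\<delta> e) (\<Gamma> e) (A e))"
proof (rule eff_app5[OF _ assms], rule eff_rec[where t = "\<lambda>p. p" and F = check_ty_op], goal_cases)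
  case 1 show ?case unfolding check_ty_op_def by (intro eff_intros)
next
  case 2 show ?case by (intro eff_intros)
next
  case (3 h p)
  have "h (\<Xi>, \<Sigma>, \<delta>, \<Gamma>, A) = Some (check_ty \<Xi> \<Sigma> \<delta> \<Gamma> A)" for \<Xi> \<Sigma> \<delta> \<Gamma> A
  proof (induction A arbitrary: \<Gamma>)
    case (Atom P)
    show ?case by (subst 3, subst check_ty.simps) (auto simp: check_ty_op_def synth_aty_iff)
  qed (subst 3, subst check_ty.simps, simp add: check_ty_op_def)+
  then show ?case by (cases p) auto
qed

definition check_kind_op :: "(sig \<times> sig \<times> bool \<times> ctx \<times> kind \<Rightarrow> bool option) \<Rightarrow> sig \<times> sig \<times> bool \<times> ctx \<times> kind \<Rightarrow> bool option" where
  "check_kind_op h = (\<lambda>(\<Xi>, \<Sigma>, \<delta>, \<Gamma>, K). case K of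
      Type \<Rightarrow> Some True
    | Cotype \<Rightarrow> Some True
    | KPi A K \<Rightarrow> if check_ty \<Xi> \<Sigma> \<delta> \<Gamma> A then h (\<Xi>, \<Sigma>, \<delta>, Ord A # \<Gamma>, K) else Some False
    | KPrePi A K \<Rightarrow> if check_ty \<Xi> \<Sigma> \<delta> \<Gamma> A then h (\<Xi>, \<Sigma>, \<delta>, Pre A # \<Gamma>, K) else Some False)"

lemma eff_check_kind [eff_intros]:
  assumes "effective \<Xi>" "effective \<Sigma>" "effective \<delta>" "effective \<Gamma>" "effective K"
  shows "effective (\<lambda>e. check_kind (\<Xi> e) (\<Sigma> e) (\<delta> e) (\<Gamma> e) (K e))"
proof (rule eff_app5[OF _ assms], rule eff_rec[where t = "\<lambda>p. p" and F = check_kind_op], goal_cases)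
  case 1 show ?case unfolding check_kind_op_def by (intro eff_intros)
next
  case 2 show ?case by (intro eff_intros)
next
  case (3 h p)
  have "h (\<Xi>, \<Sigma>, \<delta>, \<Gamma>, K) = Some (check_kind \<Xi> \<Sigma> \<delta> \<Gamma> K)" for \<Xi> \<Sigma> \<delta> \<Gamma> K
    by (induction K arbitrary: \<Gamma>) (subst 3, subst check_kind.simps, simp add: check_kind_op_def)+
  then show ?case by (cases p) auto
qed

definition ctx_ok_op :: "(sig \<times> sig \<times> bool \<times> ctx \<Rightarrow> bool option) \<Rightarrow> sig \<times> sig \<times> bool \<times> ctx \<Rightarrow> bool option" where
  "ctx_ok_op h = (\<lambda>(\<Xi>, \<Sigma>, \<delta>, \<Gamma>). case \<Gamma> of
      [] \<Rightarrow> Some True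
    | b # \<Gamma> \<Rightarrow> if check_ty \<Xi> \<Sigma> \<delta> \<Gamma> (binding_ty b) then h (\<Xi>, \<Sigma>, \<delta>, \<Gamma>) else Some False)"

lemma eff_ctx_ok [eff_intros]:
  assumes "effective \<Xi>" "effective \<Sigma>" "effective \<delta>" "effective \<Gamma>"
  shows "effective (\<lambda>e. ctx_ok (\<Xi> e) (\<Sigma> e) (\<delta> e) (\<Gamma> e))"
proof (rule eff_app4[OF _ assms], rule eff_rec[where t = "\<lambda>p. p" and F = ctx_ok_op], goal_cases)
  case 1 show ?case unfolding ctx_ok_op_def by (intro eff_intros)
next
  case 2 show ?case by (intro eff_intros)
next
  case (3 h p)
  have "h (\<Xi>, \<Sigma>, \<delta>, \<Gamma>) = Some (ctx_ok \<Xi> \<Sigma> \<delta> \<Gamma>)" for \<Xi> \<Sigma> \<delta> \<Gamma>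
  proof (induction \<Gamma>)
    case Nil
    show ?case by (subst 3, subst ctx_ok.simps) (simp add: ctx_ok_op_def)
  next
    case (Cons b \<Gamma>)
    then show ?case by (subst 3, subst ctx_ok.simps) (cases b; simp add: ctx_ok_op_def)
  qed
  then show ?case by (cases p) auto
qed

section \<open>Decidability of guardedness\<close>

text \<open>The condition that \<open>guarded\<close> imposes on a single path. It depends only on
  the set of constructors, which is what allows repetitions to be dropped.\<close>

definition good_cons :: "sig \<Rightarrow> nat list \<Rightarrow> bool" where
  "good_cons \<Sigma> cs \<longleftrightarrow> (\<exists>c\<in>set cs. coinductive_con \<Sigma> c \<and>
     (\<exists>p. con_prio \<Sigma> c = Some p \<and> (\<forall>c'\<in>set cs. \<exists>p'. con_prio \<Sigma> c' = Some p' \<and> p' \<le> p)))"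

text \<open>A state of the search is a spine, whose first argument is a term to be explored, together with the
  constructors passed so far, without repetitions.\<close>

definition succs :: "sig \<Rightarrow> nat \<Rightarrow> spine \<times> nat list \<Rightarrow> (spine \<times> nat list) list" where
  "succs \<Sigma> r z = (case fst z of
      SNil \<Rightarrow> []
    | SPre y S \<Rightarrow> [(S, snd z)]
    | SArg M S \<Rightarrow> (S, snd z) # (case M of
          Lam N \<Rightarrow> [(SArg N SNil, snd z)]
        | Neu R \<Rightarrow> (case R of App H T \<Rightarrow> (case H of
              Var x \<Rightarrow> [(T, snd z)]
            | Con c \<Rightarrow> [(T, if c \<in> set (snd z) then snd z else c # snd z)]
            | Rec r' \<Rightarrow> (T, snd z) # (if r' = r then [] else (case rec_def \<Sigma> r' of
                None \<Rightarrow> [] | Some d \<Rightarrow> [(SArg (snd d) SNil, snd z)]))))))"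

definition at_rec :: "nat \<Rightarrow> spine \<Rightarrow> bool" where
  "at_rec r S \<longleftrightarrow> (case S of SNil \<Rightarrow> False | SPre y S \<Rightarrow> False | SArg M S \<Rightarrow> (case M of Lam N \<Rightarrow> False
    | Neu R \<Rightarrow> (case R of App H T \<Rightarrow> H = Rec r)))"

abbreviation reach :: "sig \<Rightarrow> nat \<Rightarrow> spine \<times> nat list \<Rightarrow> spine \<times> nat list \<Rightarrow> bool" where
  "reach \<Sigma> r \<equiv> (\<lambda>z z'. z' \<in> set (succs \<Sigma> r z))\<^sup>*\<^sup>*"

definition reaches_rec :: "sig \<Rightarrow> nat \<Rightarrow> spine \<times> nat list \<Rightarrow> nat set \<Rightarrow> bool" where
  "reaches_rec \<Sigma> r z C \<longleftrightarrow> (\<exists>z'. reach \<Sigma> r z z' \<and> at_rec r (fst z') \<and> set (snd z') = C)"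

lemma reaches_rec_step: "z' \<in> set (succs \<Sigma> r z) \<Longrightarrow> reaches_rec \<Sigma> r z' C \<Longrightarrow> reaches_rec \<Sigma> r z C"
  unfolding reaches_rec_def by (auto intro: converse_rtranclp_into_rtranclp)

text \<open>The constructors \<open>s\<close> collected so far and the arguments after the current
  one are generalised, since a path may enter a subterm with any values of these.\<close>

lemma path_reach:
  "path_tm \<Sigma> r M cs \<Longrightarrow> \<forall>S s. reaches_rec \<Sigma> r (SArg M S, s) (set s \<union> set cs)"
  "path_neu \<Sigma> r R cs \<Longrightarrow> \<forall>S s. reaches_rec \<Sigma> r (SArg (Neu R) S, s) (set s \<union> set cs)"
  "path_spine \<Sigma> r S cs \<Longrightarrow> \<forall>s. reaches_rec \<Sigma> r (S, s) (set s \<union> set cs)"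
proof (induction rule: path_tm_path_neu_path_spine.inducts)
  fix M cs assume IH: "\<forall>S s. reaches_rec \<Sigma> r (SArg M S, s) (set s \<union> set cs)"
  show "\<forall>S s. reaches_rec \<Sigma> r (SArg (Lam M) S, s) (set s \<union> set cs)"
    by (intro allI, rule reaches_rec_step[OF _ IH[rule_format, of SNil]]) (simp add: succs_def)
next
  fix T
  show "\<forall>S s. reaches_rec \<Sigma> r (SArg (Neu (App (Rec r) T)) S, s) (set s \<union> set [])"
    unfolding reaches_rec_def
  proof (intro allI exI conjI)
    fix S s
    show "reach \<Sigma> r (SArg (Neu (App (Rec r) T)) S, s) (SArg (Neu (App (Rec r) T)) S, s)" by simp
  qed (simp_all add: at_rec_def)
next
  fix r' A M cs S
  assume r': "r' \<noteq> r" "rec_def \<Sigma> r' = Some (A, M)" and IH: "\<forall>S s. reaches_rec \<Sigma> r (SArg M S, s) (set s \<union> set cs)"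
  show "\<forall>S' s. reaches_rec \<Sigma> r (SArg (Neu (App (Rec r') S)) S', s) (set s \<union> set cs)"
    by (intro allI, rule reaches_rec_step[OF _ IH[rule_format, of SNil]]) (simp add: succs_def r')
next
  fix T cs c assume IH: "\<forall>s. reaches_rec \<Sigma> r (T, s) (set s \<union> set cs)"
  show "\<forall>S s. reaches_rec \<Sigma> r (SArg (Neu (App (Con c) T)) S, s) (set s \<union> set (c # cs))"
  proof (intro allI)
    fix S s
    have "set (if c \<in> set s then s else c # s) \<union> set cs = set s \<union> set (c # cs)" by auto
    with IH have "reaches_rec \<Sigma> r (T, if c \<in> set s then s else c # s) (set s \<union> set (c # cs))" by metis
    then show "reaches_rec \<Sigma> r (SArg (Neu (App (Con c) T)) S, s) (set s \<union> set (c # cs))"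
      by (rule reaches_rec_step[rotated]) (simp add: succs_def)
  qed
next
  fix T cs x assume IH: "\<forall>s. reaches_rec \<Sigma> r (T, s) (set s \<union> set cs)"
  show "\<forall>S s. reaches_rec \<Sigma> r (SArg (Neu (App (Var x) T)) S, s) (set s \<union> set cs)"
    by (intro allI, rule reaches_rec_step[OF _ IH[rule_format]]) (simp add: succs_def)
next
  fix T cs r' assume IH: "\<forall>s. reaches_rec \<Sigma> r (T, s) (set s \<union> set cs)"
  show "\<forall>S s. reaches_rec \<Sigma> r (SArg (Neu (App (Rec r') T)) S, s) (set s \<union> set cs)"
    by (intro allI, rule reaches_rec_step[OF _ IH[rule_format]]) (simp add: succs_def)
next
  fix S cs M assume IH: "\<forall>s. reaches_rec \<Sigma> r (S, s) (set s \<union> set cs)"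
  show "\<forall>s. reaches_rec \<Sigma> r (SArg M S, s) (set s \<union> set cs)"
    by (intro allI, rule reaches_rec_step[OF _ IH[rule_format]]) (simp add: succs_def)
next
  fix S cs y assume IH: "\<forall>s. reaches_rec \<Sigma> r (S, s) (set s \<union> set cs)"
  show "\<forall>s. reaches_rec \<Sigma> r (SPre y S, s) (set s \<union> set cs)"
    by (intro allI, rule reaches_rec_step[OF _ IH[rule_format]]) (simp add: succs_def)
qed blast+

lemma path_spine_SArg_SNil: "path_spine \<Sigma> r (SArg M SNil) cs \<Longrightarrow> path_tm \<Sigma> r M cs"
  by (erule path_spine.cases) (auto elim: path_spine.cases)

text \<open>A search step is undone: a path from the successor extends backwards to one from the
  state itself. A constructor passed before is not recorded again, so the constructor sets agree
  only after union with the collected ones.\<close>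

lemma succs_path:
  assumes "z' \<in> set (succs \<Sigma> r z)" "path_spine \<Sigma> r (fst z') cs"
  shows "\<exists>cs'. path_spine \<Sigma> r (fst z) cs' \<and> set (snd z) \<union> set cs' = set (snd z') \<union> set cs"
proof (cases "fst z")
  case SNil
  with assms show ?thesis by (simp add: succs_def)
next
  case (SPre y S)
  with assms show ?thesis by (intro exI[of _ cs]) (auto simp: succs_def intro: path_tm_path_neu_path_spine.intros)
next
  case (SArg M S)
  show ?thesis
  proof (cases "z' = (S, snd z)")
    case True
    with assms SArg show ?thesis
      by (intro exI[of _ cs]) (auto intro: path_tm_path_neu_path_spine.intros)
  next
    case z': False
    show ?thesis
    proof (cases M)
      case (Lam N)
      with z' assms SArg have "z' = (SArg N SNil, snd z)" by (simp add: succs_def)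
      with assms(2) have "path_tm \<Sigma> r N cs" by (simp add: path_spine_SArg_SNil)
      then have "path_spine \<Sigma> r (SArg (Lam N) S) cs" by (intro path_tm_path_neu_path_spine.intros)
      with \<open>z' = _\<close> show ?thesis by (auto simp: SArg Lam)
    next
      case (Neu R)
      obtain H T where R: "R = App H T" by (cases R)
      have lift: "path_spine \<Sigma> r (fst z) cs'" if "path_neu \<Sigma> r (App H T) cs'" for cs'
        using that unfolding SArg Neu R by (intro path_tm_path_neu_path_spine.intros)
      show ?thesis
      proof (cases H)
        case (Var x)
        with z' assms SArg Neu R have "z' = (T, snd z)" by (simp add: succs_def)
        with assms(2) have "path_neu \<Sigma> r (App H T) cs"
          unfolding Var by (intro path_tm_path_neu_path_spine.intros) simp
        with lift \<open>z' = _\<close> show ?thesis by auto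
      next
        case (Con c)
        with z' assms SArg Neu R have "z' = (T, if c \<in> set (snd z) then snd z else c # snd z)" by (simp add: succs_def)
        with assms(2) have "path_neu \<Sigma> r (App H T) (c # cs)"
          unfolding Con by (intro path_tm_path_neu_path_spine.intros) simp
        with lift \<open>z' = _\<close> show ?thesis by (intro exI[of _ "c # cs"]) auto
      next
        case (Rec r')
        have "path_neu \<Sigma> r (App H T) cs \<and> snd z' = snd z"
        proof (cases "z' = (T, snd z)")
          case True
          with assms(2) have "path_spine \<Sigma> r T cs" by simp
          with True show ?thesis unfolding Rec by (auto intro: path_tm_path_neu_path_spine.intros)
        next
          case False
          have "r' \<noteq> r" using False z' assms(1) SArg Neu R Rec by (auto simp: succs_def)
          with False z' assms(1) SArg Neu R Rec obtain d where
            d: "r' \<noteq> r" "rec_def \<Sigma> r' = Some d" "z' = (SArg (snd d) SNil, snd z)"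
            by (cases "rec_def \<Sigma> r'") (simp_all add: succs_def)
          with assms(2) have "path_tm \<Sigma> r (snd d) cs" by (simp add: path_spine_SArg_SNil)
          with d show ?thesis unfolding Rec
            by (cases d) (auto intro: path_tm_path_neu_path_spine.intros(4))
        qed
        with lift show ?thesis by auto
      qed
    qed
  qed
qed

lemma reach_path:
  "reach \<Sigma> r z z' \<Longrightarrow> at_rec r (fst z') \<Longrightarrow>
    \<exists>cs. path_spine \<Sigma> r (fst z) cs \<and> set (snd z') = set (snd z) \<union> set cs"
proof (induction rule: converse_rtranclp_induct)
  case base
  then obtain S T where "fst z' = SArg (Neu (App (Rec r) T)) S"
    by (auto simp: at_rec_def split: spine.splits tm.splits neu.splits)
  then have "path_spine \<Sigma> r (fst z') []" by (auto intro: path_tm_path_neu_path_spine.intros)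
  then show ?case by (intro exI[of _ "[]"]) simp
next
  case (step y z)
  then obtain cs where cs: "path_spine \<Sigma> r (fst z) cs" "set (snd z') = set (snd z) \<union> set cs" by blast
  from succs_path[OF step(1) cs(1)] cs(2) show ?case by auto
qed

definition search_ok :: "sig \<Rightarrow> nat \<Rightarrow> spine \<times> nat list \<Rightarrow> bool" where
  "search_ok \<Sigma> r z \<longleftrightarrow> (at_rec r (fst z) \<longrightarrow> good_cons \<Sigma> (snd z))"

lemma good_cons_cong: "set cs = set cs' \<Longrightarrow> good_cons \<Sigma> cs = good_cons \<Sigma> cs'"
  by (simp add: good_cons_def)

text \<open>There may be infinitely many paths through recursion constants, but a search state keeps
  all that the condition needs to know about the paths leading to it.\<close>

lemma guarded_iff_reach: "guarded \<Sigma> r M \<longleftrightarrow> (\<forall>z. reach \<Sigma> r (SArg M SNil, []) z \<longrightarrow> search_ok \<Sigma> r z)"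
proof
  assume g: "guarded \<Sigma> r M"
  show "\<forall>z. reach \<Sigma> r (SArg M SNil, []) z \<longrightarrow> search_ok \<Sigma> r z"
  proof (intro allI impI, unfold search_ok_def, intro impI)
    fix z assume "reach \<Sigma> r (SArg M SNil, []) z" "at_rec r (fst z)"
    from reach_path[OF this] obtain cs where cs: "path_spine \<Sigma> r (SArg M SNil) cs" "set (snd z) = set cs" by auto
    from path_spine_SArg_SNil[OF cs(1)] g have "good_cons \<Sigma> cs" by (simp add: guarded_def good_cons_def)
    with good_cons_cong[OF cs(2)] show "good_cons \<Sigma> (snd z)" by simp
  qed
next
  assume ok: "\<forall>z. reach \<Sigma> r (SArg M SNil, []) z \<longrightarrow> search_ok \<Sigma> r z"
  have "good_cons \<Sigma> cs" if "path_tm \<Sigma> r M cs" for cs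
  proof -
    have "reaches_rec \<Sigma> r (SArg M SNil, []) (set [] \<union> set cs)" using path_reach(1)[OF that] by blast
    then obtain z where z: "reach \<Sigma> r (SArg M SNil, []) z" "at_rec r (fst z)" "set (snd z) = set cs"
      by (auto simp: reaches_rec_def)
    with ok have "good_cons \<Sigma> (snd z)" unfolding search_ok_def by blast
    with good_cons_cong[OF z(3)] show ?thesis by simp
  qed
  then show "guarded \<Sigma> r M" by (simp add: guarded_def good_cons_def)
qed

text \<open>Besides proper subspines, the set contains the spines \<open>SArg M SNil\<close> that
  the search forms below abstractions, with their tails. It is thus closed under all steps of
  \<open>succs\<close> except unfolding.\<close>

primrec sp_tm :: "tm \<Rightarrow> spine set" and sp_neu :: "neu \<Rightarrow> spine set" and sp_spine :: "spine \<Rightarrow> spine set" where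
  "sp_tm (Neu R) = sp_neu R"
| "sp_tm (Lam M) = insert (SArg M SNil) (insert SNil (sp_tm M))"
| "sp_neu (App H S) = insert S (sp_spine S)"
| "sp_spine SNil = {}"
| "sp_spine (SArg M S) = insert S (sp_tm M \<union> sp_spine S)"
| "sp_spine (SPre y S) = insert S (sp_spine S)"

primrec cn_tm :: "tm \<Rightarrow> nat set" and cn_neu :: "neu \<Rightarrow> nat set" and cn_spine :: "spine \<Rightarrow> nat set" where
  "cn_tm (Neu R) = cn_neu R"
| "cn_tm (Lam M) = cn_tm M"
| "cn_neu (App H S) = (case H of Con c \<Rightarrow> insert c (cn_spine S) | _ \<Rightarrow> cn_spine S)"
| "cn_spine SNil = {}"
| "cn_spine (SArg M S) = cn_tm M \<union> cn_spine S"
| "cn_spine (SPre y S) = cn_spine S"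

lemma finite_sp: "finite (sp_tm M)" "finite (sp_neu R)" "finite (sp_spine S)"
  by (induction M and R and S) auto

lemma finite_cn: "finite (cn_tm M)" "finite (cn_neu R)" "finite (cn_spine S)"
  by (induction M and R and S) (auto split: head.split)

text \<open>Unfolding in \<open>succs\<close> enters a body literally, without substitution, so all
  states stem from \<open>M\<close> and the finitely many bodies in \<Sigma>. The recorded
  constructors form a list without repetitions over a finite set, and such lists are finite in
  number.\<close>

lemma finite_reach: "finite {z. reach \<Sigma> r (SArg M SNil, []) z}"
proof -
  define \<M> where "\<M> = insert M (\<Union>d\<in>set \<Sigma>. case d of RecDecl r A N \<Rightarrow> {N} | _ \<Rightarrow> {})"
  define X where "X = insert SNil (\<Union>N\<in>\<M>. insert (SArg N SNil) (sp_tm N))"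
  define C where "C = (\<Union>N\<in>\<M>. cn_tm N)"
  have "finite \<M>" unfolding \<M>_def by (auto split: decl.split)
  then have fin: "finite X" "finite C" by (auto simp: X_def C_def finite_sp finite_cn)
  have body: "insert (SArg (snd d) SNil) (insert SNil (sp_tm (snd d))) \<subseteq> X \<and> cn_tm (snd d) \<subseteq> C"
    if d: "rec_def \<Sigma> r' = Some d" for r' d
  proof -
    have "snd d \<in> \<M>" using rec_def_in_set[of \<Sigma> r' "fst d" "snd d"] d unfolding \<M>_def by force
    then show ?thesis by (auto simp: X_def C_def)
  qed
  let ?inv = "\<lambda>z. insert (fst z) (sp_spine (fst z)) \<subseteq> X \<and> cn_spine (fst z) \<subseteq> C \<and> distinct (snd z) \<and> set (snd z) \<subseteq> C"
  have inv_step: "?inv z'" if z: "?inv z" and z': "z' \<in> set (succs \<Sigma> r z)" for z z'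
  proof (cases "fst z")
    case SNil
    with z' show ?thesis by (simp add: succs_def)
  next
    case (SPre y S)
    with z z' show ?thesis by (auto simp: succs_def)
  next
    case (SArg M S)
    show ?thesis
    proof (cases M)
      case (Lam N)
      with z z' SArg show ?thesis by (auto simp: succs_def)
    next
      case (Neu R)
      obtain H T where R: "R = App H T" by (cases R)
      show ?thesis
      proof (cases H)
        case (Var x)
        with z z' SArg Neu R show ?thesis by (auto simp: succs_def)
      next
        case (Con c)
        with z z' SArg Neu R show ?thesis by (auto simp: succs_def split: if_splits)
      next
        case (Rec r')
        show ?thesis
        proof (cases "\<exists>d. rec_def \<Sigma> r' = Some d \<and> z' = (SArg (snd d) SNil, snd z)")
          case True
          then obtain d where d: "rec_def \<Sigma> r' = Some d" "z' = (SArg (snd d) SNil, snd z)" by blast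
          with body[OF d(1)] z show ?thesis by simp
        next
          case False
          with z' SArg Neu R Rec have "z' = (S, snd z) \<or> z' = (T, snd z)"
            by (cases "rec_def \<Sigma> r'") (auto simp: succs_def split: if_splits)
          with z SArg Neu R Rec show ?thesis by auto
        qed
      qed
    qed
  qed
  have inv: "?inv z" if "reach \<Sigma> r (SArg M SNil, []) z" for z
    using that
  proof (induction)
    case base
    have "M \<in> \<M>" by (simp add: \<M>_def)
    then show ?case by (auto simp: X_def C_def)
  next
    case (step z z')
    from inv_step[OF step(3) step(2)] show ?case .
  qed
  have "z \<in> X \<times> {s. set s \<subseteq> C \<and> distinct s}" if "reach \<Sigma> r (SArg M SNil, []) z" for z
    using inv[OF that] by (cases z) simp
  then have "{z. reach \<Sigma> r (SArg M SNil, []) z} \<subseteq> X \<times> {s. set s \<subseteq> C \<and> distinct s}" by blast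
  then show ?thesis
    by (rule finite_subset) (intro finite_SigmaI fin finite_subset_distinct)
qed

definition all_succs :: "sig \<Rightarrow> nat \<Rightarrow> (spine \<times> nat list) list \<Rightarrow> (spine \<times> nat list) list" where
  "all_succs \<Sigma> r V = concat (map (succs \<Sigma> r) V)"

text \<open>Breadth-first saturation: the visited states are enlarged by all their successors until
  nothing new appears, and only then are they inspected.\<close>

definition guarded_op :: "(sig \<times> nat \<times> (spine \<times> nat list) list \<Rightarrow> bool option) \<Rightarrow>
    sig \<times> nat \<times> (spine \<times> nat list) list \<Rightarrow> bool option" where
  "guarded_op h = (\<lambda>(\<Sigma>, r, V). if \<forall>z\<in>set (all_succs \<Sigma> r V). z \<in> set V
     then Some (\<forall>z\<in>set V. search_ok \<Sigma> r z) else h (\<Sigma>, r, all_succs \<Sigma> r V @ V))"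

lemma guarded_op_fixpoint:
  assumes h: "\<And>z. h z = guarded_op h z"
  shows "h (\<Sigma>, r, [(SArg M SNil, [])]) = Some (guarded \<Sigma> r M)"
proof -
  let ?i = "(SArg M SNil, []) :: spine \<times> nat list"
  let ?A = "{z. reach \<Sigma> r ?i z}"
  have set_succs: "set (all_succs \<Sigma> r V) = (\<Union>z\<in>set V. set (succs \<Sigma> r z))" for V
    by (simp add: all_succs_def)
  have "?i \<in> set V \<Longrightarrow> set V \<subseteq> ?A \<Longrightarrow> h (\<Sigma>, r, V) = Some (guarded \<Sigma> r M)" for V
  \<comment> \<open>The number of reachable states not yet visited drops in every round except the
    last.\<close>
  proof (induction "card (?A - set V)" arbitrary: V rule: less_induct)
    case less
    show ?case
    proof (cases "\<forall>z\<in>set (all_succs \<Sigma> r V). z \<in> set V")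
      case True
      have "z \<in> set V" if "reach \<Sigma> r ?i z" for z
        using that
      proof induction
        case base show ?case by (rule less.prems(1))
      next
        case (step y z)
        from step(2,3) have "z \<in> set (all_succs \<Sigma> r V)" unfolding set_succs by (rule UN_I[rotated])
        with True show ?case by (rule bspec)
      qed
      with less.prems(2) have "set V = ?A" by blast
      then have "(\<forall>z\<in>set V. search_ok \<Sigma> r z) \<longleftrightarrow> guarded \<Sigma> r M" unfolding guarded_iff_reach by blast
      then show ?thesis by (subst h) (simp only: guarded_op_def prod.case if_P[OF True])
    next
      case False
      let ?V = "all_succs \<Sigma> r V @ V"
      have sub: "set ?V \<subseteq> ?A"
      proof
        fix z assume "z \<in> set ?V"
        then consider "z \<in> set V" | y where "y \<in> set V" "z \<in> set (succs \<Sigma> r y)"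
          unfolding set_append set_succs by blast
        then show "z \<in> ?A"
        proof cases
          case 1 with less.prems(2) show ?thesis by blast
        next
          case (2 y)
          from less.prems(2) 2(1) have "reach \<Sigma> r ?i y" by blast
          from rtranclp.rtrancl_into_rtrancl[OF this, of z] 2(2) show ?thesis by simp
        qed
      qed
      from False obtain z where "z \<in> set (all_succs \<Sigma> r V)" "z \<notin> set V" by blast
      with sub have "?A - set ?V \<subset> ?A - set V" unfolding set_append by blast
      then have "card (?A - set ?V) < card (?A - set V)"
        by (intro psubset_card_mono finite_Diff finite_reach)
      from less.hyps[OF this _ sub] less.prems(1) have "h (\<Sigma>, r, ?V) = Some (guarded \<Sigma> r M)" by simp
      then show ?thesis by (subst h) (simp only: guarded_op_def prod.case if_not_P[OF False])
    qed
  qed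
  from this[of "[?i]"] show ?thesis by simp
qed

lemma eff_con_prio [eff_intros]: "effective f \<Longrightarrow> effective g \<Longrightarrow> effective (\<lambda>e. con_prio (f e) (g e))"
  by (rule eff_app2) (unfold con_prio_def, intro eff_intros)

lemma eff_coinductive_con [eff_intros]:
  assumes "effective f" "effective g" shows "effective (\<lambda>e. coinductive_con (f e) (g e))"
proof (rule eff_app2[OF _ assms])
  have eq: "coinductive_con \<Sigma> c \<longleftrightarrow> (case con_type \<Sigma> c of None \<Rightarrow> False
    | Some A \<Rightarrow> (case fam_kind \<Sigma> (target A) of None \<Rightarrow> False | Some K \<Rightarrow> cotype_kind K))" for \<Sigma> c
    by (auto simp: coinductive_con_def split: option.split)
  show "effective (\<lambda>p. coinductive_con (fst p) (snd p))" unfolding eq by (intro eff_intros)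
qed

lemma eff_good_cons [eff_intros]:
  assumes "effective f" "effective g" shows "effective (\<lambda>e. good_cons (f e) (g e))"
proof (rule eff_app2[OF _ assms])
  have eq: "good_cons \<Sigma> cs \<longleftrightarrow> (\<exists>c\<in>set cs. coinductive_con \<Sigma> c \<and> (case con_prio \<Sigma> c of None \<Rightarrow> False
    | Some p \<Rightarrow> (\<forall>c'\<in>set cs. case con_prio \<Sigma> c' of None \<Rightarrow> False | Some p' \<Rightarrow> p' \<le> p)))" for \<Sigma> cs
  proof -
    have ex_Some: "(\<exists>p. m = Some p \<and> Q p) \<longleftrightarrow> (case m of None \<Rightarrow> False | Some p \<Rightarrow> Q p)" for m :: "nat option" and Q
      by (cases m) auto
    show ?thesis unfolding good_cons_def ex_Some ..
  qed
  show "effective (\<lambda>p. good_cons (fst p) (snd p))"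
    unfolding eq by (intro eff_intros eff_list_ex eff_list_all)
qed

lemma eff_at_rec [eff_intros]: "effective f \<Longrightarrow> effective g \<Longrightarrow> effective (\<lambda>e. at_rec (f e) (g e))"
  by (rule eff_app2) (unfold at_rec_def, intro eff_intros)

lemma eff_search_ok [eff_intros]:
  "effective f \<Longrightarrow> effective g \<Longrightarrow> effective h \<Longrightarrow> effective (\<lambda>e. search_ok (f e) (g e) (h e))"
  by (rule eff_app3) (unfold search_ok_def, intro eff_intros)

lemma eff_succs [eff_intros]:
  "effective f \<Longrightarrow> effective g \<Longrightarrow> effective h \<Longrightarrow> effective (\<lambda>e. succs (f e) (g e) (h e))"
  by (rule eff_app3) (unfold succs_def, intro eff_intros)

lemma eff_all_succs [eff_intros]:
  assumes "effective f" "effective g" "effective k" shows "effective (\<lambda>e. all_succs (f e) (g e) (k e))"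
proof (rule eff_app3[OF _ assms], rule eff_rec[where t = "\<lambda>p. p" and F = "\<lambda>h p. case snd (snd p) of
      [] \<Rightarrow> Some []
    | z # V \<Rightarrow> Option.bind (h (fst p, fst (snd p), V)) (\<lambda>W. Some (succs (fst p) (fst (snd p)) z @ W))"], goal_cases)
  case (3 h p)
  have "h (\<Sigma>, r, V) = Some (all_succs \<Sigma> r V)" for \<Sigma> r V
    by (induction V) (subst 3, simp add: all_succs_def)+
  then show ?case by (cases p) auto
qed (intro eff_intros)+

lemma eff_guarded [eff_intros]:
  assumes "effective f" "effective g" "effective k" shows "effective (\<lambda>e. guarded (f e) (g e) (k e))"
proof (rule eff_app3[OF _ assms],
    rule eff_rec[where t = "\<lambda>p. (fst p, fst (snd p), [(SArg (snd (snd p)) SNil, [])])" and F = guarded_op], goal_cases)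
  case 1 show ?case unfolding guarded_op_def by (intro eff_intros eff_list_all)
next
  case 2 show ?case by (intro eff_intros)
next
  case (3 h p)
  show ?case by (rule guarded_op_fixpoint[OF 3])
qed

section \<open>Decidability of signature formation\<close>

text \<open>Deferred checks of bodies consult the full signature \<Sigma>, which is a fixed
  parameter, so signature formation remains a recursion on \<Xi> without a second phase.\<close>

definition decl_ok :: "sig \<Rightarrow> sig \<Rightarrow> decl \<Rightarrow> bool" where
  "decl_ok \<Sigma> \<Xi> d \<longleftrightarrow> (case d of
      FamDecl a K \<Rightarrow> fam_kind \<Xi> a = None \<and> check_kind \<Xi> \<Sigma> False [] K
    | ConDecl c A \<Rightarrow> con_type \<Xi> c = None \<and> check_ty \<Xi> \<Sigma> False [] A
    | RecDecl r A M \<Rightarrow> rec_def \<Xi> r = None \<and> check_ty \<Xi> \<Sigma> False [] A \<and> prepattern_ty A \<and> contractive M \<and>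
        guarded \<Sigma> r M \<and> chk \<Xi> \<Sigma> True [] M A)"

lemma sig_ok_Cons: "sig_ok \<Sigma> (d # \<Xi>) \<longleftrightarrow> sig_ok \<Sigma> \<Xi> \<and> decl_ok \<Sigma> \<Xi> d"
  by (subst sig_ok.simps) (cases d; auto simp: decl_ok_def check_tm_iff_chk)

lemma eff_decl_ok [eff_intros]:
  assumes "effective f" "effective g" "effective k" shows "effective (\<lambda>e. decl_ok (f e) (g e) (k e))"
proof (rule eff_app3[OF _ assms], rule op_effective)
  have eq: "Some (decl_ok \<Sigma> \<Xi> d) = (case d of
      FamDecl a K \<Rightarrow> Some (fam_kind \<Xi> a = None \<and> check_kind \<Xi> \<Sigma> False [] K)
    | ConDecl c A \<Rightarrow> Some (con_type \<Xi> c = None \<and> check_ty \<Xi> \<Sigma> False [] A)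
    | RecDecl r A M \<Rightarrow> Some (rec_def \<Xi> r = None \<and> check_ty \<Xi> \<Sigma> False [] A \<and> prepattern_ty A \<and> contractive M \<and>
        guarded \<Sigma> r M \<and> chk \<Xi> \<Sigma> True [] M A))" for \<Sigma> \<Xi> d
    by (cases d) (simp_all add: decl_ok_def)
  show "eff_op (\<lambda>(g :: nat \<Rightarrow> nat option) p. Some (decl_ok (fst p) (fst (snd p)) (snd (snd p))))"
    unfolding eq by (intro eff_intros)
qed

lemma eff_sig_ok [eff_intros]:
  assumes "effective f" "effective g" shows "effective (\<lambda>e. sig_ok (f e) (g e))"
proof (rule eff_app2[OF _ assms], rule eff_rec[where t = "\<lambda>p. p" and F = "\<lambda>h p. case snd p of
      [] \<Rightarrow> Some True | d # \<Xi> \<Rightarrow> Option.bind (h (fst p, \<Xi>)) (\<lambda>b. Some (b \<and> decl_ok (fst p) \<Xi> d))"], goal_cases)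
  case (3 h p)
  have "h (\<Sigma>, \<Xi>) = Some (sig_ok \<Sigma> \<Xi>)" for \<Sigma> \<Xi>
    by (induction \<Xi>) (subst 3, simp add: sig_ok_Cons sig_ok.intros)+
  then show ?case by (cases p) auto
qed (intro eff_intros)+

text \<open>Uniqueness of the output comes from exhibiting the judgment as the graph of an
  option-valued function.\<close>

lemma decidable_synthI:
  fixes g :: "'a::godel \<Rightarrow> 'b::godel_re option"
  assumes "effective g" "\<And>x y. J x y \<longleftrightarrow> g x = Some y"
  shows "decidable_synth J"
  unfolding decidable_synth_def using eff_computable[OF assms(1)] assms(2) by blast

theorem theorem5:
  shows "decidable (\<lambda>\<Sigma>. sig_valid \<Sigma>)
    \<and> decidable (\<lambda>(\<Sigma>, \<Xi>). sig_ok \<Sigma> \<Xi>)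
    \<and> decidable (\<lambda>(\<Xi>, \<Sigma>, \<delta>, \<Gamma>). ctx_ok \<Xi> \<Sigma> \<delta> \<Gamma>)
    \<and> decidable (\<lambda>(\<Xi>, \<Sigma>, \<delta>, \<Gamma>, K). check_kind \<Xi> \<Sigma> \<delta> \<Gamma> K)
    \<and> decidable (\<lambda>(\<Xi>, \<Sigma>, \<delta>, \<Gamma>, A). check_ty \<Xi> \<Sigma> \<delta> \<Gamma> A)
    \<and> decidable (\<lambda>(\<Xi>, \<Sigma>, \<delta>, \<Gamma>, M, A). check_tm \<Xi> \<Sigma> \<delta> \<Gamma> M A)
    \<and> decidable (\<lambda>(\<Sigma>, \<Gamma>, A1, A2). ty_eq \<Sigma> \<Gamma> A1 A2)
    \<and> decidable (\<lambda>(\<Sigma>, \<Gamma>, P1, P2). aty_eq \<Sigma> \<Gamma> P1 P2)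
    \<and> decidable_synth (\<lambda>(\<Xi>, \<Sigma>, \<delta>, \<Gamma>, P) K. synth_aty \<Xi> \<Sigma> \<delta> \<Gamma> P K)
    \<and> decidable_synth (\<lambda>(\<Xi>, \<Sigma>, \<delta>, \<Gamma>, S, K) K'. kind_spine \<Xi> \<Sigma> \<delta> \<Gamma> S K K')
    \<and> decidable_synth (\<lambda>(\<Xi>, \<Sigma>, \<delta>, \<Gamma>, R) P. synth_neu \<Xi> \<Sigma> \<delta> \<Gamma> R P)
    \<and> decidable_synth (\<lambda>(\<Xi>, \<Sigma>, \<delta>, \<Gamma>, S, A) P. ty_spine \<Xi> \<Sigma> \<delta> \<Gamma> S A P)"
proof (intro conjI)
  show "decidable (\<lambda>\<Sigma>. sig_valid \<Sigma>)"
    "decidable (\<lambda>(\<Sigma>, \<Xi>). sig_ok \<Sigma> \<Xi>)"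
    "decidable (\<lambda>(\<Xi>, \<Sigma>, \<delta>, \<Gamma>). ctx_ok \<Xi> \<Sigma> \<delta> \<Gamma>)"
    "decidable (\<lambda>(\<Xi>, \<Sigma>, \<delta>, \<Gamma>, K). check_kind \<Xi> \<Sigma> \<delta> \<Gamma> K)"
    "decidable (\<lambda>(\<Xi>, \<Sigma>, \<delta>, \<Gamma>, A). check_ty \<Xi> \<Sigma> \<delta> \<Gamma> A)"
    "decidable (\<lambda>(\<Xi>, \<Sigma>, \<delta>, \<Gamma>, M, A). check_tm \<Xi> \<Sigma> \<delta> \<Gamma> M A)"
    "decidable (\<lambda>(\<Sigma>, \<Gamma>, A1, A2). ty_eq \<Sigma> \<Gamma> A1 A2)"
    "decidable (\<lambda>(\<Sigma>, \<Gamma>, P1, P2). aty_eq \<Sigma> \<Gamma> P1 P2)"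
    \<comment> \<open>Every algorithm has been registered as an introduction rule, so each claim is
      proved along its own syntax.\<close>
    unfolding sig_valid_def check_tm_iff_chk by (rule eff_decidable, intro eff_intros)+
  show "decidable_synth (\<lambda>(\<Xi>, \<Sigma>, \<delta>, \<Gamma>, P) K. synth_aty \<Xi> \<Sigma> \<delta> \<Gamma> P K)"
    by (rule decidable_synthI[of "\<lambda>(\<Xi>, \<Sigma>, \<delta>, \<Gamma>, P). syn_aty \<Xi> \<Sigma> \<delta> \<Gamma> P"])
      (intro eff_intros, simp add: synth_aty_iff split_beta)
  show "decidable_synth (\<lambda>(\<Xi>, \<Sigma>, \<delta>, \<Gamma>, S, K) K'. kind_spine \<Xi> \<Sigma> \<delta> \<Gamma> S K K')"
    by (rule decidable_synthI[of "\<lambda>(\<Xi>, \<Sigma>, \<delta>, \<Gamma>, S, K). kspn \<Xi> \<Sigma> \<delta> \<Gamma> S K"])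
      (intro eff_intros, simp add: kind_spine_iff_kspn split_beta)
  show "decidable_synth (\<lambda>(\<Xi>, \<Sigma>, \<delta>, \<Gamma>, R) P. synth_neu \<Xi> \<Sigma> \<delta> \<Gamma> R P)"
  proof (rule decidable_synthI[of "\<lambda>(\<Xi>, \<Sigma>, \<delta>, \<Gamma>, R). case R of App H S \<Rightarrow>
      Option.bind (head_ty \<Xi> \<Sigma> \<delta> \<Gamma> H) (\<lambda>A. spn \<Xi> \<Sigma> \<delta> \<Gamma> S A)"])
    show "effective (\<lambda>(\<Xi>, \<Sigma>, \<delta>, \<Gamma>, R). case R of App H S \<Rightarrow>
      Option.bind (head_ty \<Xi> \<Sigma> \<delta> \<Gamma> H) (\<lambda>A. spn \<Xi> \<Sigma> \<delta> \<Gamma> S A))" by (intro eff_intros)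
  qed (simp add: synth_neu_iff_ty_spine ty_spine_iff_spn bind_eq_Some_conv split_beta split: neu.split)
  show "decidable_synth (\<lambda>(\<Xi>, \<Sigma>, \<delta>, \<Gamma>, S, A) P. ty_spine \<Xi> \<Sigma> \<delta> \<Gamma> S A P)"
    by (rule decidable_synthI[of "\<lambda>(\<Xi>, \<Sigma>, \<delta>, \<Gamma>, S, A). spn \<Xi> \<Sigma> \<delta> \<Gamma> S A"])
      (intro eff_intros, simp add: ty_spine_iff_spn split_beta)
qed

end
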